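(* Let $(D_1,\rho_1)$ and $(D_2,\rho_2)$ be two admissible pairs (in the sense of the context). For $j=1,2$ let $F_j=\rho_j\chi_{D_j}$ and let $u_j\in H^1(\Omega)$ be a weak solution of $\Delta u_j+k^2u_j=F_j$ in $\Omega$. If $$\left(u_1|_{\partial\Omega},\frac{\partial u_1}{\partial\nu}\Big|_{\partial\Omega}\right)=\left(u_2|_{\partial\Omega},\frac{\partial u_2}{\partial\nu}\Big|_{\partial\Omega}\right),$$ then $[D_1]=[D_2]$, where $[D]$ denotes the convex hull of $D$.
   Context: $\Omega\subset\mathbb R^2$ is a bounded domain with Lipschitz boundary and unit outward normal $\nu$; $k\ge 0$ is fixed. Function spaces are complex valued, and all pairings and the dot product are bilinear. A pair $(D,\rho)$ is admissible if: $D$ is an open polygon (interior of a simple closed polygonal curve) with $\overline D\subset\Omega$; $\rho\in L^2(D)$; for each vertex $p$ of $D$ there exist an open disk $B(p,\eta)$ centred at $p$ with radius $\eta>0$, a number $0<\alpha\le1$ and a function $\tilde\rho\in C^{0,\alpha}(\overline{B(p,\eta)})$ such that $\rho=\tilde\rho$ on $B(p,\eta)\cap\overline D$ (a.e.) and $\tilde\rho(p)\ne0$. $\chi_D$ is the characteristic function of $D$. $F=\rho\chi_D$ acts by $F(\varphi)=\int_D\rho\varphi\,dx$ for $\varphi\in H^1_0(\Omega)$. Weak solution of $\Delta u+k^2u=F$: $u\in H^1(\Omega)$ with $\int_\Omega\nabla u\cdot\nabla\varphi\,dx-k^2\int_\Omega u\varphi\,dx=-F(\varphi)$ for all $\varphi\in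 H^1_0(\Omega)$. Since $\operatorname{supp}F$ is a compact subset of $\Omega$, put $\tilde F(w)=F(\psi w)$ for $w\in H^1(\Omega)$, where $\psi\in C_0^\infty(\Omega)$ equals $1$ near $\operatorname{supp}F$ (independent of the choice of $\psi$). The Neumann derivative $\partial u/\partial\nu|_{\partial\Omega}$ is the element of the dual of $H^{1/2}(\partial\Omega)$ given by $\langle\partial u/\partial\nu|_{\partial\Omega},g\rangle=\int_\Omega\nabla u\cdot\nabla w\,dx-k^2\int_\Omega uw\,dx+\tilde F(w)$, where $w\in H^1(\Omega)$ is any lifting of $g$. *)

theory Defs
  imports "HOL-Analysis.Analysis"
begin

type_synonym plane = "real^2"
type_synonym cfun = "plane \<Rightarrow> complex"


section \<open>Smooth functions and Lebesgue spaces\<close>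

definition partial_deriv :: "2 \<Rightarrow> cfun \<Rightarrow> cfun" where
  "partial_deriv i f = (\<lambda>x. frechet_derivative f (at x) (axis i 1))"

primrec C_k :: "nat \<Rightarrow> cfun \<Rightarrow> bool" where
  "C_k 0 f \<longleftrightarrow> continuous_on UNIV f"
| "C_k (Suc n) f \<longleftrightarrow> (\<forall>x. f differentiable (at x)) \<and> (\<forall>i. C_k n (partial_deriv i f))"

definition smooth :: "cfun \<Rightarrow> bool" where
  "smooth f \<longleftrightarrow> (\<forall>n. C_k n f)"

(* Smooth functions with compact support in Om, extended by zero to the whole plane. *)
definition test_functions :: "plane set \<Rightarrow> cfun set" where
  "test_functions Om = {f. smooth f \<and> compact (closure {x. f x \<noteq> 0}) \<and> closure {x. f x \<noteq> 0} \<subseteq> Om}"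

definition L2 :: "plane measure \<Rightarrow> cfun set" where
  "L2 M = {f. f \<in> borel_measurable M \<and> integrable M (\<lambda>x. (cmod (f x))\<^sup>2)}"


section \<open>Sobolev spaces\<close>

(* Functions on an open set Om are represented by functions on the plane; the values outside
   Om are irrelevant. *)

definition has_weak_gradient :: "plane set \<Rightarrow> cfun \<Rightarrow> (plane \<Rightarrow> complex^2) \<Rightarrow> bool" where
  "has_weak_gradient Om u G \<longleftrightarrow>
     (\<forall>i. (\<lambda>x. G x $ i) \<in> L2 (lebesgue_on Om)) \<and>
     (\<forall>i. \<forall>f\<in>test_functions Om.
        (LINT x|lebesgue_on Om. u x * partial_deriv i f x) = - (LINT x|lebesgue_on Om. G x $ i * f x))"

definition H1 :: "plane set \<Rightarrow> cfun set" where
  "H1 Om = {u \<in> L2 (lebesgue_on Om). \<exists>G. has_weak_gradient Om u G}"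

(* Unique up to null sets when u is in H1 Om. *)
definition weak_gradient :: "plane set \<Rightarrow> cfun \<Rightarrow> plane \<Rightarrow> complex^2" where
  "weak_gradient Om u = (SOME G. has_weak_gradient Om u G)"

definition H1_norm :: "plane set \<Rightarrow> cfun \<Rightarrow> real" where
  "H1_norm Om u = sqrt ((LINT x|lebesgue_on Om. (cmod (u x))\<^sup>2)
                      + (LINT x|lebesgue_on Om. (norm (weak_gradient Om u x))\<^sup>2))"

definition H1_0 :: "plane set \<Rightarrow> cfun set" where
  "H1_0 Om = {u \<in> H1 Om. \<exists>f. (\<forall>n. f n \<in> test_functions Om) \<and>
                (\<lambda>n::nat. H1_norm Om (\<lambda>x. f n x - u x)) \<longlonglongrightarrow> 0}"


section \<open>Lipschitz domains and arc length on the boundary\<close>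

(* The orthogonal map T chooses local coordinates; since g is an arbitrary Lipschitz function,
   no translation is needed. *)
definition lipschitz_domain :: "plane set \<Rightarrow> bool" where
  "lipschitz_domain Om \<longleftrightarrow> open Om \<and> connected Om \<and> Om \<noteq> {} \<and> bounded Om \<and>
     (\<forall>x\<in>frontier Om. \<exists>r>0. \<exists>(T::plane \<Rightarrow> plane) (g::real \<Rightarrow> real) L.
        orthogonal_transformation T \<and> L-lipschitz_on UNIV g \<and>
        Om \<inter> ball x r = {y \<in> ball x r. T y $ 2 < g (T y $ 1)})"

(* One-dimensional Hausdorff outer measure. Boundedness is required because diameter has no
   meaning on unbounded sets. *)
definition hausdorff1_outer :: "plane set \<Rightarrow> ennreal" where
  "hausdorff1_outer A = (SUP d\<in>{0<..}. INF U\<in>{U :: nat \<Rightarrow> plane set.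
      A \<subseteq> (\<Union>n. U n) \<and> (\<forall>n. bounded (U n) \<and> diameter (U n) \<le> d)}. \<Sum>n. ennreal (diameter (U n)))"

(* hausdorff1_outer is a metric outer measure, hence countably additive on Borel sets, so
   measure_of does not degenerate to the zero measure here. *)
definition hausdorff1 :: "plane measure" where
  "hausdorff1 = measure_of UNIV (sets borel) hausdorff1_outer"

(* On the boundary of a Lipschitz domain, hausdorff1 is arc length. *)
definition boundary_measure :: "plane set \<Rightarrow> plane measure" where
  "boundary_measure Om = restrict_space hausdorff1 (frontier Om)"


section \<open>Traces\<close>

(* g represents the trace of u: the trace operator is the continuous extension to H1 Om, with values
   in L2 of the boundary, of the restriction map on functions smooth up to the boundary. *)
definition has_trace :: "plane set \<Rightarrow> cfun \<Rightarrow> cfun \<Rightarrow> bool" where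
  "has_trace Om u g \<longleftrightarrow> u \<in> H1 Om \<and> g \<in> L2 (boundary_measure Om) \<and>
     (\<exists>f. (\<forall>n. smooth (f n)) \<and>
        (\<lambda>n::nat. H1_norm Om (\<lambda>x. f n x - u x)) \<longlonglongrightarrow> 0 \<and>
        (\<lambda>n. LINT x|boundary_measure Om. (cmod (f n x - g x))\<^sup>2) \<longlonglongrightarrow> 0)"

(* H^{1/2} of the boundary is the range of the trace operator, with the quotient norm. *)
definition H_half :: "plane set \<Rightarrow> cfun set" where
  "H_half Om = {g. \<exists>w. has_trace Om w g}"

definition H_half_norm :: "plane set \<Rightarrow> cfun \<Rightarrow> real" where
  "H_half_norm Om g = Inf {H1_norm Om w | w. has_trace Om w g}"

(* Values of N at arguments outside H_half Om are irrelevant. *)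
definition H_half_dual :: "plane set \<Rightarrow> (cfun \<Rightarrow> complex) set" where
  "H_half_dual Om = {N.
     (\<forall>g\<in>H_half Om. \<forall>h\<in>H_half Om. \<forall>a b. N (\<lambda>x. a * g x + b * h x) = a * N g + b * N h) \<and>
     (\<exists>C. \<forall>g\<in>H_half Om. cmod (N g) \<le> C * H_half_norm Om g)}"


section \<open>The Helmholtz equation with a source\<close>

definition source :: "plane set \<Rightarrow> cfun \<Rightarrow> cfun \<Rightarrow> complex" where
  "source D \<rho> f = (LINT x|lebesgue_on D. \<rho> x * f x)"

(* The dot product of the gradients is bilinear: no complex conjugation. *)
definition helmholtz_form :: "plane set \<Rightarrow> real \<Rightarrow> cfun \<Rightarrow> cfun \<Rightarrow> complex" where
  "helmholtz_form Om k u w =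
     (LINT x|lebesgue_on Om. (\<Sum>i\<in>UNIV. weak_gradient Om u x $ i * weak_gradient Om w x $ i))
     - of_real (k\<^sup>2) * (LINT x|lebesgue_on Om. u x * w x)"

definition weak_solution :: "plane set \<Rightarrow> real \<Rightarrow> (cfun \<Rightarrow> complex) \<Rightarrow> cfun \<Rightarrow> bool" where
  "weak_solution Om k F u \<longleftrightarrow> u \<in> H1 Om \<and> (\<forall>f\<in>H1_0 Om. helmholtz_form Om k u f = - F f)"

definition functional_support :: "plane set \<Rightarrow> (cfun \<Rightarrow> complex) \<Rightarrow> plane set" where
  "functional_support Om F = Om - \<Union>{U. open U \<and> U \<subseteq> Om \<and> (\<forall>f\<in>test_functions U. F f = 0)}"

definition cutoff :: "plane set \<Rightarrow> (cfun \<Rightarrow> complex) \<Rightarrow> cfun \<Rightarrow> bool" where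
  "cutoff Om F \<psi> \<longleftrightarrow> \<psi> \<in> test_functions Om \<and>
     (\<exists>V. open V \<and> functional_support Om F \<subseteq> V \<and> (\<forall>x\<in>V. \<psi> x = 1))"

(* N is the Neumann derivative of the weak solution u of the equation with right-hand side F.
   F (\<psi> w) is the extension of F to w in H1 Om. The value of the right-hand side depends neither
   on the lifting w of g nor on \<psi>, which is why the formula is required for all of them. *)
definition has_neumann_derivative ::
  "plane set \<Rightarrow> real \<Rightarrow> (cfun \<Rightarrow> complex) \<Rightarrow> cfun \<Rightarrow> (cfun \<Rightarrow> complex) \<Rightarrow> bool" where
  "has_neumann_derivative Om k F u N \<longleftrightarrow> N \<in> H_half_dual Om \<and>
     (\<forall>g\<in>H_half Om. \<forall>w \<psi>. has_trace Om w g \<longrightarrow> cutoff Om F \<psi> \<longrightarrow>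
        N g = helmholtz_form Om k u w + F (\<lambda>x. \<psi> x * w x))"

(* The Cauchy data (trace, Neumann derivative) of u are (g, N). *)
definition has_cauchy_data ::
  "plane set \<Rightarrow> real \<Rightarrow> (cfun \<Rightarrow> complex) \<Rightarrow> cfun \<Rightarrow> cfun \<times> (cfun \<Rightarrow> complex) \<Rightarrow> bool" where
  "has_cauchy_data Om k F u = (\<lambda>(g, N). has_trace Om u g \<and> has_neumann_derivative Om k F u N)"


section \<open>Polygons and admissible pairs\<close>

fun polygonal_path :: "plane list \<Rightarrow> real \<Rightarrow> plane" where
  "polygonal_path [] = linepath 0 0"
| "polygonal_path [a] = linepath a a"
| "polygonal_path [a, b] = linepath a b"
| "polygonal_path (a # b # c # ps) = linepath a b +++ polygonal_path (b # c # ps)"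

(* Consecutive vertices are not collinear, so that set ps consists of the genuine corners
   and is determined by D. *)
definition open_polygon :: "plane list \<Rightarrow> plane set \<Rightarrow> bool" where
  "open_polygon ps D \<longleftrightarrow> length ps \<ge> 3 \<and>
     (\<forall>i<length ps. \<not> collinear {ps ! i, ps ! ((i + 1) mod length ps), ps ! ((i + 2) mod length ps)}) \<and>
     simple_path (polygonal_path (ps @ [hd ps])) \<and>
     D = inside (path_image (polygonal_path (ps @ [hd ps])))"

definition holder_on :: "real \<Rightarrow> plane set \<Rightarrow> cfun \<Rightarrow> bool" where
  "holder_on \<alpha> S f \<longleftrightarrow> (\<exists>C. \<forall>x\<in>S. \<forall>y\<in>S. cmod (f x - f y) \<le> C * dist x y powr \<alpha>)"

definition admissible :: "plane set \<Rightarrow> plane set \<Rightarrow> cfun \<Rightarrow> bool" where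
  "admissible Om D \<rho> \<longleftrightarrow> (\<exists>ps. open_polygon ps D \<and> closure D \<subseteq> Om \<and> \<rho> \<in> L2 (lebesgue_on D) \<and>
     (\<forall>p\<in>set ps. \<exists>\<eta>>0. \<exists>\<alpha> \<rho>'. 0 < \<alpha> \<and> \<alpha> \<le> 1 \<and> holder_on \<alpha> (cball p \<eta>) \<rho>' \<and>
        (AE x in lebesgue. x \<in> ball p \<eta> \<inter> closure D \<longrightarrow> \<rho> x = \<rho>' x) \<and> \<rho>' p \<noteq> 0))"

end

theory Submission
  imports Defs "HOL-Computational_Algebra.Polynomial"
begin

text \<open>Let \<open>w\<close> be a smooth solution of the homogeneous Helmholtz equation in the whole plane.
  Testing the Neumann derivatives with \<open>w\<close> and using that \<open>u1\<close> and \<open>u2\<close> have the same trace gives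
  the reciprocity identity \<open>F1 w = F2 w\<close>. If the hulls differ, some vertex \<open>p\<close> of, say, \<open>D1\<close> is
  strictly exposed in a direction \<open>\<omega>\<close> among the points of both polygons and is not in the hull of
  \<open>D2\<close>; near \<open>p\<close> the polygon \<open>D1\<close> is a convex sector. Now take
  \<open>w x = exp (\<tau> \<omega> \<bullet> (x - p) + \<i> sqrt (\<tau>\<^sup>2 + k\<^sup>2) \<omega>' \<bullet> (x - p))\<close> with \<open>\<omega>'\<close> orthogonal to \<open>\<omega>\<close>, and let
  \<open>\<tau>\<close> tend to infinity. After multiplication by \<open>\<tau>\<^sup>2\<close> the part of \<open>F1 w\<close> near \<open>p\<close> converges to the
  density at \<open>p\<close> times a nonzero exponential integral over the sector, while everything else
  decays exponentially, which is a contradiction.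

  The divergence theorem enters only through the bound of the integral of a partial derivative
  over the domain by the \<open>L\<^sup>1\<close> norm on the boundary. It is obtained from difference quotients:
  shifting the domain by \<open>t\<close> changes it only in a tube of width \<open>t\<close> around the boundary.\<close>


section \<open>Smooth cutoff functions\<close>

text \<open>The Cauchy data are stated with Hausdorff measure and limits of smooth functions; they
  involve neither a parametrisation of the boundary nor a normal vector. An inequality in place of
  Green's formula is enough because only differences are compared: with \<open>w\<close> solving the
  Helmholtz equation, the integrand of the form for a smooth \<open>f\<close> is the divergence of
  \<open>f\<close> times the gradient of \<open>w\<close>, and two approximating sequences with the
  same trace have boundary values whose difference tends to 0 in L^1. The same inequality shows that
  classical gradients of smooth functions are weak gradients, as a product with a test function
  vanishes on the boundary.

  The limit at the corner cannot vanish: in the coordinates along the two edges the exponential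
  integral is a product of one-dimensional ones, each of the form \<open>- 1 / c\<close>. The
  argument compares the hulls of the vertices; this suffices since the hull of the open set
  \<open>D\<close> is the interior of the hull of its vertices.\<close>

lemma partial_deriv_eqI: "(f has_derivative f') (at x) \<Longrightarrow> partial_deriv i f x = f' (axis i 1)"
  by (simp add: partial_deriv_def frechet_derivative_at[symmetric])

lemma differentiable_has_frechet: "f differentiable (at x) \<Longrightarrow> (f has_derivative frechet_derivative f (at x)) (at x)"
  by (simp add: frechet_derivative_works)

lemma C_k_continuous: "C_k n f \<Longrightarrow> continuous_on UNIV f"
proof (cases n)
  case (Suc m)
  assume "C_k n f"
  then show ?thesis using Suc
    by (auto simp: continuous_on_eq_continuous_at intro: differentiable_imp_continuous_within)
qed simp

text \<open>\<open>C_k (Suc n)\<close> speaks only of differentiability and of the partial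
  derivatives, so lowering the order is an induction whose base is the continuity of differentiable
  functions.\<close>

lemma C_k_Suc_D: "C_k (Suc n) f \<Longrightarrow> C_k n f"
proof (induction n arbitrary: f)
  case 0
  then show ?case using C_k_continuous by (metis C_k.simps(1))
next
  case (Suc n)
  then show ?case by (metis C_k.simps(2))
qed

lemma partial_deriv_const [simp]: "partial_deriv i (\<lambda>x. c) = (\<lambda>x. 0)"
  by (rule ext, rule partial_deriv_eqI) (rule has_derivative_const)

lemma partial_deriv_add:
  assumes "f differentiable (at x)" "g differentiable (at x)"
  shows "partial_deriv i (\<lambda>x. f x + g x) x = partial_deriv i f x + partial_deriv i g x"
  using partial_deriv_eqI[OF has_derivative_add[OF assms[THEN differentiable_has_frechet]]]
  by (simp add: partial_deriv_def)

lemma partial_deriv_diff: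
  assumes "f differentiable (at x)" "g differentiable (at x)"
  shows "partial_deriv i (\<lambda>x. f x - g x) x = partial_deriv i f x - partial_deriv i g x"
  using partial_deriv_eqI[OF has_derivative_diff[OF assms[THEN differentiable_has_frechet]]]
  by (simp add: partial_deriv_def)

lemma partial_deriv_mult:
  assumes "f differentiable (at x)" "g differentiable (at x)"
  shows "partial_deriv i (\<lambda>x. f x * g x) x = partial_deriv i f x * g x + f x * partial_deriv i g x"
  using partial_deriv_eqI[OF has_derivative_mult[OF assms[THEN differentiable_has_frechet]]]
  by (simp add: partial_deriv_def)

text \<open>The sign is kept as a factor \<open>- 1\<close> and the square as a product, so that the
  right side has the form to which \<open>C_k_mult\<close> and \<open>C_k_const\<close>
  apply.\<close>

lemma partial_deriv_inverse:
  assumes "f differentiable (at x)" "f x \<noteq> 0"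
  shows "partial_deriv i (\<lambda>x. inverse (f x)) x = - 1 * (inverse (f x) * partial_deriv i f x * inverse (f x))"
  using partial_deriv_eqI[OF Deriv.has_derivative_inverse[OF assms(2) differentiable_has_frechet[OF assms(1)]]]
  by (simp add: partial_deriv_def)

lemma C_k_const [simp]: "C_k n (\<lambda>x. c)"
  by (induction n arbitrary: c) auto

lemma C_k_add: "C_k n f \<Longrightarrow> C_k n g \<Longrightarrow> C_k n (\<lambda>x. f x + g x)"
proof (induction n arbitrary: f g)
  case (Suc n)
  then have "partial_deriv i (\<lambda>x. f x + g x) = (\<lambda>x. partial_deriv i f x + partial_deriv i g x)" for i
    by (auto simp: partial_deriv_add)
  with Suc show ?case by auto
qed (auto intro: continuous_intros)

lemma C_k_mult: "C_k n f \<Longrightarrow> C_k n g \<Longrightarrow> C_k n (\<lambda>x. f x * g x)"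
proof (induction n arbitrary: f g)
  case (Suc n)
  then have *: "partial_deriv i (\<lambda>x. f x * g x) = (\<lambda>x. partial_deriv i f x * g x + f x * partial_deriv i g x)" for i
    by (auto simp: partial_deriv_mult)
  \<comment> \<open>The product rule also contains the undifferentiated factors, which are needed at
    order \<open>n\<close>.\<close>
  have "C_k n f" "C_k n g"
    using Suc.prems C_k_Suc_D by auto
  with Suc show ?case unfolding C_k.simps(2) * by (auto intro!: C_k_add)
qed (auto intro: continuous_intros)

lemma C_k_inverse: "C_k n f \<Longrightarrow> (\<And>x. f x \<noteq> 0) \<Longrightarrow> C_k n (\<lambda>x. inverse (f x))"
proof (induction n arbitrary: f)
  case (Suc n)
  then have *: "partial_deriv i (\<lambda>x. inverse (f x)) = (\<lambda>x. - 1 * (inverse (f x) * partial_deriv i f x * inverse (f x)))" for i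
    by (intro ext partial_deriv_inverse) auto
  have "C_k n f" using Suc.prems(1) by (rule C_k_Suc_D)
  then have "C_k n (\<lambda>x. inverse (f x))" using Suc by blast
  with Suc.prems(1) have "C_k n (\<lambda>x. - 1 * (inverse (f x) * partial_deriv i f x * inverse (f x)))" for i
    by (intro C_k_mult C_k_const) auto
  moreover have "(\<lambda>x. inverse (f x)) differentiable (at x)" for x
    using Suc.prems by (intro differentiable_inverse) auto
  ultimately show ?case unfolding C_k.simps(2) * by blast
qed (auto intro: continuous_intros)

lemma smooth_const [simp]: "smooth (\<lambda>x. c)"
  by (simp add: smooth_def)
lemma smooth_add: "smooth f \<Longrightarrow> smooth g \<Longrightarrow> smooth (\<lambda>x. f x + g x)"
  by (simp add: smooth_def C_k_add)
lemma smooth_mult: "smooth f \<Longrightarrow> smooth g \<Longrightarrow> smooth (\<lambda>x. f x * g x)"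
  by (simp add: smooth_def C_k_mult)
lemma smooth_inverse: "smooth f \<Longrightarrow> (\<And>x. f x \<noteq> 0) \<Longrightarrow> smooth (\<lambda>x. inverse (f x))"
  by (simp add: smooth_def C_k_inverse)
lemma smooth_diff: "smooth f \<Longrightarrow> smooth g \<Longrightarrow> smooth (\<lambda>x. f x - g x)"
  using smooth_add[of f "\<lambda>x. (-1) * g x"] smooth_mult[of "\<lambda>x. -1" g] by simp
lemma smooth_prod: "(\<And>i. i \<in> A \<Longrightarrow> smooth (f i)) \<Longrightarrow> smooth (\<lambda>x. \<Prod>i\<in>A. f i x)"
  by (induction A rule: infinite_finite_induct) (auto intro: smooth_mult)

lemma smooth_partial_deriv: "smooth f \<Longrightarrow> smooth (partial_deriv i f)"
  unfolding smooth_def by (meson C_k.simps(2))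
lemma smooth_differentiable: "smooth f \<Longrightarrow> f differentiable (at x)"
  unfolding smooth_def by (meson C_k.simps(2))
lemma smooth_continuous: "smooth f \<Longrightarrow> continuous_on A f"
  unfolding smooth_def by (meson C_k_continuous continuous_on_subset subset_UNIV)

text \<open>Induction on the order works because the family \<open>F\<close> is closed under
  differentiation: each step passes from \<open>h\<close> to some \<open>h'\<close> in
  \<open>F\<close>, so \<open>h\<close> has to vary. The inner affine coordinate only contributes a
  constant factor.\<close>

lemma smooth_real_fun:
  assumes F: "\<And>h. h \<in> F \<Longrightarrow> \<exists>h'\<in>F. \<forall>t. (h has_real_derivative h' t) (at t)" and h: "h \<in> F"
  shows "smooth (\<lambda>x. of_real (h (c * x $ i + d)))"
proof -
  have "C_k n (\<lambda>x. of_real (h (c * x $ i + d)))" if "h \<in> F" for n h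
    using that
  proof (induction n arbitrary: h)
    case 0
    then obtain h' where "\<forall>t. (h has_real_derivative h' t) (at t)" using F by blast
    then have "continuous_on UNIV h"
      by (meson DERIV_continuous continuous_at_imp_continuous_on)
    then have "continuous_on UNIV (\<lambda>x::plane. h (c * x $ i + d))"
      by (rule continuous_on_compose2) (auto intro!: continuous_on_add continuous_on_mult continuous_on_const continuous_on_component continuous_on_id)
    then show ?case by (auto intro: continuous_on_of_real)
  next
    case (Suc n)
    then obtain h' where h': "h' \<in> F" "\<And>t. (h has_real_derivative h' t) (at t)" using F by blast
    have 1: "((\<lambda>x. complex_of_real (h (c * x $ i + d))) has_derivative
        (\<lambda>v. complex_of_real (h' (c * x $ i + d) * (c * v $ i)))) (at x)" for x :: plane
    proof -
      have "((\<lambda>x::plane. c * x $ i + d) has_derivative (\<lambda>v. c * v $ i)) (at x)"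
        by (auto intro!: derivative_eq_intros bounded_linear.has_derivative[OF bounded_linear_vec_nth])
      moreover have "(h has_derivative (*) (h' (c * x $ i + d))) (at (c * x $ i + d))"
        using h'(2) unfolding has_field_derivative_def .
      ultimately have "((\<lambda>x. h (c * x $ i + d)) has_derivative (\<lambda>v. h' (c * x $ i + d) * (c * v $ i))) (at x)"
        by (rule has_derivative_compose)
      then show ?thesis by (rule has_derivative_of_real)
    qed
    have 2: "partial_deriv j (\<lambda>x. complex_of_real (h (c * x $ i + d))) =
       (\<lambda>x. of_real (h' (c * x $ i + d)) * of_real (c * axis j 1 $ i))" for j
      by (rule ext, subst partial_deriv_eqI[OF 1]) simp
    show ?case unfolding C_k.simps(2) 2 using 1 Suc.IH[OF h'(1)]
      by (auto simp: differentiable_def intro!: C_k_mult)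
  qed
  with h show ?thesis by (simp add: smooth_def)
qed

text \<open>The polynomial is a parameter because the derivatives of \<open>exp (- (1/t))\<close>
  are again of this form.\<close>

definition flat :: "real poly \<Rightarrow> real \<Rightarrow> real" where
  "flat p t = (if t > 0 then poly p (1/t) * exp (- (1/t)) else 0)"

lemma poly_exp_tendsto_0: "((\<lambda>u. poly p u * exp (- u)) \<longlongrightarrow> (0::real)) at_top"
proof -
  have "((\<lambda>u. \<Sum>i\<le>degree p. coeff p i * (u ^ i / exp u)) \<longlongrightarrow> (\<Sum>i\<le>degree p. coeff p i * 0)) at_top"
    by (intro tendsto_intros tendsto_power_div_exp_0)
  moreover have "(\<Sum>i\<le>degree p. coeff p i * (u ^ i / exp u)) = poly p u * exp (- u)" for u
    by (simp add: poly_altdef exp_minus sum_distrib_right divide_inverse mult.assoc)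
  ultimately show ?thesis by simp
qed

text \<open>With \<open>s = 1/t\<close> the chain rule gives
  \<open>s^2 * (p s - p' s) * exp (- s)\<close>; the factor \<open>s^2\<close> is the double
  \<open>pCons 0\<close>. At 0 both one-sided difference quotients tend to 0.\<close>

lemma flat_deriv:
  "(flat p has_real_derivative flat (pCons 0 (pCons 0 (p - pderiv p))) t) (at t)"
proof -
  consider "t > 0" | "t < 0" | "t = 0" by linarith
  then show ?thesis
  proof cases
    case 1
    have A: "((\<lambda>t. 1/t) has_real_derivative - (1/t) * (1/t)) (at t)"
      using 1 by (auto intro!: derivative_eq_intros)
    have "((\<lambda>t. poly p (1/t) * exp (- (1/t))) has_real_derivative flat (pCons 0 (pCons 0 (p - pderiv p))) t) (at t)"
      using DERIV_mult[OF DERIV_chain2[OF poly_DERIV A] DERIV_chain2[OF DERIV_exp DERIV_minus[OF A]]] 1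
      unfolding flat_def by (simp add: algebra_simps)
    moreover have "eventually (\<lambda>s. flat p s = poly p (1/s) * exp (- (1/s))) (nhds t)"
      using eventually_nhds_in_open[of "{0<..}" t] 1 by (auto simp: flat_def elim!: eventually_mono)
    ultimately show ?thesis
      by (subst DERIV_cong_ev[OF refl _ refl]) auto
  next
    case 2
    have "eventually (\<lambda>s. flat p s = 0) (nhds t)"
      using eventually_nhds_in_open[of "{..<0}" t] 2 by (auto simp: flat_def elim!: eventually_mono)
    then show ?thesis using 2
      by (subst DERIV_cong_ev[OF refl _ refl]) (auto simp: flat_def)
  next
    case 3
    \<comment> \<open>To the right of 0, dividing by \<open>s\<close> multiplies the polynomial by
      its variable, hence \<open>pCons 0 p\<close>.\<close>
    have "((\<lambda>s. poly (pCons 0 p) (1/s) * exp (- (1/s))) \<longlongrightarrow> 0) (at_right 0)"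
      using filterlim_compose[OF poly_exp_tendsto_0 filterlim_inverse_at_top_right, of "pCons 0 p"]
      by (simp add: inverse_eq_divide)
    then have r: "((\<lambda>s. flat p s / s) \<longlongrightarrow> 0) (at_right 0)"
      by (rule Lim_transform_eventually) (auto simp: eventually_at_filter flat_def)
    have l: "((\<lambda>s. flat p s / s) \<longlongrightarrow> 0) (at_left 0)"
      by (rule Lim_transform_eventually[OF tendsto_const]) (auto simp: eventually_at_filter flat_def)
    have "((\<lambda>s. flat p s / s) \<longlongrightarrow> 0) (at 0)"
      using l r by (simp add: filterlim_split_at)
    then show ?thesis using 3 by (simp add: DERIV_def flat_def)
  qed
qed

lemma smooth_flat: "smooth (\<lambda>x. of_real (flat p (c * x $ i + d)))"
  by (rule smooth_real_fun[of "range flat"]) (auto intro: flat_deriv)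

definition step :: "real \<Rightarrow> real" where
  "step t = flat 1 t / (flat 1 t + flat 1 (1 - t))"

lemma flat_1: "flat 1 t \<ge> 0" "t > 0 \<Longrightarrow> flat 1 t > 0" "t \<le> 0 \<Longrightarrow> flat 1 t = 0"
  by (auto simp: flat_def)

lemma step_denominator_pos: "flat 1 t + flat 1 (1 - t) > 0"
  using flat_1(1)[of t] flat_1(1)[of "1 - t"] flat_1(2)[of t] flat_1(2)[of "1 - t"]
  by (cases "t > 0") (auto intro: add_pos_nonneg)

lemma step_bounds: "0 \<le> step t" "step t \<le> 1"
  using step_denominator_pos[of t] flat_1(1)[of t] flat_1(1)[of "1 - t"] by (auto simp: step_def)

lemma step_eq_0: "t \<le> 0 \<Longrightarrow> step t = 0"
  by (simp add: step_def flat_1)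

lemma step_eq_1: "t \<ge> 1 \<Longrightarrow> step t = 1"
  using flat_1(2)[of t] flat_1(3)[of "1 - t"] by (simp add: step_def)

lemma smooth_step: "smooth (\<lambda>x. of_real (step (c * x $ i + d)))"
proof -
  have "smooth (\<lambda>x. of_real (flat 1 (c * x $ i + d)) *
      inverse (of_real (flat 1 (c * x $ i + d)) + of_real (flat 1 ((-c) * x $ i + (1 - d)))))"
  proof (intro smooth_mult smooth_inverse smooth_add smooth_flat)
    fix x :: plane
    show "complex_of_real (flat 1 (c * x $ i + d)) + of_real (flat 1 ((-c) * x $ i + (1 - d))) \<noteq> 0"
      using step_denominator_pos[of "c * x $ i + d"]
      by (simp add: of_real_add[symmetric] algebra_simps del: of_real_add)
  qed
  moreover have "(-c) * x $ i + (1 - d) = 1 - (c * x $ i + d)" for x :: plane by simp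
  ultimately show ?thesis unfolding step_def by (simp only: of_real_divide of_real_add divide_inverse of_real_mult of_real_inverse)
qed

text \<open>\<open>m\<close> is the steepness: the value is 1 at points of the box whose coordinates
  keep distance \<open>1/m\<close> from the faces, and the limit for large \<open>m\<close> is the
  indicator of the open box.\<close>

definition box_cut :: "real \<Rightarrow> plane \<Rightarrow> plane \<Rightarrow> plane \<Rightarrow> real" where
  "box_cut m a b x = (\<Prod>i\<in>UNIV. step (m * (x $ i - a $ i)) * step (m * (b $ i - x $ i)))"

lemma smooth_box_cut: "smooth (\<lambda>x. of_real (box_cut m a b x))"
proof -
  have "smooth (\<lambda>x. \<Prod>i\<in>UNIV. of_real (step (m * x $ i + (- m * a $ i))) * of_real (step ((- m) * x $ i + m * b $ i)))"
    by (intro smooth_prod smooth_mult smooth_step)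
  moreover have "m * (x $ i - a $ i) = m * x $ i + (- m * a $ i)"
     "m * (b $ i - x $ i) = (- m) * x $ i + m * b $ i" for x i
    by (auto simp: algebra_simps)
  ultimately show ?thesis unfolding box_cut_def by simp
qed

lemma box_cut_bounds: "0 \<le> box_cut m a b x" "box_cut m a b x \<le> 1"
  unfolding box_cut_def
  by (auto intro!: prod_nonneg prod_le_1 mult_le_one simp: step_bounds)

lemma box_cut_eq_0: "m > 0 \<Longrightarrow> x \<notin> box a b \<Longrightarrow> box_cut m a b x = 0"
  unfolding box_cut_def
  by (auto simp: mem_box_cart not_less intro!: step_eq_0 mult_nonneg_nonpos)

lemma box_cut_eq_1:
  assumes "m > 0" "\<And>i. a $ i + 1/m \<le> x $ i" "\<And>i. x $ i \<le> b $ i - 1/m"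
  shows "box_cut m a b x = 1"
proof -
  have "step (m * (x $ i - a $ i)) = 1" "step (m * (b $ i - x $ i)) = 1" for i
    using assms(1) assms(2)[of i] assms(3)[of i] by (auto intro!: step_eq_1 simp: field_simps)
  then show ?thesis by (simp add: box_cut_def)
qed

lemma box_cut_tendsto: "(\<lambda>n. box_cut (real (Suc n)) a b x) \<longlonglongrightarrow> indicator (box a b) x"
proof (cases "x \<in> box a b")
  case False
  then show ?thesis by (simp add: box_cut_eq_0)
next
  case True
  have "\<forall>\<^sub>F n in sequentially. \<forall>i. inverse (real (Suc n)) < min (x $ i - a $ i) (b $ i - x $ i)"
  proof (rule eventually_all_finite, rule order_tendstoD(2)[OF LIMSEQ_inverse_real_of_nat])
    show "0 < min (x $ i - a $ i) (b $ i - x $ i)" for i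
      using True by (auto simp: mem_box_cart)
  qed
  then have "\<forall>\<^sub>F n in sequentially. indicator (box a b) x = box_cut (real (Suc n)) a b x"
  proof eventually_elim
    case (elim n)
    have "box_cut (real (Suc n)) a b x = 1"
    proof (rule box_cut_eq_1)
      fix i
      have "1 / real (Suc n) < min (x $ i - a $ i) (b $ i - x $ i)"
        using elim by (simp only: inverse_eq_divide)
      then show "a $ i + 1 / real (Suc n) \<le> x $ i" "x $ i \<le> b $ i - 1 / real (Suc n)"
        by linarith+
    qed simp
    with True show ?case by simp
  qed
  then show ?thesis by (rule Lim_transform_eventually[OF tendsto_const])
qed

lemma test_function_box_cut:
  assumes "m > 0" "cbox a b \<subseteq> Om"
  shows "(\<lambda>x. of_real (box_cut m a b x)) \<in> test_functions Om"
proof -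
  have "closure {x. complex_of_real (box_cut m a b x) \<noteq> 0} \<subseteq> cbox a b"
  proof (rule closure_minimal)
    show "{x. complex_of_real (box_cut m a b x) \<noteq> 0} \<subseteq> cbox a b"
      using box_cut_eq_0[OF assms(1), of _ a b] box_subset_cbox[of a b] by auto
  qed (rule closed_cbox)
  moreover from this have "compact (closure {x. complex_of_real (box_cut m a b x) \<noteq> 0})"
    by (meson bounded_cbox bounded_subset closed_closure compact_eq_bounded_closed)
  ultimately show ?thesis using assms(2) smooth_box_cut
    by (auto simp: test_functions_def)
qed

text \<open>Box cutoffs around finitely many points are merged through the product of their
  complements, which is 0 as soon as one cutoff is 1 and is 1 where all of them vanish; a plain sum
  would not stay at the value 1.\<close>

lemma cutoff_exists:
  assumes "compact K" "open Om" "K \<subseteq> Om"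
  obtains \<psi> V where "\<psi> \<in> test_functions Om" "open V" "K \<subseteq> V" "\<And>x. x \<in> V \<Longrightarrow> \<psi> x = 1"
proof -
  define good where "good V f \<longleftrightarrow> open V \<and> f \<in> test_functions Om \<and> (\<forall>y\<in>V. f y = 1)" for V f
  have ex: "\<exists>V f. x \<in> V \<and> good V f" if "x \<in> K" for x
  proof -
    have xOm: "x \<in> Om" using assms(3) that by blast
    obtain a b where ab: "cbox a b \<subseteq> Om" "x \<in> box a b"
      by (rule open_contains_cbox[OF assms(2) xOm]) auto
    \<comment> \<open>\<open>e\<close> is the coordinate distance from \<open>x\<close> to the faces
      of the box. With \<open>m = 2 / e\<close> the point lies in the smaller open box on which the
      cutoff is 1.\<close>
    define e where "e = Min (range (\<lambda>i. min (x $ i - a $ i) (b $ i - x $ i)))"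
    have e: "e > 0" "\<And>i. e \<le> x $ i - a $ i" "\<And>i. e \<le> b $ i - x $ i"
    proof -
      show "e > 0" unfolding e_def using ab(2) by (subst Min_gr_iff) (auto simp: mem_box_cart)
      have "e \<le> min (x $ i - a $ i) (b $ i - x $ i)" for i
        unfolding e_def by (rule Min_le) auto
      then show "\<And>i. e \<le> x $ i - a $ i" "\<And>i. e \<le> b $ i - x $ i" by (meson min.boundedE)+
    qed
    define m where "m = 2 / e"
    have m: "m > 0" "1 / m < e" using e by (auto simp: m_def)
    have "good (box (\<chi> i. a $ i + 1/m) (\<chi> i. b $ i - 1/m)) (\<lambda>x. of_real (box_cut m a b x))"
      unfolding good_def using m ab test_function_box_cut[of m a b Om]
      by (auto simp: mem_box_cart less_imp_le intro!: box_cut_eq_1)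
    moreover have "x \<in> box (\<chi> i. a $ i + 1/m) (\<chi> i. b $ i - 1/m)"
    proof -
      have "a $ i + 1/m < x $ i" "x $ i < b $ i - 1/m" for i
        using m(2) e(2)[of i] e(3)[of i] by linarith+
      then show ?thesis by (simp add: mem_box_cart)
    qed
    ultimately show ?thesis by blast
  qed
  then obtain V f where Vf: "\<And>x. x \<in> K \<Longrightarrow> x \<in> V x \<and> good (V x) (f x)" by metis
  obtain C where C: "C \<subseteq> K" "finite C" "K \<subseteq> (\<Union>x\<in>C. V x)"
    using compactE_image[OF assms(1), of K V] Vf unfolding good_def by (metis UN_I subsetI)
  define \<psi> where "\<psi> = (\<lambda>y. 1 - (\<Prod>x\<in>C. 1 - f x y))"
  have good: "good (V x) (f x)" if "x \<in> C" for x using C Vf that by blast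
  show thesis
  proof
    let ?S = "\<Union>x\<in>C. closure {y. f x y \<noteq> 0}"
    have sub: "closure {y. \<psi> y \<noteq> 0} \<subseteq> ?S"
    proof (rule closure_minimal)
      show "closed ?S" using C(2) by auto
      show "{y. \<psi> y \<noteq> 0} \<subseteq> ?S"
      proof
        fix y assume "y \<in> {y. \<psi> y \<noteq> 0}"
        then obtain x where "x \<in> C" "f x y \<noteq> 0" unfolding \<psi>_def
          by (metis (mono_tags, lifting) cancel_comm_monoid_add_class.diff_cancel diff_zero mem_Collect_eq prod.neutral)
        then show "y \<in> ?S" using closure_subset[of "{y. f x y \<noteq> 0}"] by auto
      qed
    qed
    have S: "compact ?S" "?S \<subseteq> Om"
      using C(2) good by (auto simp: good_def test_functions_def)
    have "smooth \<psi>" unfolding \<psi>_def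
      by (intro smooth_diff smooth_const smooth_prod) (use good in \<open>auto simp: good_def test_functions_def\<close>)
    then show "\<psi> \<in> test_functions Om"
      using sub S compact_Int_closed[OF S(1) closed_closure, of "{y. \<psi> y \<noteq> 0}"]
      by (simp add: test_functions_def Int_absorb1)
    show "open (\<Union>x\<in>C. V x)" using good by (auto simp: good_def)
    show "K \<subseteq> (\<Union>x\<in>C. V x)" by fact
    show "\<psi> y = 1" if y: "y \<in> (\<Union>x\<in>C. V x)" for y
    proof -
      obtain x where x: "x \<in> C" "y \<in> V x" using y by blast
      then have "1 - f x y = 0" using good[OF x(1)] by (auto simp: good_def)
      then show ?thesis unfolding \<psi>_def using C(2) x(1) by (metis (no_types, lifting) diff_zero prod_zero)
    qed
  qed
qed


section \<open>One-dimensional Hausdorff measure\<close>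

text \<open>The last assumption, superadditivity at positive distance, is Caratheodory's criterion
  for Borel sets to be measurable. The setting is abstract because the argument for it never refers
  to diameters.\<close>

locale metric_outer_measure =
  fixes f :: "'a::metric_space set \<Rightarrow> ennreal"
  assumes f_empty: "f {} = 0"
    and f_mono: "A \<subseteq> B \<Longrightarrow> f A \<le> f B"
    and f_countable_subadditive: "f (\<Union>i::nat. S i) \<le> (\<Sum>i. f (S i))"
    and f_separated: "0 < d \<Longrightarrow> (\<And>x y. x \<in> A \<Longrightarrow> y \<in> B \<Longrightarrow> d \<le> dist x y) \<Longrightarrow> f A + f B \<le> f (A \<union> B)"
begin

lemma f_subadditive: "f (A \<union> B) \<le> f A + f B"
proof -
  have "f (A \<union> B) \<le> f (\<Union>i. (\<lambda>n. if n = 0 then A else if n = Suc 0 then B else {}) i)"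
    by (rule f_mono) (force split: if_splits)
  also have "\<dots> \<le> (\<Sum>i. f ((\<lambda>n. if n = 0 then A else if n = Suc 0 then B else {}) i))"
    by (rule f_countable_subadditive)
  also have "\<dots> = (\<Sum>i\<in>{0, Suc 0}. f ((\<lambda>n. if n = 0 then A else if n = Suc 0 then B else {}) i))"
    by (rule suminf_finite) (auto simp: f_empty)
  finally show ?thesis by simp
qed

text \<open>The gap may depend on the pair; the least of finitely many gaps to the last set is still
  positive, so the sets are split off one at a time.\<close>

lemma f_separated_sum:
  fixes S :: "nat \<Rightarrow> 'a set"
  assumes "\<And>i j. i < j \<Longrightarrow> j < N \<Longrightarrow> \<exists>d>0. \<forall>x\<in>S i. \<forall>y\<in>S j. d \<le> dist x y"
  shows "(\<Sum>i<N. f (S i)) \<le> f (\<Union>i<N. S i)"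
  using assms
proof (induction N)
  case (Suc N)
  have "\<forall>i\<in>{..<N}. \<exists>d>0. \<forall>x\<in>S i. \<forall>y\<in>S N. d \<le> dist x y" using Suc.prems by auto
  then obtain d where d: "\<And>i. i < N \<Longrightarrow> d i > 0 \<and> (\<forall>x\<in>S i. \<forall>y\<in>S N. d i \<le> dist x y)"
    by (metis lessThan_iff)
  define m where "m = Min (insert 1 (d ` {..<N}))"
  have m: "m > 0" "\<And>i. i < N \<Longrightarrow> m \<le> d i"
    using d by (auto simp: m_def)
  have "(\<Sum>i<N. f (S i)) \<le> f (\<Union>i<N. S i)"
    by (rule Suc.IH) (use Suc.prems in auto)
  then have "(\<Sum>i<Suc N. f (S i)) \<le> f (\<Union>i<N. S i) + f (S N)"
    by (simp add: add_right_mono)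
  also have "\<dots> \<le> f ((\<Union>i<N. S i) \<union> S N)"
  proof (rule f_separated[OF m(1)])
    fix x y assume "x \<in> (\<Union>i<N. S i)" "y \<in> S N"
    then obtain i where "i < N" "x \<in> S i" by auto
    with d[of i] m(2)[of i] \<open>y \<in> S N\<close> show "m \<le> dist x y" by force
  qed
  also have "(\<Union>i<N. S i) \<union> S N = (\<Union>i<Suc N. S i)"
    by (auto simp: lessThan_Suc)
  finally show ?case .
qed simp

text \<open>The parts of \<open>A\<close> at distance between \<open>1 / (n + 2)\<close> and \<open>1 / (n + 1)\<close> from \<open>C\<close> have
  summable measures, since those of even (odd) index are pairwise separated; so the part of
  \<open>A - C\<close> close to \<open>C\<close> is small.\<close>

lemma closed_caratheodory:
  assumes C: "closed C"
  shows "f (C \<inter> A) + f (A - C) \<le> f A"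
proof (cases "C = {} \<or> f A = top")
  case True
  then show ?thesis by (auto simp: f_empty)
next
  case False
  then have ne: "C \<noteq> {}" and fin: "f A < top" by (auto simp: less_top)
  define E where "E n = {x \<in> A. infdist x C \<ge> 1 / real (Suc n)}" for n
  define R where "R n = E (Suc n) - E n" for n
  \<comment> \<open>The indices must differ by at least two: neighbouring shells may touch, while a
    shell in between leaves a gap because \<open>infdist\<close> is 1-Lipschitz.\<close>
  have sep: "\<exists>d>0. \<forall>x\<in>R i. \<forall>y\<in>R j. d \<le> dist x y" if "Suc i < j" for i j
  proof (intro exI conjI ballI)
    show "1 / real (Suc (Suc i)) - 1 / real (Suc j) > 0"
      using that by (simp add: frac_less2)
    fix x y assume "x \<in> R i" "y \<in> R j"
    then have "infdist x C \<ge> 1 / real (Suc (Suc i))" "infdist y C \<le> 1 / real (Suc j)"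
      by (auto simp: R_def E_def)
    moreover have "infdist x C \<le> infdist y C + dist x y"
      by (rule infdist_triangle)
    ultimately show "1 / real (Suc (Suc i)) - 1 / real (Suc j) \<le> dist x y" by linarith
  qed
  define r where "r n = enn2real (f (R n))" for n
  have R_sub: "R n \<subseteq> A" for n by (auto simp: R_def E_def)
  then have fR: "f (R n) = ennreal (r n)" for n
    unfolding r_def using le_less_trans[OF f_mono fin] by simp
  have r0: "r n \<ge> 0" for n by (simp add: r_def)
  obtain a where a: "f A = ennreal a" "a \<ge> 0"
    using fin by (cases "f A") auto
  have half: "(\<Sum>i<N. r (2 * i + e)) \<le> a" for N e
  proof -
    have "(\<Sum>i<N. f (R (2 * i + e))) \<le> f (\<Union>i<N. R (2 * i + e))"
      by (rule f_separated_sum) (rule sep, simp)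
    also have "\<dots> \<le> f A" by (rule f_mono) (use R_sub in auto)
    finally have "ennreal (\<Sum>i<N. r (2 * i + e)) \<le> ennreal a"
      by (simp add: fR a r0)
    then show ?thesis using a by simp
  qed
  have split: "(\<Sum>i<2 * N. r i) = (\<Sum>i<N. r (2 * i + 0)) + (\<Sum>i<N. r (2 * i + 1))" for N
    by (induction N) auto
  have summ: "summable r"
  proof (rule summableI_nonneg_bounded)
    show "0 \<le> r n" for n by (simp add: r_def)
    show "(\<Sum>i<n. r i) \<le> 2 * a" for n
    proof -
      have "(\<Sum>i<n. r i) \<le> (\<Sum>i<2 * n. r i)"
        by (rule sum_mono2) (auto simp: r_def)
      then show ?thesis using split[of n] half[of 0 n] half[of 1 n] by linarith
    qed
  qed
  show ?thesis
  proof (rule ennreal_le_epsilon)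
    fix e :: real assume "0 < e"
    then obtain N where N: "norm (\<Sum>i. r (i + N)) < e"
      using suminf_exist_split[OF _ summ] by blast
    have sub: "A - C \<subseteq> E N \<union> (\<Union>i. R (i + N))"
    proof
      fix x assume x: "x \<in> A - C"
      then have "infdist x C > 0"
        using C ne in_closed_iff_infdist_zero[OF C ne, of x] infdist_nonneg[of x C] by auto
      then obtain n where "inverse (real (Suc n)) < infdist x C"
        using reals_Archimedean by blast
      then have "x \<in> E n" using x by (simp add: E_def inverse_eq_divide)
      then have ex: "\<exists>n. x \<in> E n" ..
      define n where "n = (LEAST n. x \<in> E n)"
      have n: "x \<in> E n" "\<And>m. m < n \<Longrightarrow> x \<notin> E m"
        using LeastI_ex[OF ex] not_less_Least by (auto simp: n_def)
      have E_mono: "E m \<subseteq> E k" if "m \<le> k" for m k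
      proof -
        have "1 / real (Suc k) \<le> 1 / real (Suc m)" using that by (simp add: frac_le)
        then show ?thesis by (auto simp: E_def)
      qed
      show "x \<in> E N \<union> (\<Union>i. R (i + N))"
      proof (cases "n \<le> N")
        case True
        then show ?thesis using n E_mono by blast
      next
        case False
        then obtain k where "n = Suc (k + N)" using less_iff_Suc_add[of N n] by (auto simp: add.commute)
        with n have "x \<in> R (k + N)" by (auto simp: R_def)
        then show ?thesis by blast
      qed
    qed
    have tail: "(\<Sum>i. f (R (i + N))) = ennreal (\<Sum>i. r (i + N))"
    proof -
      have "summable (\<lambda>i. r (i + N))" using summ by (rule summable_ignore_initial_segment)
      then have "(\<Sum>i. ennreal (r (i + N))) \<noteq> top"
        by (rule ennreal_suminf_neq_top) (simp add: r_def)
      then show ?thesis by (simp add: fR r0)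
    qed
    have "f (A - C) \<le> f (E N) + f (\<Union>i. R (i + N))"
      using f_mono[OF sub] f_subadditive by (rule order_trans)
    also have "f (\<Union>i. R (i + N)) \<le> (\<Sum>i. f (R (i + N)))"
      by (rule f_countable_subadditive)
    also have "\<dots> \<le> ennreal e" unfolding tail using N by (intro ennreal_leI) auto
    finally have 1: "f (A - C) \<le> f (E N) + ennreal e" by (simp add: add_left_mono)
    \<comment> \<open>\<open>E N\<close> keeps the distance \<open>1 / real (Suc N)\<close> from
      \<open>C\<close>, so \<open>f_separated\<close> applies to it; replacing it by
      \<open>A - C\<close> costs only the tail, at most \<open>e\<close>.\<close>
    have "f (C \<inter> A) + f (E N) \<le> f ((C \<inter> A) \<union> E N)"
    proof (rule f_separated)
      show "0 < 1 / real (Suc N)" by simp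
      fix x y assume "x \<in> C \<inter> A" "y \<in> E N"
      then show "1 / real (Suc N) \<le> dist x y"
        using infdist_le[of x C y] by (auto simp: E_def dist_commute)
    qed
    also have "\<dots> \<le> f A" by (rule f_mono) (auto simp: E_def)
    finally have 2: "f (C \<inter> A) + f (E N) \<le> f A" .
    have "f (C \<inter> A) + f (A - C) \<le> (f (C \<inter> A) + f (E N)) + ennreal e"
      using add_left_mono[OF 1, of "f (C \<inter> A)"] by (simp add: add.assoc)
    also have "\<dots> \<le> f A + ennreal e" by (rule add_right_mono[OF 2])
    finally show "f (C \<inter> A) + f (A - C) \<le> f A + ennreal e" .
  qed
qed

text \<open>The sets that split every set additively form a sigma-algebra on which \<open>f\<close>
  is a measure; it contains the closed sets, hence all Borel sets.\<close>

lemma borel_measure_space: "measure_space UNIV (sets borel) f"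
proof -
  interpret P: sigma_algebra UNIV "Pow UNIV :: 'a set set" by (rule sigma_algebra_Pow)
  let ?L = "lambda_system UNIV (Pow UNIV) f"
  have "outer_measure_space (Pow UNIV) f"
    using f_empty f_mono f_countable_subadditive
    by (auto simp: outer_measure_space_def positive_def increasing_def countably_subadditive_def)
  then have ms: "measure_space UNIV ?L f" by (rule P.caratheodory_lemma)
  have "Collect closed \<subseteq> ?L"
  proof
    fix C :: "'a set" assume "C \<in> Collect closed"
    then have "f (C \<inter> A) + f (A - C) \<le> f A" for A by (simp add: closed_caratheodory)
    moreover have "f A \<le> f (C \<inter> A) + f (A - C)" for A
      using f_subadditive[of "C \<inter> A" "A - C"] by (simp add: Int_Diff_Un Int_commute)
    ultimately have "f (C \<inter> A) + f (A - C) = f A" for A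
      using order_antisym by blast
    then show "C \<in> ?L"
      by (simp add: lambda_system_def) (simp add: Diff_eq Int_commute)
  qed
  then have "sigma_sets UNIV (Collect closed) \<subseteq> ?L"
    using ms unfolding measure_space_def by (metis sigma_algebra.sigma_sets_subset)
  then have "sets borel \<subseteq> ?L" by (simp add: borel_eq_closed)
  moreover have "sigma_algebra UNIV (sets (borel :: 'a measure))"
    using sets.sigma_algebra_axioms[of borel] by simp
  ultimately show ?thesis using measure_down[OF ms] by blast
qed

end

section \<open>Hausdorff premeasures from covers of bounded size\<close>

definition fine_covers :: "real \<Rightarrow> plane set \<Rightarrow> (nat \<Rightarrow> plane set) set" where
  "fine_covers d A = {U. A \<subseteq> (\<Union>n. U n) \<and> (\<forall>n. bounded (U n) \<and> diameter (U n) \<le> d)}"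

text \<open>This is the usual premeasure of size \<open>d\<close>. Subadditivity holds at each fixed
  \<open>d\<close>, whereas separated sets are handled by values of \<open>d\<close> below their
  distance.\<close>

definition hausdorff1_content :: "real \<Rightarrow> plane set \<Rightarrow> ennreal" where
  "hausdorff1_content d A = (INF U\<in>fine_covers d A. \<Sum>n. ennreal (diameter (U n)))"

lemma hausdorff1_outer_alt: "hausdorff1_outer A = (SUP d\<in>{0<..}. hausdorff1_content d A)"
  by (simp add: hausdorff1_outer_def hausdorff1_content_def fine_covers_def)

lemma hausdorff1_content_le:
  "U \<in> fine_covers d A \<Longrightarrow> hausdorff1_content d A \<le> (\<Sum>n. ennreal (diameter (U n)))"
  unfolding hausdorff1_content_def by (rule INF_lower)

lemma hausdorff1_content_empty: "d > 0 \<Longrightarrow> hausdorff1_content d {} = 0"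
  using hausdorff1_content_le[of "\<lambda>n. {}" d "{}"] by (simp add: fine_covers_def)

lemma hausdorff1_content_mono: "A \<subseteq> B \<Longrightarrow> hausdorff1_content d A \<le> hausdorff1_content d B"
  unfolding hausdorff1_content_def by (rule INF_superset_mono) (auto simp: fine_covers_def)

lemma hausdorff1_content_antimono: "d \<le> e \<Longrightarrow> hausdorff1_content e A \<le> hausdorff1_content d A"
  unfolding hausdorff1_content_def
  by (rule INF_superset_mono) (auto simp: fine_covers_def intro: order_trans)

text \<open>Each \<open>S n\<close> is covered up to an excess of \<open>e / 2^(n+1)\<close>;
  \<open>prod_decode\<close> merges these covers into one sequence, and the excesses add up to
  \<open>e\<close>.\<close>

lemma hausdorff1_content_countable_subadditive:
  "hausdorff1_content d (\<Union>i::nat. S i) \<le> (\<Sum>i. hausdorff1_content d (S i))"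
proof (rule ennreal_le_epsilon)
  fix e :: real assume "0 < e" "(\<Sum>n. hausdorff1_content d (S n)) < top"
  then have *: "hausdorff1_content d (S n) < hausdorff1_content d (S n) + e * (1/2)^Suc n" for n
    by (auto simp add: less_top dest!: ennreal_suminf_lessD)
  have "\<exists>U\<in>fine_covers d (S n). (\<Sum>i. ennreal (diameter (U i))) < hausdorff1_content d (S n) + e * (1/2)^Suc n" for n
    using *[of n] unfolding hausdorff1_content_def INF_less_iff .
  then obtain B where B: "\<And>n. B n \<in> fine_covers d (S n)"
    and Ble: "\<And>n. (\<Sum>i. ennreal (diameter (B n i))) \<le> hausdorff1_content d (S n) + e * (1/2)^Suc n"
    by (metis less_imp_le)
  define C where "C = case_prod B o prod_decode"
  have "C \<in> fine_covers d (\<Union>i. S i)"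
  proof -
    have "x \<in> (\<Union>n. C n)" if "x \<in> S i" for x i
    proof -
      obtain j where "x \<in> B i j" using B[of i] \<open>x \<in> S i\<close> by (auto simp: fine_covers_def)
      then have "x \<in> C (prod_encode (i, j))" by (simp add: C_def)
      then show ?thesis by blast
    qed
    then show ?thesis using B by (auto simp: fine_covers_def C_def split_def)
  qed
  then have "hausdorff1_content d (\<Union>i. S i) \<le> (\<Sum>n. ennreal (diameter (C n)))"
    by (rule hausdorff1_content_le)
  also have "\<dots> = (\<Sum>n. \<Sum>i. ennreal (diameter (B n i)))"
    using suminf_ennreal_2dimen[of "\<lambda>n. \<Sum>i. ennreal (diameter (B n i))" "\<lambda>(n, i). ennreal (diameter (B n i))"]
    by (simp add: C_def comp_def split_def)
  also have "\<dots> \<le> (\<Sum>n. hausdorff1_content d (S n) + e * (1/2) ^ Suc n)"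
    by (intro suminf_le allI Ble) auto
  also have "\<dots> = (\<Sum>n. hausdorff1_content d (S n)) + (\<Sum>n. ennreal e * ennreal ((1/2) ^ Suc n))"
    using \<open>0 < e\<close> by (subst suminf_add[symmetric])
                     (auto simp del: ennreal_suminf_cmult simp add: ennreal_mult[symmetric])
  also have "\<dots> = (\<Sum>n. hausdorff1_content d (S n)) + e"
    unfolding ennreal_suminf_cmult
    by (subst suminf_ennreal_eq[OF zero_le_power power_half_series]) auto
  finally show "hausdorff1_content d (\<Union>i. S i) \<le> (\<Sum>n. hausdorff1_content d (S n)) + e" .
qed

text \<open>A cover element of diameter at most \<open>d < s\<close> cannot meet both sets, so a
  cover of the union splits into covers of \<open>A\<close> and of \<open>B\<close> that use no
  element twice.\<close>

lemma hausdorff1_content_separated: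
  assumes "d < s" "0 < d" and sep: "\<And>x y. x \<in> A \<Longrightarrow> y \<in> B \<Longrightarrow> s \<le> dist x y"
  shows "hausdorff1_content d A + hausdorff1_content d B \<le> hausdorff1_content d (A \<union> B)"
  unfolding hausdorff1_content_def[of d "A \<union> B"]
proof (rule INF_greatest)
  fix U assume U: "U \<in> fine_covers d (A \<union> B)"
  define V where "V n = (if U n \<inter> A \<noteq> {} then U n else {})" for n
  define W where "W n = (if U n \<inter> B \<noteq> {} then U n else {})" for n
  have "V \<in> fine_covers d A" "W \<in> fine_covers d B"
    using U \<open>0 < d\<close> by (fastforce simp: fine_covers_def V_def W_def)+
  then have "hausdorff1_content d A + hausdorff1_content d B
      \<le> (\<Sum>n. ennreal (diameter (V n))) + (\<Sum>n. ennreal (diameter (W n)))"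
    by (intro add_mono hausdorff1_content_le)
  also have "\<dots> = (\<Sum>n. ennreal (diameter (V n)) + ennreal (diameter (W n)))"
    by (rule suminf_add) auto
  also have "\<dots> \<le> (\<Sum>n. ennreal (diameter (U n)))"
  proof (intro suminf_le allI)
    fix n
    have "U n \<inter> A = {} \<or> U n \<inter> B = {}"
    proof (rule ccontr)
      assume "\<not> ?thesis"
      then obtain x y where "x \<in> U n" "x \<in> A" "y \<in> U n" "y \<in> B" by blast
      moreover from this have "dist x y \<le> diameter (U n)" "diameter (U n) \<le> d"
        using U by (auto simp: fine_covers_def intro: diameter_bounded_bound)
      ultimately show False using sep[of x y] assms(1) by linarith
    qed
    then show "ennreal (diameter (V n)) + ennreal (diameter (W n)) \<le> ennreal (diameter (U n))"
      by (auto simp: V_def W_def)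
  qed auto
  finally show "hausdorff1_content d A + hausdorff1_content d B \<le> (\<Sum>n. ennreal (diameter (U n)))" .
qed

interpretation hausdorff1: metric_outer_measure hausdorff1_outer
proof
  show "hausdorff1_outer {} = 0"
    by (auto simp: hausdorff1_outer_alt hausdorff1_content_empty intro!: SUP_eq_const)
  show "hausdorff1_outer A \<le> hausdorff1_outer B" if "A \<subseteq> B" for A B
    unfolding hausdorff1_outer_alt using that by (intro SUP_mono) (auto intro: hausdorff1_content_mono)
  show "hausdorff1_outer (\<Union>i::nat. S i) \<le> (\<Sum>i. hausdorff1_outer (S i))" for S
    unfolding hausdorff1_outer_alt[of "\<Union>i. S i"]
  proof (rule SUP_least)
    fix d :: real assume "d \<in> {0<..}"
    then have "(\<Sum>i. hausdorff1_content d (S i)) \<le> (\<Sum>i. hausdorff1_outer (S i))"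
      unfolding hausdorff1_outer_alt by (intro suminf_le allI SUP_upper) auto
    then show "hausdorff1_content d (\<Union>i. S i) \<le> (\<Sum>i. hausdorff1_outer (S i))"
      using hausdorff1_content_countable_subadditive order_trans by blast
  qed
  show "hausdorff1_outer A + hausdorff1_outer B \<le> hausdorff1_outer (A \<union> B)"
    if "0 < s" "\<And>x y. x \<in> A \<Longrightarrow> y \<in> B \<Longrightarrow> s \<le> dist x y" for s A B
  proof -
    \<comment> \<open>Two sizes are replaced by a common smaller one that is also below the gap
      \<open>s\<close>; this directedness is what allows the two suprema to be added.\<close>
    have *: "\<exists>k\<in>{0<..}. hausdorff1_content d A + hausdorff1_content e B \<le> hausdorff1_content k A + hausdorff1_content k B
       \<and> k < s" if "d \<in> {0<..}" "e \<in> {0<..}" for d e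
      using that \<open>0 < s\<close>
      by (intro bexI[of _ "min (min d e) (s / 2)"] conjI add_mono hausdorff1_content_antimono) auto
    have "hausdorff1_outer A + hausdorff1_outer B = (SUP d\<in>{0<..}. hausdorff1_content d A + hausdorff1_content d B)"
      unfolding hausdorff1_outer_alt by (rule SUP_add_directed_ennreal[symmetric]) (use * in blast)
    also have "\<dots> \<le> hausdorff1_outer (A \<union> B)"
    proof (rule SUP_least)
      fix d :: real assume "d \<in> {0<..}"
      then obtain k where k: "k > 0" "k < s"
          "hausdorff1_content d A + hausdorff1_content d B \<le> hausdorff1_content k A + hausdorff1_content k B"
        using *[of d d] by auto
      note k(3)
      also have "hausdorff1_content k A + hausdorff1_content k B \<le> hausdorff1_content k (A \<union> B)"
        using k that by (intro hausdorff1_content_separated)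
      also have "\<dots> \<le> hausdorff1_outer (A \<union> B)"
        unfolding hausdorff1_outer_alt using k by (intro SUP_upper) auto
      finally show "hausdorff1_content d A + hausdorff1_content d B \<le> hausdorff1_outer (A \<union> B)" .
    qed
    finally show ?thesis .
  qed
qed

lemma sets_hausdorff1 [simp, measurable_cong]: "sets hausdorff1 = sets borel"
  and space_hausdorff1 [simp]: "space hausdorff1 = UNIV"
  using sets.sigma_sets_eq[of "borel :: plane measure"]
  by (auto simp: hausdorff1_def sets_measure_of space_measure_of)

lemma emeasure_hausdorff1: "A \<in> sets borel \<Longrightarrow> emeasure hausdorff1 A = hausdorff1_outer A"
  unfolding hausdorff1_def using hausdorff1.borel_measure_space
  by (intro emeasure_measure_of_sigma) (auto simp: measure_space_def)

text \<open>The factor 2 is the price for not centring the covering intervals.\<close>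

lemma interval_length_le_hausdorff1:
  fixes p :: "plane \<Rightarrow> real"
  assumes p: "\<And>x y. \<bar>p x - p y\<bar> \<le> dist x y" and s: "{a..b} \<subseteq> p ` A" "a \<le> b"
  shows "ennreal (b - a) \<le> 2 * hausdorff1_outer A"
proof -
  have "ennreal (b - a) \<le> 2 * (\<Sum>n. ennreal (diameter (U n)))" if U: "U \<in> fine_covers 1 A" for U
  proof -
    \<comment> \<open>For empty \<open>U n\<close> the chosen point is arbitrary, and its interval
      \<open>I n\<close> has length 0.\<close>
    define u where "u n = (SOME x. x \<in> U n)" for n
    define I where "I n = {p (u n) - diameter (U n) .. p (u n) + diameter (U n)}" for n
    have bd: "bounded (U n)" for n using U by (auto simp: fine_covers_def)
    have "{a..b} \<subseteq> (\<Union>n. I n)"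
    proof
      fix t assume "t \<in> {a..b}"
      then obtain x where x: "x \<in> A" "t = p x" using s by blast
      then obtain n where n: "x \<in> U n" using U by (auto simp: fine_covers_def)
      then have "u n \<in> U n" unfolding u_def by (rule someI)
      then have "dist x (u n) \<le> diameter (U n)" using n bd diameter_bounded_bound by blast
      then have "t \<in> I n" using p[of x "u n"] x by (auto simp: I_def)
      then show "t \<in> (\<Union>n. I n)" by blast
    qed
    then have "emeasure lborel {a..b} \<le> emeasure lborel (\<Union>n. I n)"
      by (rule emeasure_mono) (auto simp: I_def)
    also have "\<dots> \<le> (\<Sum>n. emeasure lborel (I n))"
      by (rule emeasure_subadditive_countably) (auto simp: I_def)
    also have "\<dots> = (\<Sum>n. 2 * ennreal (diameter (U n)))"
      using diameter_ge_0[OF bd] by (simp add: I_def ennreal_mult'')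
    finally show ?thesis using s by simp
  qed
  moreover have dbl: "2 * ennreal x = ennreal (2 * x)" if "0 \<le> x" for x
    using that by (simp add: ennreal_mult)
  have "ennreal ((b - a) / 2) \<le> X" if "ennreal (b - a) \<le> 2 * X" for X
    using that by (cases X) (auto simp: dbl)
  ultimately have "ennreal ((b - a) / 2) \<le> hausdorff1_content 1 A"
    unfolding hausdorff1_content_def by (intro INF_greatest) blast
  also have "\<dots> \<le> hausdorff1_outer A"
    unfolding hausdorff1_outer_alt by (rule SUP_upper) simp
  finally have le: "2 * ennreal ((b - a) / 2) \<le> 2 * hausdorff1_outer A"
    by (rule mult_left_mono) simp
  have "ennreal (b - a) = ennreal (2 * ((b - a) / 2))"
    by (rule arg_cong[of _ _ ennreal]) (simp add: field_simps)
  also have "\<dots> = 2 * ennreal ((b - a) / 2)"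
    by (rule dbl[symmetric]) (use s in simp)
  finally show ?thesis using le by simp
qed

text \<open>The parameter interval is cut into \<open>N\<close> equal pieces, with \<open>N\<close>
  so large that each image has diameter at most \<open>d\<close>; the bounds \<open>K * h\<close>
  add up to \<open>K * (b - a)\<close> whatever \<open>d\<close> is.\<close>

lemma hausdorff1_lipschitz_curve:
  fixes c :: "real \<Rightarrow> plane"
  assumes c: "\<And>s t. dist (c s) (c t) \<le> K * \<bar>s - t\<bar>" and "a \<le> b"
  shows "hausdorff1_outer (c ` {a..b}) \<le> ennreal (K * (b - a))"
  unfolding hausdorff1_outer_alt
proof (rule SUP_least)
  fix d :: real assume "d \<in> {0<..}"
  then have d: "d > 0" by simp
  have "K \<ge> 0" using order_trans[OF zero_le_dist c[of 0 1]] by simp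
  obtain N :: nat where N: "N > 0" "K * (b - a) / d \<le> real N"
    by (metis (no_types, opaque_lifting) gr0I less_eq_real_def linorder_not_le nle_le
        of_nat_0_le_iff order_trans real_arch_simple zero_less_one of_nat_0 of_nat_1)
  define h where "h = (b - a) / real N"
  have h: "h \<ge> 0" "K * h \<le> d" "real N * h = b - a"
    using N d \<open>a \<le> b\<close> by (auto simp: h_def field_simps)
  define U where "U n = (if n < N then c ` {a + real n * h .. a + real (Suc n) * h} else {})" for n
  have U: "bounded (U n)" "diameter (U n) \<le> (if n < N then K * h else 0)" for n
  proof -
    have *: "dist x y \<le> K * h" if xy: "n < N" "x \<in> U n" "y \<in> U n" for x y
    proof -
      obtain s t where st: "x = c s" "y = c t" "s \<in> {a + real n * h .. a + real (Suc n) * h}"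
          "t \<in> {a + real n * h .. a + real (Suc n) * h}"
        using xy by (auto simp: U_def)
      then have "\<bar>s - t\<bar> \<le> h" by (auto simp: algebra_simps)
      then show ?thesis using c[of s t] mult_left_mono[OF _ \<open>K \<ge> 0\<close>] st by fastforce
    qed
    show "diameter (U n) \<le> (if n < N then K * h else 0)"
    proof (cases "n < N")
      case True
      then show ?thesis using * \<open>K \<ge> 0\<close> h by (auto intro!: diameter_le simp: dist_norm[symmetric])
    qed (simp add: U_def)
    show "bounded (U n)"
      unfolding bounded_two_points using * by (cases "n < N") (auto simp: U_def intro: exI[of _ "K * h"])
  qed
  have "c ` {a..b} \<subseteq> (\<Union>n. U n)"
  proof (cases "h = 0")
    case True
    then have "a = b" using h by simp
    then show ?thesis using N True by (auto simp: U_def intro!: exI[of _ 0])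
  next
    case False
    then have "h > 0" using h by simp
    show ?thesis
    proof safe
      fix t assume t: "t \<in> {a..b}"
      \<comment> \<open>The right end point belongs to the last piece, whereas the floor would give
        the index \<open>N\<close>.\<close>
      define n where "n = (if t = b then N - 1 else nat \<lfloor>(t - a) / h\<rfloor>)"
      have "n < N \<and> t \<in> {a + real n * h .. a + real (Suc n) * h}"
      proof (cases "t = b")
        case True
        then show ?thesis using N h by (auto simp: n_def of_nat_diff algebra_simps)
      next
        case False
        define q where "q = (t - a) / h"
        have q: "q \<ge> 0" "q < real N" "t = a + q * h"
          using t False \<open>h > 0\<close> h by (auto simp: q_def field_simps)
        have n: "n = nat \<lfloor>q\<rfloor>" using False by (simp add: n_def q_def)
        have "real n \<le> q" "q \<le> real (Suc n)" using q(1) unfolding n by linarith+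
        moreover have "n < N" using q calculation by linarith
        ultimately show ?thesis using q(3) \<open>h > 0\<close> by (auto intro!: mult_right_mono)
      qed
      then have "c t \<in> U n" by (auto simp: U_def)
      then show "c t \<in> (\<Union>n. U n)" by blast
    qed
  qed
  then have "U \<in> fine_covers d (c ` {a..b})"
    using U h d by (auto simp: fine_covers_def intro: order_trans split: if_splits)
       (smt (verit, best))
  then have "hausdorff1_content d (c ` {a..b}) \<le> (\<Sum>n. ennreal (diameter (U n)))"
    by (rule hausdorff1_content_le)
  also have "\<dots> = (\<Sum>n<N. ennreal (diameter (U n)))"
    by (rule suminf_finite) (auto simp: U_def)
  also have "\<dots> \<le> (\<Sum>n<N. ennreal (K * h))"
    by (rule sum_mono) (use U(2) in \<open>auto intro!: ennreal_leI split: if_splits\<close>, metis)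
  also have "\<dots> = ennreal (K * (b - a))"
  proof -
    have "ennreal (real N) * ennreal (K * h) = ennreal (real N * (K * h))"
      using \<open>K \<ge> 0\<close> h by (simp add: ennreal_mult)
    also have "real N * (K * h) = K * (b - a)" using h(3) by (simp add: mult.left_commute)
    finally show ?thesis by (simp add: ennreal_of_nat_eq_real_of_nat)
  qed
  finally show "hausdorff1_content d (c ` {a..b}) \<le> ennreal (K * (b - a))" .
qed


section \<open>Boundary integrals on Lipschitz domains\<close>

text \<open>A strict inequality above the graph persists nearby and so excludes limits of points of
  \<open>Om\<close>; from the graph itself one enters \<open>Om\<close> by moving down in the local
  coordinates.\<close>

lemma lipschitz_graph_frontier:
  fixes T :: "plane \<Rightarrow> plane"
  assumes T: "orthogonal_transformation T" and g: "continuous_on UNIV g" and Om: "open Om"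
    and eq: "Om \<inter> ball x r = {y \<in> ball x r. T y $ 2 < g (T y $ 1)}"
  shows "frontier Om \<inter> ball x r = {y \<in> ball x r. T y $ 2 = g (T y $ 1)}"
proof -
  have eqD: "y \<in> Om \<longleftrightarrow> T y $ 2 < g (T y $ 1)" if "dist x y < r" for y
    using eq that by (metis (mono_tags, lifting) Int_iff mem_Collect_eq mem_ball)
  have Tc: "continuous_on UNIV (\<lambda>y. T y $ j)" for j
    using orthogonal_transformation_linear[OF T] by (intro continuous_on_component linear_continuous_on) (simp add: linear_linear)
  have gc: "continuous_on UNIV (\<lambda>y. g (T y $ 1))"
    by (rule continuous_on_compose2[OF g Tc]) simp
  show ?thesis
  proof (intro equalityI subsetI)
    fix y assume y: "y \<in> frontier Om \<inter> ball x r"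
    then have "y \<notin> Om" using Om by (simp add: frontier_def interior_open)
    then have ge: "T y $ 2 \<ge> g (T y $ 1)" using y eqD[of y] by simp
    have "\<not> g (T y $ 1) < T y $ 2"
    proof
      assume less: "g (T y $ 1) < T y $ 2"
      define W where "W = ball x r \<inter> {y. g (T y $ 1) < T y $ 2}"
      have "open W" unfolding W_def using open_Collect_less[OF gc Tc] by auto
      moreover have "y \<in> W" using y less by (simp add: W_def)
      moreover have "W \<inter> Om = {}" using eqD by (fastforce simp: W_def)
      ultimately have "W \<inter> closure Om = {}" by (simp add: open_Int_closure_eq_empty)
      then show False using y \<open>y \<in> W\<close> unfolding frontier_def by blast
    qed
    then show "y \<in> {y \<in> ball x r. T y $ 2 = g (T y $ 1)}" using ge y by auto
  next
    fix y assume y: "y \<in> {y \<in> ball x r. T y $ 2 = g (T y $ 1)}"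
    then have "y \<notin> Om" using eqD[of y] by simp
    moreover have "y \<in> closure Om"
      unfolding closure_approachable
    proof (intro allI impI)
      fix e :: real assume "e > 0"
      have r: "dist x y < r" using y by simp
      define d where "d = min (e / 2) ((r - dist x y) / 2)"
      have d: "d > 0" "d < e" "d < r - dist x y"
        using \<open>e > 0\<close> r by (auto simp: d_def min_def)
      \<comment> \<open>\<open>T\<close> sends \<open>v\<close> to the second axis, so a step along
        \<open>- v\<close> lowers the second local coordinate and keeps the first.\<close>
      obtain v where v: "T v = axis 2 1"
        using orthogonal_transformation_surj[OF T] by (metis surjD)
      define z where "z = y - d *\<^sub>R v"
      have "norm v = 1" using orthogonal_transformation_norm[OF T, of v] v by simp
      then have "dist z y = d" using d by (simp add: z_def dist_norm)
      moreover have "T z = T y - d *\<^sub>R axis 2 1"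
        using orthogonal_transformation_linear[OF T] v by (simp add: z_def linear_diff linear_scale)
      then have "T z $ 1 = T y $ 1" "T z $ 2 < T y $ 2" using d by (auto simp: axis_def)
      moreover have "dist x z < r" using dist_triangle[of x z y] \<open>dist z y = d\<close> d by (simp add: dist_commute)
      ultimately have "z \<in> Om" using eqD[of z] y by simp
      then show "\<exists>z\<in>Om. dist z y < e" using \<open>dist z y = d\<close> d by auto
    qed
    ultimately show "y \<in> frontier Om \<inter> ball x r"
      using y Om by (simp add: frontier_def interior_open)
  qed
qed

lemma ennreal_le_double_cancel:
  assumes "ennreal (2 * d) \<le> 2 * X"
  shows "ennreal d \<le> X"
proof (cases X)
  case (real r)
  then have "2 * X = ennreal (2 * r)" by (simp add: ennreal_mult)
  then show ?thesis using assms real by (simp add: ennreal_le_iff2 split: if_splits)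
qed simp

lemma lipschitz_domainD:
  assumes "lipschitz_domain Om"
  shows "open Om" "bounded Om" "Om \<noteq> {}"
  using assms unfolding lipschitz_domain_def by blast+

text \<open>For finiteness, the boundary near \<open>x\<close> lies on a
  \<open>(1 + L)\<close>-Lipschitz curve. For the lower bound, the first local coordinate is
  1-Lipschitz and its values on the boundary near \<open>z\<close> fill an interval of length
  proportional to \<open>t\<close>.\<close>

lemma lipschitz_boundary_local:
  assumes "lipschitz_domain Om" "x \<in> frontier Om"
  obtains r c where "r > 0" "c > 0" "hausdorff1_outer (frontier Om \<inter> ball x r) < top"
    "\<And>z t. z \<in> frontier Om \<Longrightarrow> dist x z < r \<Longrightarrow> 0 < t \<Longrightarrow> t \<le> r \<Longrightarrow>
        ennreal (c * t) \<le> hausdorff1_outer (frontier Om \<inter> ball z t)"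
proof -
  have "\<forall>x\<in>frontier Om. \<exists>r>0. \<exists>(T::plane \<Rightarrow> plane) (g::real \<Rightarrow> real) L.
        orthogonal_transformation T \<and> L-lipschitz_on UNIV g \<and>
        Om \<inter> ball x r = {y \<in> ball x r. T y $ 2 < g (T y $ 1)}"
    using assms(1) unfolding lipschitz_domain_def by (elim conjE)
  from bspec[OF this assms(2)]
  obtain r and T :: "plane \<Rightarrow> plane" and g :: "real \<Rightarrow> real" and L where r: "r > 0" and T: "orthogonal_transformation T" and L: "L-lipschitz_on UNIV g"
    and eq: "Om \<inter> ball x r = {y \<in> ball x r. T y $ 2 < g (T y $ 1)}"
    by blast
  have Om: "open Om" by (rule lipschitz_domainD(1)[OF assms(1)])
  have gc: "continuous_on UNIV g" using L by (rule lipschitz_on_continuous_on)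
  note fr = lipschitz_graph_frontier[OF T gc Om eq]
  have L0: "L \<ge> 0" using L by (rule lipschitz_on_nonneg)
  have gL: "\<bar>g s - g t\<bar> \<le> L * \<bar>s - t\<bar>" for s t
    using lipschitz_onD[OF L, of s t] by (simp add: dist_real_def)
  define c where "c s = inv T (vector [s, g s])" for s
  have surj: "surj T" by (rule orthogonal_transformation_surj[OF T])
  have Tc: "T (c s) = vector [s, g s]" for s
    unfolding c_def by (rule surj_f_inv_f[OF surj])
  have lin: "linear T" by (rule orthogonal_transformation_linear[OF T])
  have distT: "dist (T y) (T z) = dist y z" for y z
    using orthogonal_transformation_norm[OF T, of "y - z"] linear_diff[OF lin, of y z] by (simp add: dist_norm)
  have cL: "dist (c s) (c t) \<le> (1 + L) * \<bar>s - t\<bar>" for s t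
  proof -
    have "dist (c s) (c t) = norm (vector [s, g s] - vector [t, g t] :: plane)"
      using distT[of "c s" "c t"] by (simp add: Tc dist_norm)
    also have "\<dots> \<le> \<bar>s - t\<bar> + \<bar>g s - g t\<bar>"
      using norm_le_l1_cart[of "vector [s, g s] - vector [t, g t] :: plane"] by (simp add: sum_2)
    also have "\<dots> \<le> (1 + L) * \<bar>s - t\<bar>" using gL[of s t] by (simp add: algebra_simps)
    finally show ?thesis .
  qed
  have on_graph: "y = c (T y $ 1)" if "T y $ 2 = g (T y $ 1)" for y
  proof -
    have "T y = T (c (T y $ 1))" unfolding Tc using that by (simp add: vec_eq_iff forall_2)
    then show ?thesis using orthogonal_transformation_inj[OF T] by (metis injD)
  qed
  have p: "\<bar>T y $ 1 - T z $ 1\<bar> \<le> dist y z" for y z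
    using component_le_norm_cart[of "T y - T z" 1] distT[of y z] by (simp add: dist_norm)
  show thesis
  \<comment> \<open>The radius \<open>r / 2\<close> keeps \<open>ball z t\<close> inside the chart.
    The graph over an interval of half-length \<open>t / (2 * (1 + L))\<close> stays within
    \<open>t / 2\<close> of \<open>z\<close>; its two halves compensate for the factor 2 in
    \<open>interval_length_le_hausdorff1\<close>.\<close>
  proof (rule that[of "r / 2" "1 / (2 * (1 + L))"])
    show "r / 2 > 0" "1 / (2 * (1 + L)) > 0" using r L0 by auto
    have "frontier Om \<inter> ball x (r / 2) \<subseteq> c ` {T x $ 1 - r .. T x $ 1 + r}"
    proof
      fix y assume y: "y \<in> frontier Om \<inter> ball x (r / 2)"
      then have "y \<in> frontier Om \<inter> ball x r" using r by auto
      then have "T y $ 2 = g (T y $ 1)" unfolding fr by simp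
      then have "y = c (T y $ 1)" by (rule on_graph)
      moreover have "T y $ 1 \<in> {T x $ 1 - r .. T x $ 1 + r}" using p[of x y] y r by auto
      ultimately show "y \<in> c ` {T x $ 1 - r .. T x $ 1 + r}" by (rule image_eqI)
    qed
    then have "hausdorff1_outer (frontier Om \<inter> ball x (r / 2)) \<le> hausdorff1_outer (c ` {T x $ 1 - r .. T x $ 1 + r})"
      by (rule hausdorff1.f_mono)
    also have "\<dots> \<le> ennreal ((1 + L) * ((T x $ 1 + r) - (T x $ 1 - r)))"
      by (rule hausdorff1_lipschitz_curve[OF cL]) (use r in simp)
    also have "\<dots> < top" by simp
    finally show "hausdorff1_outer (frontier Om \<inter> ball x (r / 2)) < top" .
    fix z t assume z: "z \<in> frontier Om" "dist x z < r / 2" and t: "0 < t" "t \<le> r / 2"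
    define d where "d = t / (2 * (1 + L))"
    have d: "d > 0" "(1 + L) * d = t / 2" using t L0 by (auto simp: d_def field_simps)
    define s0 where "s0 = T z $ 1"
    have "z \<in> frontier Om \<inter> ball x r" using z r by auto
    then have "T z $ 2 = g (T z $ 1)" unfolding fr by simp
    then have zc: "z = c s0" unfolding s0_def by (rule on_graph)
    have "ennreal ((s0 + d) - (s0 - d)) \<le> 2 * hausdorff1_outer (frontier Om \<inter> ball z t)"
    proof (rule interval_length_le_hausdorff1[of "\<lambda>y. T y $ 1", OF p])
      show "{s0 - d..s0 + d} \<subseteq> (\<lambda>y. T y $ 1) ` (frontier Om \<inter> ball z t)"
      proof
        fix s assume s: "s \<in> {s0 - d..s0 + d}"
        then have "\<bar>s0 - s\<bar> \<le> d" by auto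
        then have "(1 + L) * \<bar>s0 - s\<bar> \<le> (1 + L) * d" using L0 by (intro mult_left_mono) auto
        from order_trans[OF cL this] have zs: "dist z (c s) < t" using d(2) t(1) zc by simp
        moreover have "dist x (c s) < r" using zs z t dist_triangle[of x "c s" z] by linarith
        ultimately have "c s \<in> frontier Om \<inter> ball x r" unfolding fr by (simp add: Tc)
        then show "s \<in> (\<lambda>y. T y $ 1) ` (frontier Om \<inter> ball z t)"
          using zs by (intro image_eqI[of _ _ "c s"]) (auto simp: Tc)
      qed
    qed (use d in simp)
    then have "ennreal (2 * d) \<le> 2 * hausdorff1_outer (frontier Om \<inter> ball z t)" by simp
    then have "ennreal d \<le> hausdorff1_outer (frontier Om \<inter> ball z t)"
      by (rule ennreal_le_double_cancel)
    then show "ennreal (1 / (2 * (1 + L)) * t) \<le> hausdorff1_outer (frontier Om \<inter> ball z t)"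
      by (simp add: d_def)
  qed
qed

text \<open>Compactness of the boundary makes the local constants uniform.\<close>

lemma lipschitz_boundary:
  assumes "lipschitz_domain Om"
  obtains c t0 where "c > 0" "t0 > 0" "hausdorff1_outer (frontier Om) < top"
    "\<And>z t. z \<in> frontier Om \<Longrightarrow> 0 < t \<Longrightarrow> t \<le> t0 \<Longrightarrow>
        ennreal (c * t) \<le> hausdorff1_outer (frontier Om \<inter> ball z t)"
proof -
  have comp: "compact (frontier Om)"
    by (intro compact_frontier_bounded lipschitz_domainD(2)[OF assms])
  have "\<forall>x\<in>frontier Om. \<exists>r c. r > 0 \<and> c > 0 \<and> hausdorff1_outer (frontier Om \<inter> ball x r) < top \<and>
    (\<forall>z t. z \<in> frontier Om \<longrightarrow> dist x z < r \<longrightarrow> 0 < t \<longrightarrow> t \<le> r \<longrightarrow>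
        ennreal (c * t) \<le> hausdorff1_outer (frontier Om \<inter> ball z t))"
    using lipschitz_boundary_local[OF assms] by metis
  then obtain r c where rc: "\<And>x. x \<in> frontier Om \<Longrightarrow> r x > 0 \<and> c x > 0 \<and> hausdorff1_outer (frontier Om \<inter> ball x (r x)) < top \<and>
    (\<forall>z t. z \<in> frontier Om \<longrightarrow> dist x z < r x \<longrightarrow> 0 < t \<longrightarrow> t \<le> r x \<longrightarrow>
        ennreal (c x * t) \<le> hausdorff1_outer (frontier Om \<inter> ball z t))"
    by metis
  have cov: "frontier Om \<subseteq> (\<Union>x\<in>frontier Om. ball x (r x))" using rc by force
  obtain F where F: "F \<subseteq> frontier Om" "finite F" "frontier Om \<subseteq> (\<Union>x\<in>F. ball x (r x))"
    by (rule compactE_image[OF comp _ cov]) auto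
  \<comment> \<open>Inserting 1 keeps the minima defined for an empty \<open>F\<close>.\<close>
  define c0 where "c0 = Min (insert 1 (c ` F))"
  define r0 where "r0 = Min (insert 1 (r ` F))"
  have c0: "c0 > 0" "\<And>x. x \<in> F \<Longrightarrow> c0 \<le> c x" using F rc by (auto simp: c0_def)
  have r0: "r0 > 0" "\<And>x. x \<in> F \<Longrightarrow> r0 \<le> r x" using F rc by (auto simp: r0_def)
  have "hausdorff1_outer (\<Union>x\<in>G. frontier Om \<inter> ball x (r x)) < top" if "finite G" "G \<subseteq> F" for G
    using that
  proof (induction G rule: finite_induct)
    case empty
    then show ?case by (simp add: hausdorff1.f_empty)
  next
    case (insert x G)
    have "hausdorff1_outer (\<Union>x\<in>insert x G. frontier Om \<inter> ball x (r x)) \<le>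
       hausdorff1_outer (frontier Om \<inter> ball x (r x)) + hausdorff1_outer (\<Union>x\<in>G. frontier Om \<inter> ball x (r x))"
      using hausdorff1.f_subadditive by simp
    also have "\<dots> < top" using insert rc F by (auto simp: subset_iff)
    finally show ?case .
  qed
  then have "hausdorff1_outer (\<Union>x\<in>F. frontier Om \<inter> ball x (r x)) < top" using F by blast
  moreover have "frontier Om \<subseteq> (\<Union>x\<in>F. frontier Om \<inter> ball x (r x))" using F by blast
  ultimately have fin: "hausdorff1_outer (frontier Om) < top"
    using hausdorff1.f_mono le_less_trans by blast
  show thesis
  proof (rule that[OF c0(1) r0(1) fin])
    fix z t assume z: "z \<in> frontier Om" and t: "0 < t" "t \<le> r0"
    obtain x where x: "x \<in> F" "dist x z < r x" using F(3) z by auto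
    have "ennreal (c0 * t) \<le> ennreal (c x * t)" using c0(2)[OF x(1)] t by (intro ennreal_leI mult_right_mono) auto
    also have "\<dots> \<le> hausdorff1_outer (frontier Om \<inter> ball z t)"
      using rc[of x] x z t r0(2)[OF x(1)] F(1) by auto
    finally show "ennreal (c0 * t) \<le> hausdorff1_outer (frontier Om \<inter> ball z t)" .
  qed
qed

lemma sets_boundary_measure: "A \<in> sets borel \<Longrightarrow> A \<subseteq> frontier Om \<Longrightarrow> A \<in> sets (boundary_measure Om)"
  by (auto simp: boundary_measure_def sets_restrict_space)

lemma space_boundary_measure [simp]: "space (boundary_measure Om) = frontier Om"
  by (simp add: boundary_measure_def space_restrict_space)

lemma emeasure_boundary_measure:
  "A \<in> sets borel \<Longrightarrow> A \<subseteq> frontier Om \<Longrightarrow> emeasure (boundary_measure Om) A = hausdorff1_outer A"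
  by (simp add: boundary_measure_def emeasure_restrict_space emeasure_hausdorff1)

lemma finite_boundary_measure:
  assumes "lipschitz_domain Om"
  shows "finite_measure (boundary_measure Om)"
proof (rule finite_measureI)
  have "hausdorff1_outer (frontier Om) < top" using lipschitz_boundary[OF assms] by metis
  then show "emeasure (boundary_measure Om) (space (boundary_measure Om)) \<noteq> \<infinity>"
    by (simp add: emeasure_boundary_measure)
qed

lemma borel_measurable_boundary_measure: "f \<in> borel_measurable borel \<Longrightarrow> f \<in> borel_measurable (boundary_measure Om)"
  unfolding boundary_measure_def by (intro measurable_restrict_space1) (simp add: measurable_cong_sets[OF sets_hausdorff1 refl])

text \<open>Points of the tube see a boundary portion of measure at least proportional to \<open>t\<close>;
  Fubini's theorem turns this into an upper bound for the integral over the tube.\<close>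

lemma tube_integral_bound:
  assumes Om: "lipschitz_domain Om"
  shows "\<exists>C\<ge>0. \<forall>h e. continuous_on UNIV h \<longrightarrow> (\<forall>x. h x \<ge> 0) \<longrightarrow> e > 0 \<longrightarrow>
    (\<exists>t0>0. \<forall>t. 0 < t \<longrightarrow> t \<le> t0 \<longrightarrow> (\<integral>\<^sup>+x. ennreal (h x) * indicator {x. infdist x (frontier Om) \<le> t} x \<partial>lborel)
      \<le> ennreal (C * t) * (\<integral>\<^sup>+y. ennreal (h y + e) \<partial>boundary_measure Om))"
proof -
  let ?K = "frontier Om" and ?M = "boundary_measure Om"
  obtain c t1 where c: "c > 0" "t1 > 0" and
    low: "\<And>z t. z \<in> frontier Om \<Longrightarrow> 0 < t \<Longrightarrow> t \<le> t1 \<Longrightarrow>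
        ennreal (c * t) \<le> hausdorff1_outer (frontier Om \<inter> ball z t)"
    using lipschitz_boundary[OF Om] by metis
  have bd: "bounded Om" and ne: "Om \<noteq> {}" using lipschitz_domainD[OF Om] by auto
  have K: "compact ?K" "?K \<noteq> {}"
    using bd ne not_bounded_UNIV by (auto intro: compact_frontier_bounded simp: frontier_eq_empty)
  interpret M: finite_measure ?M by (rule finite_boundary_measure[OF Om])
  interpret P: pair_sigma_finite lborel ?M ..
  define V where "V = unit_ball_vol (real DIM(plane))"
  have V: "V \<ge> 0" by (simp add: V_def)
  \<comment> \<open>A ball of radius \<open>2 * t\<close> has area \<open>4 * V * t * t\<close>;
    division by the lower bound \<open>c * t\<close> for a boundary portion leaves
    \<open>C * t\<close>.\<close>
  define C where "C = 4 * V / c"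
  show ?thesis
  proof (rule exI[of _ C], intro conjI allI impI)
    show "C \<ge> 0" using V c by (simp add: C_def)
    fix h :: "plane \<Rightarrow> real" and e :: real
    assume h: "continuous_on UNIV h" "\<forall>x. h x \<ge> 0" and e: "e > 0"
    define S where "S = {x. infdist x ?K \<le> 1}"
    have "compact S" unfolding S_def using K by (intro compact_infdist_le) auto
    then have "uniformly_continuous_on S h"
      using h(1) continuous_on_subset by (intro compact_uniformly_continuous) auto
    then obtain d where d: "d > 0" "\<And>x y. x \<in> S \<Longrightarrow> y \<in> S \<Longrightarrow> dist y x < d \<Longrightarrow> dist (h y) (h x) < e"
      using e unfolding uniformly_continuous_on_def by metis
    have [measurable]: "h \<in> borel_measurable borel" using h(1) by (simp add: borel_measurable_continuous_onI)
    have [measurable]: "(\<lambda>x. infdist x ?K) \<in> borel_measurable borel"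
      by (intro borel_measurable_continuous_onI continuous_intros)
    have sM: "A \<inter> ?K \<in> sets ?M" if "A \<in> sets borel" for A
      using that by (intro sets_boundary_measure) auto
    show "\<exists>t0>0. \<forall>t. 0 < t \<longrightarrow> t \<le> t0 \<longrightarrow> (\<integral>\<^sup>+x. ennreal (h x) * indicator {x. infdist x ?K \<le> t} x \<partial>lborel)
      \<le> ennreal (C * t) * (\<integral>\<^sup>+y. ennreal (h y + e) \<partial>?M)"
    \<comment> \<open>\<open>t1\<close> is the range of \<open>low\<close>, the bound 1 puts the
      tube into the compact set \<open>S\<close>, and \<open>d / 3\<close> gives
      \<open>2 * t < d\<close>, as uniform continuity demands.\<close>
    proof (rule exI[of _ "min (min t1 1) (d / 3)"], intro conjI allI impI)
      show "0 < min (min t1 1) (d / 3)" using c d by simp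
      fix t assume t: "0 < t" "t \<le> min (min t1 1) (d / 3)"
      \<comment> \<open>The kernel couples \<open>x\<close> with the boundary points closer than
        \<open>2 * t\<close>; for \<open>x\<close> in the tube these include the part of the
        boundary within \<open>t\<close> of a point nearest to \<open>x\<close>.\<close>
      let ?f = "\<lambda>(x, y). indicator {(x, y). dist x y < 2 * t} (x, y) * ennreal (h y + e)"
      have idM: "(\<lambda>y. y) \<in> measurable ?M borel" by (rule borel_measurable_boundary_measure) simp
      have fm: "?f \<in> borel_measurable (lborel \<Otimes>\<^sub>M ?M)"
      proof -
        have 1: "fst \<in> borel_measurable (lborel \<Otimes>\<^sub>M ?M)"
          using measurable_fst[of lborel ?M] by simp
        have 2: "snd \<in> borel_measurable (lborel \<Otimes>\<^sub>M ?M)"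
          using measurable_compose[OF measurable_snd idM, of lborel] by (simp add: comp_def)
        have "(\<lambda>p. dist (fst p) (snd p)) \<in> borel_measurable (lborel \<Otimes>\<^sub>M ?M)"
          by (rule borel_measurable_dist[OF 1 2])
        then have "{p \<in> space (lborel \<Otimes>\<^sub>M ?M). dist (fst p) (snd p) < 2 * t} \<in> sets (lborel \<Otimes>\<^sub>M ?M)"
          by (rule borel_measurable_less) simp
        moreover have "(\<lambda>p. ennreal (h (snd p) + e)) \<in> borel_measurable (lborel \<Otimes>\<^sub>M ?M)"
          by (rule measurable_compose[OF 2, of "\<lambda>y. ennreal (h y + e)"]) measurable
        ultimately have "(\<lambda>p. if dist (fst p) (snd p) < 2 * t then ennreal (h (snd p) + e) else 0)
            \<in> borel_measurable (lborel \<Otimes>\<^sub>M ?M)"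
          by (intro measurable_If) auto
        moreover have "(\<lambda>p. if dist (fst p) (snd p) < 2 * t then ennreal (h (snd p) + e) else 0) = ?f"
          by (auto simp: indicator_def)
        ultimately show ?thesis by simp
      qed
      have "ennreal (c * t) * (\<integral>\<^sup>+x. ennreal (h x) * indicator {x. infdist x ?K \<le> t} x \<partial>lborel)
        = (\<integral>\<^sup>+x. ennreal (c * t) * (ennreal (h x) * indicator {x. infdist x ?K \<le> t} x) \<partial>lborel)"
        by (rule nn_integral_cmult[symmetric]) measurable
      also have "\<dots> \<le> (\<integral>\<^sup>+x. (\<integral>\<^sup>+y. ?f (x, y) \<partial>?M) \<partial>lborel)"
      proof (rule nn_integral_mono)
        fix x :: plane
        show "ennreal (c * t) * (ennreal (h x) * indicator {x. infdist x ?K \<le> t} x) \<le> (\<integral>\<^sup>+y. ?f (x, y) \<partial>?M)"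
        proof (cases "infdist x ?K \<le> t")
          case True
          obtain z where z: "z \<in> ?K" "infdist x ?K = dist x z"
            using infdist_attains_inf[of ?K x] K by auto
          have xS: "x \<in> S" using True t by (simp add: S_def)
          have "ennreal (c * t) \<le> emeasure ?M (ball z t \<inter> ?K)"
            using low[OF z(1), of t] t by (simp add: emeasure_boundary_measure Int_commute)
          then have "ennreal (c * t) * ennreal (h x) \<le> emeasure ?M (ball z t \<inter> ?K) * ennreal (h x)"
            by (rule mult_right_mono) simp
          also have "\<dots> = (\<integral>\<^sup>+y. ennreal (h x) * indicator (ball z t \<inter> ?K) y \<partial>?M)"
            by (subst nn_integral_cmult_indicator) (auto intro!: sM simp: mult.commute)
          also have "\<dots> \<le> (\<integral>\<^sup>+y. ?f (x, y) \<partial>?M)"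
          proof (rule nn_integral_mono)
            fix y assume "y \<in> space ?M"
            then have yK: "y \<in> ?K" by simp
            show "ennreal (h x) * indicator (ball z t \<inter> ?K) y \<le> ?f (x, y)"
            proof (cases "y \<in> ball z t")
              case True
              have xy: "dist x y < 2 * t" using True z \<open>infdist x ?K \<le> t\<close> dist_triangle[of x y z] by auto
              have "y \<in> S" using yK by (simp add: S_def)
              then have "dist (h y) (h x) < e" using d(2)[OF xS, of y] xy t by (simp add: dist_commute)
              then have "h x \<le> h y + e" by (simp add: dist_real_def)
              then show ?thesis using xy True by (auto simp: indicator_def intro: ennreal_leI)
            qed simp
          qed
          finally show ?thesis using True by simp
        qed simp
      qed
      also have "\<dots> = (\<integral>\<^sup>+y. (\<integral>\<^sup>+x. ?f (x, y) \<partial>lborel) \<partial>?M)"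
        using P.Fubini[of ?f] fm by simp
      also have "\<dots> = (\<integral>\<^sup>+y. ennreal (4 * V * t * t) * ennreal (h y + e) \<partial>?M)"
      proof (rule nn_integral_cong)
        fix y
        have "(\<integral>\<^sup>+x. ?f (x, y) \<partial>lborel) = (\<integral>\<^sup>+x. ennreal (h y + e) * indicator (ball y (2 * t)) x \<partial>lborel)"
          by (rule nn_integral_cong) (simp add: indicator_def dist_commute)
        also have "\<dots> = ennreal (h y + e) * emeasure lborel (ball y (2 * t))"
          by (rule nn_integral_cmult_indicator) simp
        also have "emeasure lborel (ball y (2 * t)) = ennreal (4 * V * t * t)"
          using t by (simp add: emeasure_ball V_def power2_eq_square mult_ac)
        finally show "(\<integral>\<^sup>+x. ?f (x, y) \<partial>lborel) = ennreal (4 * V * t * t) * ennreal (h y + e)"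
          by (simp add: mult.commute)
      qed
      also have "\<dots> = ennreal (4 * V * t * t) * (\<integral>\<^sup>+y. ennreal (h y + e) \<partial>?M)"
        using borel_measurable_boundary_measure[of "\<lambda>y. ennreal (h y + e)" Om] by (intro nn_integral_cmult) simp
      also have "ennreal (4 * V * t * t) = ennreal (c * t) * ennreal (C * t)"
        using c t V by (simp add: C_def ennreal_mult[symmetric] del: ennreal_mult)
      finally have main: "ennreal (c * t) * (\<integral>\<^sup>+x. ennreal (h x) * indicator {x. infdist x ?K \<le> t} x \<partial>lborel)
        \<le> ennreal (c * t) * (ennreal (C * t) * (\<integral>\<^sup>+y. ennreal (h y + e) \<partial>?M))" by (simp add: mult.assoc)
      then show "(\<integral>\<^sup>+x. ennreal (h x) * indicator {x. infdist x ?K \<le> t} x \<partial>lborel)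
      \<le> ennreal (C * t) * (\<integral>\<^sup>+y. ennreal (h y + e) \<partial>?M)"
        using c t by (subst (asm) ennreal_mult_le_mult_iff) auto
    qed
  qed
qed

section \<open>Difference quotients and translations of the domain\<close>

lemma integral_lebesgue_on_eq_lborel:
  fixes f :: "'a::euclidean_space \<Rightarrow> 'b::{banach, second_countable_topology}"
  assumes "f \<in> borel_measurable borel" "S \<in> sets borel"
  shows "(LINT x|lebesgue_on S. f x) = (LINT x|lborel. indicator S x *\<^sub>R f x)"
  using assms by (subst integral_restrict_space) (auto intro!: integral_completion borel_measurable_scaleR)

lemma smooth_line_derivative:
  assumes "smooth h"
  shows "((\<lambda>s. h (x + s *\<^sub>R axis i 1)) has_vector_derivative partial_deriv i h (x + s *\<^sub>R axis i 1)) (at s within S)"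
proof -
  have 1: "((\<lambda>s. x + s *\<^sub>R axis i 1) has_derivative (\<lambda>t. t *\<^sub>R axis i 1)) (at s)"
    by (auto intro!: derivative_eq_intros)
  let ?y = "x + s *\<^sub>R axis i 1"
  have 2: "(h has_derivative frechet_derivative h (at ?y)) (at ?y)"
    using smooth_differentiable[OF assms] by (rule differentiable_has_frechet)
  have "((\<lambda>s. h (x + s *\<^sub>R axis i 1)) has_derivative (\<lambda>t. frechet_derivative h (at ?y) (t *\<^sub>R axis i 1))) (at s)"
    by (rule has_derivative_compose[OF 1 2])
  moreover have "frechet_derivative h (at ?y) (t *\<^sub>R axis i 1) = t *\<^sub>R partial_deriv i h ?y" for t
    using has_derivative_linear[OF 2] by (simp add: linear_scale partial_deriv_def)
  ultimately have "((\<lambda>s. h (x + s *\<^sub>R axis i 1)) has_vector_derivative partial_deriv i h ?y) (at s)"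
    by (simp add: has_vector_derivative_def)
  then show ?thesis by (rule has_vector_derivative_at_within)
qed

lemma smooth_quotient_tendsto:
  assumes "smooth h"
  shows "(\<lambda>n. (h (x + (1 / real (Suc n)) *\<^sub>R axis i 1) - h x) /\<^sub>R (1 / real (Suc n))) \<longlonglongrightarrow> partial_deriv i h x"
proof -
  have "((\<lambda>s. h (x + s *\<^sub>R axis i 1)) has_vector_derivative partial_deriv i h x) (at 0)"
    using smooth_line_derivative[OF assms, of x i 0 UNIV] by simp
  then have L: "((\<lambda>s. norm (h (x + s *\<^sub>R axis i 1) - h x - s *\<^sub>R partial_deriv i h x) / norm s) \<longlongrightarrow> 0) (at 0)"
    by (simp add: has_vector_derivative_def has_derivative_at)
  have "((\<lambda>s. (h (x + s *\<^sub>R axis i 1) - h x) /\<^sub>R s - partial_deriv i h x) \<longlongrightarrow> 0) (at 0)"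
  proof (rule tendsto_norm_zero_cancel, rule Lim_transform_eventually[OF L])
    have "norm (h (x + s *\<^sub>R axis i 1) - h x - s *\<^sub>R partial_deriv i h x) / norm s
        = norm ((h (x + s *\<^sub>R axis i 1) - h x) /\<^sub>R s - partial_deriv i h x)" if "s \<noteq> 0" for s
    proof -
      have "(h (x + s *\<^sub>R axis i 1) - h x) /\<^sub>R s - partial_deriv i h x
          = (h (x + s *\<^sub>R axis i 1) - h x - s *\<^sub>R partial_deriv i h x) /\<^sub>R s"
        using that by (simp add: scaleR_diff_right)
      then show ?thesis by (simp only: norm_scaleR norm_inverse divide_inverse mult.commute real_norm_def abs_inverse)
    qed
    then show "\<forall>\<^sub>F s in at 0. norm (h (x + s *\<^sub>R axis i 1) - h x - s *\<^sub>R partial_deriv i h x) / norm s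
        = norm ((h (x + s *\<^sub>R axis i 1) - h x) /\<^sub>R s - partial_deriv i h x)"
      by (auto simp: eventually_at_filter)
  qed
  then have "((\<lambda>s. (h (x + s *\<^sub>R axis i 1) - h x) /\<^sub>R s) \<longlongrightarrow> partial_deriv i h x) (at 0)"
    by (rule LIM_zero_cancel)
  moreover have "filterlim (\<lambda>n. 1 / real (Suc n)) (at 0) sequentially"
    unfolding filterlim_at using LIMSEQ_inverse_real_of_nat by (simp add: inverse_eq_divide)
  ultimately show ?thesis by (rule filterlim_compose)
qed

lemma smooth_quotient_bound:
  assumes h: "smooth h" and B: "\<And>s. 0 \<le> s \<Longrightarrow> s \<le> t \<Longrightarrow> cmod (partial_deriv i h (x + s *\<^sub>R axis i 1)) \<le> B" and t: "0 \<le> t"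
  shows "cmod (h (x + t *\<^sub>R axis i 1) - h x) \<le> B * t"
proof -
  have "norm ((\<lambda>s. h (x + s *\<^sub>R axis i 1)) t - (\<lambda>s. h (x + s *\<^sub>R axis i 1)) 0) \<le> B * norm (t - 0)"
  proof (rule differentiable_bound[where S = "{0..t}"])
    fix s assume s: "s \<in> {0..t}"
    show "((\<lambda>s. h (x + s *\<^sub>R axis i 1)) has_derivative (\<lambda>r. r *\<^sub>R partial_deriv i h (x + s *\<^sub>R axis i 1))) (at s within {0..t})"
      using smooth_line_derivative[OF h] by (simp add: has_vector_derivative_def)
    show "onorm (\<lambda>r. r *\<^sub>R partial_deriv i h (x + s *\<^sub>R axis i 1)) \<le> B"
    proof (rule onorm_le)
      fix r show "norm (r *\<^sub>R partial_deriv i h (x + s *\<^sub>R axis i 1)) \<le> B * norm r"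
        using mult_right_mono[OF B[of s], of "\<bar>r\<bar>"] s by (simp add: mult.commute)
    qed
  qed (use t in auto)
  then show ?thesis using t by simp
qed

text \<open>The segment from \<open>x\<close> to \<open>x - v\<close> joins a point of
  \<open>S\<close> to a point outside and therefore meets the frontier.\<close>

lemma infdist_frontier_le_of_crossing:
  fixes x :: "'a::euclidean_space"
  assumes "(x \<in> S) \<noteq> (x - v \<in> S)"
  shows "infdist x (frontier S) \<le> norm v"
proof -
  have "closed_segment x (x - v) \<inter> frontier S \<noteq> {}"
    using assms by (intro connected_Int_frontier) auto
  then obtain z where z: "z \<in> closed_segment x (x - v)" "z \<in> frontier S" by blast
  have "infdist x (frontier S) \<le> dist x z" using z(2) by (rule infdist_le)
  also have "\<dots> \<le> dist x (x - v)"
    using z(1) dist_in_closed_segment[of z x "x - v"] by (simp add: dist_commute)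
  finally show ?thesis by (simp add: dist_norm)
qed

lemma integrable_boundary_measure:
  fixes h :: "plane \<Rightarrow> 'b::{banach, second_countable_topology}"
  assumes Om: "lipschitz_domain Om" and h: "continuous_on UNIV h"
  shows "integrable (boundary_measure Om) h"
proof -
  interpret M: finite_measure "boundary_measure Om" by (rule finite_boundary_measure[OF Om])
  have "compact (frontier Om)" by (intro compact_frontier_bounded lipschitz_domainD(2)[OF Om])
  then have "bounded (h ` frontier Om)"
    using h continuous_on_subset by (intro compact_imp_bounded compact_continuous_image) auto
  then obtain B where "\<And>y. y \<in> frontier Om \<Longrightarrow> norm (h y) \<le> B" by (auto simp: bounded_iff)
  then have "AE y in boundary_measure Om. norm (h y) \<le> B" by (intro AE_I2) simp
  then show ?thesis
    using h by (intro M.integrable_const_bound borel_measurable_boundary_measure borel_measurable_continuous_onI)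
qed

text \<open>\<open>C\<close> depends on the domain only, which is what permits the application to a
  sequence of differences. The error \<open>e\<close> of the tube bound is removed last, after the
  limit of the difference quotients.\<close>

lemma boundary_estimate:
  assumes Om: "lipschitz_domain Om"
  obtains C where "C \<ge> 0" "\<And>h i. smooth h \<Longrightarrow>
    cmod (LINT x|lebesgue_on Om. partial_deriv i h x) \<le> C * (LINT y|boundary_measure Om. cmod (h y))"
proof -
  let ?K = "frontier Om" and ?M = "boundary_measure Om"
  obtain C where C: "C \<ge> 0" "\<forall>h e. continuous_on UNIV h \<longrightarrow> (\<forall>x. h x \<ge> 0) \<longrightarrow> e > 0 \<longrightarrow>
    (\<exists>t0>0. \<forall>t. 0 < t \<longrightarrow> t \<le> t0 \<longrightarrow> (\<integral>\<^sup>+x. ennreal (h x) * indicator {x. infdist x (frontier Om) \<le> t} x \<partial>lborel)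
      \<le> ennreal (C * t) * (\<integral>\<^sup>+y. ennreal (h y + e) \<partial>boundary_measure Om))"
    using tube_integral_bound[OF Om] by (elim exE conjE)
  interpret M: finite_measure ?M by (rule finite_boundary_measure[OF Om])
  have bd: "bounded Om" and op: "open Om" using lipschitz_domainD[OF Om] by auto
  have [measurable]: "Om \<in> sets borel" using op by simp
  have fin: "emeasure lborel Om < \<infinity>" using emeasure_bounded_finite[OF bd] .
  show thesis
  proof (rule that[OF C(1)])
    fix h :: cfun and i :: 2
    assume h: "smooth h"
    have hc: "continuous_on UNIV h" by (rule smooth_continuous[OF h])
    have [measurable]: "h \<in> borel_measurable borel" using hc by (rule borel_measurable_continuous_onI)
    have pc: "continuous_on UNIV (partial_deriv i h)" by (intro smooth_continuous smooth_partial_deriv h)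
    then have pm [measurable]: "partial_deriv i h \<in> borel_measurable borel" by (rule borel_measurable_continuous_onI)
    define v :: plane where "v = axis i 1"
    have v: "norm v = 1" by (simp add: v_def)
    define t where "t n = 1 / real (Suc n)" for n
    have t: "t n > 0" "t n \<le> 1" for n by (auto simp: t_def)
    \<comment> \<open>The shifts are at most 1, so shifted points stay in the ball of radius
      \<open>R + 1\<close>, where the derivative is bounded by \<open>B\<close>; this dominates all
      quotients.\<close>
    obtain R where R: "\<And>x. x \<in> Om \<Longrightarrow> norm x \<le> R" using bd by (auto simp: bounded_iff)
    have "bounded (partial_deriv i h ` cball 0 (R + 1))"
      using pc continuous_on_subset by (intro compact_imp_bounded compact_continuous_image) auto
    then obtain B where "\<forall>x\<in>cball 0 (R + 1). cmod (partial_deriv i h x) \<le> B" by (auto simp: bounded_iff)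
    then have B: "cmod (partial_deriv i h x) \<le> B" if "norm x \<le> R + 1" for x using that by simp
    have bound: "cmod (h (x + s *\<^sub>R v) - h x) \<le> B * s" if "x \<in> Om" "0 \<le> s" "s \<le> 1" for x s
      unfolding v_def
    proof (rule smooth_quotient_bound[OF h _ that(2)])
      fix r assume "0 \<le> r" "r \<le> s"
      then have "norm (x + r *\<^sub>R v) \<le> R + 1"
        using norm_triangle_ineq[of x "r *\<^sub>R v"] R[OF that(1)] v that by simp
      then show "cmod (partial_deriv i h (x + r *\<^sub>R axis i 1)) \<le> B" unfolding v_def by (rule B)
    qed
    have int_Om: "integrable lborel (\<lambda>x. indicator Om x *\<^sub>R b)" for b :: real
      using fin by simp
    define q where "q n x = indicator Om x *\<^sub>R ((h (x + t n *\<^sub>R v) - h x) /\<^sub>R t n)" for n x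
    have lim: "(\<lambda>n. LINT x|lborel. q n x) \<longlonglongrightarrow> (LINT x|lborel. indicator Om x *\<^sub>R partial_deriv i h x)"
    proof (rule integral_dominated_convergence[where w = "\<lambda>x. indicator Om x *\<^sub>R B"])
      show "AE x in lborel. (\<lambda>n. q n x) \<longlonglongrightarrow> indicator Om x *\<^sub>R partial_deriv i h x"
        unfolding q_def t_def v_def by (intro AE_I2 tendsto_scaleR tendsto_const smooth_quotient_tendsto[OF h])
      show "AE x in lborel. norm (q n x) \<le> indicator Om x *\<^sub>R B" for n
      proof (rule AE_I2)
        fix x show "norm (q n x) \<le> indicator Om x *\<^sub>R B"
        proof (cases "x \<in> Om")
          case True
          have "norm (q n x) = cmod (h (x + t n *\<^sub>R v) - h x) / t n"
            using True t(1)[of n] unfolding q_def by (simp add: divide_inverse mult.commute)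
          also have "\<dots> \<le> B" using bound[OF True, of "t n"] t[of n] by (simp add: pos_divide_le_eq)
          finally show ?thesis using True by simp
        qed (simp add: q_def)
      qed
      show "q n \<in> borel_measurable lborel" for n unfolding q_def by measurable
    qed (use int_Om in auto)
    have le: "cmod (LINT x|lborel. indicator Om x *\<^sub>R partial_deriv i h x) \<le> C * ((LINT y|?M. cmod (h y)) + e * measure ?M ?K)"
      if e: "e > 0" for e
    proof -
      define I where "I = (LINT y|?M. cmod (h y)) + e * measure ?M ?K"
      have ih: "integrable ?M (\<lambda>y. cmod (h y))" by (intro integrable_boundary_measure[OF Om] continuous_intros hc)
      have "(\<integral>\<^sup>+y. ennreal (cmod (h y) + e) \<partial>?M) = ennreal (LINT y|?M. cmod (h y) + e)"
        using ih e by (intro nn_integral_eq_integral) auto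
      also have "(LINT y|?M. cmod (h y) + e) = I"
        using ih by (simp add: I_def mult.commute)
      finally have nn: "(\<integral>\<^sup>+y. ennreal (cmod (h y) + e) \<partial>?M) = ennreal I" .
      have I0: "I \<ge> 0" unfolding I_def using e by (intro add_nonneg_nonneg) auto
      obtain t0 where t0: "t0 > 0" "\<And>t. 0 < t \<Longrightarrow> t \<le> t0 \<Longrightarrow>
          (\<integral>\<^sup>+x. ennreal (cmod (h x)) * indicator {x. infdist x ?K \<le> t} x \<partial>lborel) \<le> ennreal (C * t) * ennreal I"
        using C(2)[rule_format, of "\<lambda>x. cmod (h x)" e] e continuous_on_norm[OF hc] nn by auto
      have "\<forall>\<^sub>F n in sequentially. t n < t0"
        using LIMSEQ_inverse_real_of_nat t0(1) unfolding t_def by (auto simp: inverse_eq_divide dest: order_tendstoD(2))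
      then have "\<forall>\<^sub>F n in sequentially. cmod (LINT x|lborel. q n x) \<le> C * I"
      proof eventually_elim
        case (elim n)
        define s where "s = t n"
        have s: "0 < s" "s \<le> t0" using t[of n] elim by (auto simp: s_def)
        have ints: "integrable lborel (\<lambda>x. indicator Om x *\<^sub>R h (x + r *\<^sub>R v))" for r
        proof -
          have "bounded ((\<lambda>x. h (x + r *\<^sub>R v)) ` closure Om)"
            using bd hc by (intro compact_imp_bounded compact_continuous_image continuous_on_compose2[OF hc])
              (auto intro!: continuous_intros simp: compact_closure)
          then obtain B' where "\<And>x. x \<in> closure Om \<Longrightarrow> cmod (h (x + r *\<^sub>R v)) \<le> B'" by (auto simp: bounded_iff)
          then have "AE x in lborel. norm (indicator Om x *\<^sub>R h (x + r *\<^sub>R v)) \<le> norm (indicator Om x *\<^sub>R B')"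
            using closure_subset[of Om] by (intro AE_I2) (fastforce simp: indicator_def)
          then show ?thesis
            by (rule Bochner_Integration.integrable_bound[OF int_Om, rotated]) measurable
        qed
        \<comment> \<open>Translation invariance moves the shift from \<open>h\<close> to the
          domain.\<close>
        have tr: "(LINT x|lborel. indicator Om x *\<^sub>R h (x + s *\<^sub>R v)) = (LINT x|lborel. indicator Om (x - s *\<^sub>R v) *\<^sub>R h x)"
          and ints': "integrable lborel (\<lambda>x. indicator Om (x - s *\<^sub>R v) *\<^sub>R h x)"
        proof -
          have d: "lborel = distr lborel borel ((+) (s *\<^sub>R v))" by (simp add: lborel_distr_plus)
          show "(LINT x|lborel. indicator Om x *\<^sub>R h (x + s *\<^sub>R v)) = (LINT x|lborel. indicator Om (x - s *\<^sub>R v) *\<^sub>R h x)"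
            by (subst (2) d, subst integral_distr) (auto simp: add.commute)
          show "integrable lborel (\<lambda>x. indicator Om (x - s *\<^sub>R v) *\<^sub>R h x)"
            by (subst d, subst integrable_distr_eq) (use ints[of s] in \<open>auto simp: add.commute\<close>)
        qed
        \<comment> \<open>\<open>?d\<close> vanishes unless exactly one of \<open>x\<close> and
          \<open>x - s *\<^sub>R v\<close> lies in \<open>Om\<close>, so it lives in the tube of
          width \<open>s\<close>; the factor \<open>s\<close> of the tube bound cancels against the
          quotient.\<close>
        let ?d = "\<lambda>x. indicator Om (x - s *\<^sub>R v) *\<^sub>R h x - indicator Om x *\<^sub>R h x"
        have "(LINT x|lborel. q n x) = ((LINT x|lborel. indicator Om x *\<^sub>R h (x + s *\<^sub>R v)) - (LINT x|lborel. indicator Om x *\<^sub>R h x)) /\<^sub>R s"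
        proof -
          have "q n = (\<lambda>x. (indicator Om x *\<^sub>R h (x + s *\<^sub>R v) - indicator Om x *\<^sub>R h x) /\<^sub>R s)"
            unfolding q_def s_def by (auto simp: scaleR_diff_right mult.commute)
          then show ?thesis using ints[of s] ints[of 0] by simp
        qed
        also have "\<dots> = (LINT x|lborel. ?d x) /\<^sub>R s"
          unfolding tr using ints' ints[of 0] by simp
        finally have q: "cmod (LINT x|lborel. q n x) = cmod (LINT x|lborel. ?d x) / s"
          using s by (simp add: divide_inverse)
        have "ennreal (cmod (LINT x|lborel. ?d x)) \<le> (\<integral>\<^sup>+x. ennreal (cmod (?d x)) \<partial>lborel)"
          using ints' ints[of 0] by (intro integral_norm_bound_ennreal) auto
        also have "\<dots> \<le> (\<integral>\<^sup>+x. ennreal (cmod (h x)) * indicator {x. infdist x ?K \<le> s} x \<partial>lborel)"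
        proof (rule nn_integral_mono)
          fix x
          show "ennreal (cmod (?d x)) \<le> ennreal (cmod (h x)) * indicator {x. infdist x ?K \<le> s} x"
            using infdist_frontier_le_of_crossing[of x Om "s *\<^sub>R v"] v s
            by (auto simp: indicator_def)
        qed
        also have "\<dots> \<le> ennreal (C * s) * ennreal I" by (rule t0(2)[OF s])
        also have "\<dots> = ennreal (C * s * I)" using C s I0 by (simp add: ennreal_mult)
        finally have "cmod (LINT x|lborel. ?d x) \<le> C * s * I"
          using C s I0 by (simp add: ennreal_le_iff)
        then show ?case unfolding q using s by (simp add: field_simps)
      qed
      then show ?thesis unfolding I_def[symmetric]
        using tendsto_norm[OF lim] by (intro tendsto_upperbound) auto
    qed
    have "cmod (LINT x|lborel. indicator Om x *\<^sub>R partial_deriv i h x) \<le> C * (LINT y|?M. cmod (h y))"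
    proof (rule field_le_epsilon)
      fix e :: real assume e: "e > 0"
      define m where "m = C * measure ?M ?K + 1"
      have m: "m > 0" "C * measure ?M ?K \<le> m" using C by (auto simp: m_def intro: add_nonneg_pos)
      have "C * (e / m * measure ?M ?K) = (C * measure ?M ?K) * (e / m)" by simp
      also have "\<dots> \<le> m * (e / m)" using m e by (intro mult_right_mono) auto
      finally have "C * (e / m * measure ?M ?K) \<le> e" using m by simp
      then show "cmod (LINT x|lborel. indicator Om x *\<^sub>R partial_deriv i h x) \<le> C * (LINT y|?M. cmod (h y)) + e"
        using le[of "e / m"] e m by (simp add: distrib_left)
    qed
    then show "cmod (LINT x|lebesgue_on Om. partial_deriv i h x) \<le> C * (LINT y|?M. cmod (h y))"
      by (simp add: integral_lebesgue_on_eq_lborel pm)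
  qed
qed


section \<open>Weak gradients\<close>

lemma borel_set_integrals_zero_imp_AE_zero:
  fixes h :: "'a::euclidean_space \<Rightarrow> real"
  assumes h: "integrable lebesgue h" and z: "\<And>A. A \<in> sets borel \<Longrightarrow> (LINT x|lebesgue. indicator A x *\<^sub>R h x) = 0"
  shows "AE x in lebesgue. h x = 0"
proof -
  obtain h' where h': "h' \<in> borel_measurable lborel" and eq: "AE x in lborel. h x = h' x"
    using completion_ex_borel_measurable_real[of h lborel] h by auto
  have eq': "AE x in lebesgue. h x = h' x" using eq by (rule AE_completion)
  have h'm [measurable]: "h' \<in> borel_measurable borel" using h' by simp
  have h'i: "integrable lebesgue h'"
    by (rule integrable_cong_AE_imp[OF h measurable_completion[OF h'] eq'])
  have m: "(\<lambda>x. indicator A x *\<^sub>R h' x) \<in> borel_measurable lebesgue" if "A \<in> sets borel" for A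
    using that by (intro measurable_completion) simp
  have z': "(LINT x|lebesgue. indicator A x *\<^sub>R h' x) = 0" if A: "A \<in> sets borel" for A
  proof -
    have "(LINT x|lebesgue. indicator A x *\<^sub>R h' x) = (LINT x|lebesgue. indicator A x *\<^sub>R h x)"
    proof (rule integral_cong_AE[OF m[OF A]])
      show "(\<lambda>x. indicator A x *\<^sub>R h x) \<in> borel_measurable lebesgue"
        using A by (intro borel_measurable_integrable integrable_mult_indicator[OF _ h]) simp
      show "AE x in lebesgue. indicator A x *\<^sub>R h' x = indicator A x *\<^sub>R h x"
        using eq' by eventually_elim simp
    qed
    then show ?thesis using z[OF A] by simp
  qed
  have "AE x in lebesgue. s * h' x \<le> 0" if s: "s = 1 \<or> s = -1" for s :: real
  proof -
    let ?A = "{x. s * h' x > 0}"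
    have A: "?A \<in> sets borel" by measurable
    let ?g = "\<lambda>x. s * (indicator ?A x *\<^sub>R h' x)"
    have "integrable lebesgue (\<lambda>x. indicator ?A x *\<^sub>R h' x)"
      using A h'i by (intro integrable_mult_indicator) auto
    then have i: "integrable lebesgue ?g" by simp
    have "integral\<^sup>L lebesgue ?g = 0" using z'[OF A] by simp
    moreover have "AE x in lebesgue. 0 \<le> ?g x" by (auto simp: indicator_def)
    ultimately have "AE x in lebesgue. ?g x = 0" using integral_nonneg_eq_0_iff_AE[OF i] by blast
    then show ?thesis by eventually_elim (auto simp: indicator_def split: if_splits)
  qed
  from this[of 1] this[of "-1"]
  have "AE x in lebesgue. 1 * h' x \<le> 0" "AE x in lebesgue. - 1 * h' x \<le> 0" by simp_all
  with eq' show ?thesis by eventually_elim simp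
qed

lemma box_integrals_zero_imp_AE_zero:
  fixes f :: "plane \<Rightarrow> real"
  assumes op: "open Om" and f: "integrable (lebesgue_on Om) f"
    and z: "\<And>a b. cbox a b \<subseteq> Om \<Longrightarrow> (LINT x|lebesgue_on Om. indicator (box a b) x *\<^sub>R f x) = 0"
  shows "AE x in lebesgue_on Om. f x = 0"
proof -
  have Om: "Om \<inter> space lebesgue \<in> sets lebesgue" using op by simp
  have fi: "integrable lebesgue (\<lambda>x. indicator Om x *\<^sub>R f x)"
    using f by (rule iffD1[OF integrable_restrict_space[OF Om]])
  have local: "AE x in lebesgue. x \<in> box a b \<longrightarrow> f x = 0" if ab: "cbox a b \<subseteq> Om" for a b
  proof -
    define h where "h x = indicator (box a b) x *\<^sub>R f x" for x
    have hO: "h x = indicator (box a b) x *\<^sub>R (indicator Om x *\<^sub>R f x)" for x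
      using ab box_subset_cbox[of a b] by (auto simp: h_def indicator_def fun_eq_iff)
    have hi: "integrable lebesgue h"
      unfolding hO by (rule integrable_mult_indicator[OF _ fi]) simp
    have boxes: "(LINT x|lebesgue. indicator (box c d) x *\<^sub>R h x) = 0" for c d
    \<comment> \<open>An empty open box may have a nonempty \<open>cbox\<close>, so
      \<open>closure_box\<close> is used only when the intersection is nonempty.\<close>
    proof (cases "box c d \<inter> box a b = {}")
      case True
      then have "(\<lambda>x. indicator (box c d) x *\<^sub>R h x) = (\<lambda>x. 0)" by (auto simp: h_def indicator_def fun_eq_iff)
      then show ?thesis by (simp only: Bochner_Integration.integral_zero)
    next
      case False
      define p :: plane where "p = (\<Sum>i\<in>Basis. max (c \<bullet> i) (a \<bullet> i) *\<^sub>R i)"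
      define q :: plane where "q = (\<Sum>i\<in>Basis. min (d \<bullet> i) (b \<bullet> i) *\<^sub>R i)"
      have pq: "box p q = box c d \<inter> box a b" unfolding p_def q_def box_Int_box ..
      then have "cbox p q = closure (box c d \<inter> box a b)" using False closure_box[of p q] by simp
      also have "\<dots> \<subseteq> cbox a b" by (rule closure_minimal) (auto intro: box_subset_cbox[THEN subsetD])
      finally have "cbox p q \<subseteq> Om" using ab by blast
      from z[OF this] have "(LINT x|lebesgue. indicator Om x *\<^sub>R (indicator (box p q) x *\<^sub>R f x)) = 0"
        by (simp only: integral_restrict_space[OF Om])
      moreover have "(\<lambda>x. indicator Om x *\<^sub>R (indicator (box p q) x *\<^sub>R f x)) = (\<lambda>x. indicator (box c d) x *\<^sub>R h x)"
        unfolding pq using ab box_subset_cbox[of a b] by (auto simp: h_def indicator_def fun_eq_iff)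
      ultimately show ?thesis by (simp only:)
    qed
    \<comment> \<open>The complement step of the induction needs the integral over the whole plane,
      which is the one over the box itself.\<close>
    have total: "(LINT x|lebesgue. h x) = 0"
    proof -
      have "(\<lambda>x. indicator (box a b) x *\<^sub>R h x) = h" by (auto simp: h_def indicator_def fun_eq_iff)
      then show ?thesis using boxes[of a b] by (simp only:)
    qed
    have "(LINT x|lebesgue. indicator A x *\<^sub>R h x) = 0" if A: "A \<in> sets borel" for A
    proof -
      have A': "A \<in> sigma_sets UNIV (range (\<lambda>(a, b). box a b :: plane set))"
        using A by (simp add: borel_eq_box)
      show ?thesis
      proof (rule sigma_sets_induct_disjoint[OF _ _ A'])
        show "Int_stable (range (\<lambda>(a, b). box a b :: plane set))"
          by (auto simp: Int_stable_def box_Int_box)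
        show "range (\<lambda>(a, b). box a b :: plane set) \<subseteq> Pow UNIV" by simp
      next
        fix B assume "B \<in> range (\<lambda>(a, b). box a b :: plane set)"
        then show "(LINT x|lebesgue. indicator B x *\<^sub>R h x) = 0" using boxes by auto
      next
        fix B assume B: "B \<in> sigma_sets UNIV (range (\<lambda>(a, b). box a b :: plane set))"
          and 0: "(LINT x|lebesgue. indicator B x *\<^sub>R h x) = 0"
        have "B \<in> sets lebesgue" using B by (intro sets_completionI_sets) (simp add: borel_eq_box)
        then have "integrable lebesgue (\<lambda>x. indicator B x *\<^sub>R h x)" using hi by (intro integrable_mult_indicator)
        then have "(LINT x|lebesgue. h x - indicator B x *\<^sub>R h x) = 0"
          using 0 total hi by (simp only: Bochner_Integration.integral_diff)
        moreover have "(\<lambda>x. indicator (UNIV - B) x *\<^sub>R h x) = (\<lambda>x. h x - indicator B x *\<^sub>R h x)" by (auto simp: indicator_def fun_eq_iff)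
        ultimately show "(LINT x|lebesgue. indicator (UNIV - B) x *\<^sub>R h x) = 0" by (simp only:)
      next
        fix S :: "nat \<Rightarrow> plane set" assume S: "disjoint_family S" "range S \<subseteq> sigma_sets UNIV (range (\<lambda>(a, b). box a b :: plane set))"
          and 0: "\<And>i. (LINT x|lebesgue. indicator (S i) x *\<^sub>R h x) = 0"
        have SB: "S i \<in> sets borel" for i
          using S(2) by (auto simp: borel_eq_box)
        have "(LINT x:(\<Union>i. S i)|lebesgue. h x) = (\<Sum>i. (LINT x:S i|lebesgue. h x))"
        proof (rule lebesgue_integral_countable_add)
          show "set_integrable lebesgue (\<Union>i. S i) h"
            unfolding set_integrable_def using hi SB by (intro integrable_mult_indicator) auto
        qed (use SB S(1) in \<open>auto simp: disjoint_family_on_def\<close>)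
        then show "(LINT x|lebesgue. indicator (\<Union>i. S i) x *\<^sub>R h x) = 0"
          using 0 by (simp add: set_lebesgue_integral_def)
      qed simp
    qed
    then have "AE x in lebesgue. h x = 0" by (rule borel_set_integrals_zero_imp_AE_zero[OF hi])
    then show ?thesis by eventually_elim (auto simp: h_def)
  qed
  define F where "F = {box a b | a b. cbox a b \<subseteq> Om}"
  obtain F' where F': "F' \<subseteq> F" "countable F'" "\<Union>F' = \<Union>F"
    by (rule Lindelof[of F]) (auto simp: F_def)
  have cover: "Om \<subseteq> \<Union>F"
  proof
    fix x assume x: "x \<in> Om"
    obtain a b where "cbox a b \<subseteq> Om" "x \<in> box a b"
      by (rule open_contains_cbox[OF op x]) auto
    then show "x \<in> \<Union>F" by (auto simp: F_def)
  qed
  have "AE x in lebesgue. \<forall>X\<in>F'. x \<in> X \<longrightarrow> f x = 0"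
    unfolding AE_ball_countable[OF F'(2)] using F'(1) local by (auto simp: F_def)
  then have "AE x in lebesgue. x \<in> Om \<longrightarrow> f x = 0"
    by eventually_elim (use cover F'(3) in blast)
  then show ?thesis by (simp add: AE_restrict_space_iff[OF Om])
qed

section \<open>Square integrable functions on finite measure spaces\<close>

lemma norm_le_one_plus_square: "norm (z::'b::real_normed_vector) \<le> 1 + (norm z)\<^sup>2"
proof -
  have "0 \<le> (norm z - 1)\<^sup>2" by simp
  then have "2 * norm z \<le> 1 + (norm z)\<^sup>2" by (simp add: power2_diff)
  then show ?thesis using norm_ge_zero[of z] by linarith
qed

lemma L2_integrable:
  assumes "finite_measure M" "f \<in> L2 M"
  shows "integrable M f"
proof -
  interpret finite_measure M by fact
  have "integrable M (\<lambda>x. 1 + (cmod (f x))\<^sup>2)" using assms(2) by (simp add: L2_def)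
  then show ?thesis
    by (rule Bochner_Integration.integrable_bound)
       (use assms(2) norm_le_one_plus_square in \<open>auto simp: L2_def intro!: AE_I2\<close>)
qed

lemma integrable_mult_bounded:
  fixes f :: "'a \<Rightarrow> complex"
  assumes "integrable M f" "b \<in> borel_measurable M" "\<And>x. x \<in> space M \<Longrightarrow> cmod (b x) \<le> B"
  shows "integrable M (\<lambda>x. f x * b x)"
proof (rule Bochner_Integration.integrable_bound[of M "\<lambda>x. B * cmod (f x)"])
  show "integrable M (\<lambda>x. B * cmod (f x))" using assms(1) by simp
  show "AE x in M. cmod (f x * b x) \<le> norm (B * cmod (f x))"
  proof (rule AE_I2)
    fix x assume x: "x \<in> space M"
    have "cmod (f x * b x) \<le> cmod (f x) * B" using assms(3)[OF x] by (simp add: norm_mult mult_left_mono)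
    then show "cmod (f x * b x) \<le> norm (B * cmod (f x))" by (simp add: mult.commute)
  qed
qed (use assms in simp)

lemma L2_add:
  assumes "f \<in> L2 M" "g \<in> L2 M"
  shows "(\<lambda>x. f x + g x) \<in> L2 M"
proof -
  have "integrable M (\<lambda>x. 2 * (cmod (f x))\<^sup>2 + 2 * (cmod (g x))\<^sup>2)" using assms by (simp add: L2_def)
  then have "integrable M (\<lambda>x. (cmod (f x + g x))\<^sup>2)"
  proof (rule Bochner_Integration.integrable_bound)
    show "AE x in M. norm ((cmod (f x + g x))\<^sup>2) \<le> norm (2 * (cmod (f x))\<^sup>2 + 2 * (cmod (g x))\<^sup>2)"
    proof (rule AE_I2)
      fix x
      have "(cmod (f x + g x))\<^sup>2 \<le> (cmod (f x) + cmod (g x))\<^sup>2"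
        by (intro power_mono norm_triangle_ineq norm_ge_zero)
      also have "\<dots> \<le> 2 * (cmod (f x))\<^sup>2 + 2 * (cmod (g x))\<^sup>2"
        using sum_squares_bound[of "cmod (f x)" "cmod (g x)"] by (simp add: power2_sum)
      finally show "norm ((cmod (f x + g x))\<^sup>2) \<le> norm (2 * (cmod (f x))\<^sup>2 + 2 * (cmod (g x))\<^sup>2)" by simp
    qed
  qed (use assms in \<open>auto simp: L2_def\<close>)
  then show ?thesis using assms by (auto simp: L2_def)
qed

lemma L2_diff: "f \<in> L2 M \<Longrightarrow> g \<in> L2 M \<Longrightarrow> (\<lambda>x. f x - g x) \<in> L2 M"
  using L2_add[of f M "\<lambda>x. - g x"] by (simp add: L2_def)

text \<open>The elementary bound \<open>cmod z \<le> e + (cmod z)^2 / e\<close> serves in place of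
  the Cauchy-Schwarz inequality: \<open>e\<close> is chosen so that the constant contributes less
  than \<open>r / 2\<close>, and the quadratic part eventually does the same.\<close>

lemma L2_tendsto_imp_L1_tendsto:
  assumes M: "finite_measure M" and f: "\<And>n. f n \<in> L2 M"
    and lim: "(\<lambda>n. LINT x|M. (cmod (f n x))\<^sup>2) \<longlonglongrightarrow> 0"
  shows "(\<lambda>n::nat. LINT x|M. cmod (f n x)) \<longlonglongrightarrow> 0"
proof (rule tendstoI)
  interpret finite_measure M by fact
  fix r :: real assume r: "r > 0"
  define m where "m = measure M (space M)"
  define e where "e = r / (2 * (m + 1))"
  have m: "m \<ge> 0" by (simp add: m_def)
  have e: "e > 0" "e * m < r / 2" using r m by (auto simp: e_def field_simps)
  have bound: "(LINT x|M. cmod (f n x)) \<le> e * m + (LINT x|M. (cmod (f n x))\<^sup>2) / e" for n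
  proof -
    have "(LINT x|M. cmod (f n x)) \<le> (LINT x|M. e + (cmod (f n x))\<^sup>2 / e)"
    proof (rule integral_mono)
      show "integrable M (\<lambda>x. cmod (f n x))" using L2_integrable[OF M f] by simp
      show "integrable M (\<lambda>x. e + (cmod (f n x))\<^sup>2 / e)" using f[of n] by (simp add: L2_def)
      fix x
      have "0 \<le> (cmod (f n x) - e)\<^sup>2" by simp
      then have "2 * (e * cmod (f n x)) \<le> e * e + (cmod (f n x))\<^sup>2"
        by (simp add: power2_eq_square algebra_simps)
      moreover have "0 \<le> e * cmod (f n x)" using e by simp
      ultimately have "cmod (f n x) * e \<le> e * e + (cmod (f n x))\<^sup>2" by (simp add: mult.commute)
      then show "cmod (f n x) \<le> e + (cmod (f n x))\<^sup>2 / e" using e by (simp add: field_simps)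
    qed
    also have "\<dots> = e * m + (LINT x|M. (cmod (f n x))\<^sup>2) / e"
      using f[of n] by (simp add: L2_def m_def mult.commute)
    finally show ?thesis .
  qed
  have "e * (r / 2) > 0" using e r by simp
  from order_tendstoD(2)[OF lim this]
  show "\<forall>\<^sub>F n in sequentially. dist (LINT x|M. cmod (f n x)) 0 < r"
  proof eventually_elim
    case (elim n)
    then have "(LINT x|M. (cmod (f n x))\<^sup>2) / e < r / 2" using e by (simp add: field_simps)
    then have "(LINT x|M. cmod (f n x)) < r" using bound[of n] e by linarith
    moreover have "0 \<le> (LINT x|M. cmod (f n x))" by (rule integral_nonneg_AE) simp
    ultimately show ?case by simp
  qed
qed

lemma L2_tendsto_imp_integral_tendsto:
  assumes M: "finite_measure M" and f: "\<And>n. f n \<in> L2 M" and g: "g \<in> L2 M"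
    and b: "b \<in> borel_measurable M" "\<And>x. x \<in> space M \<Longrightarrow> cmod (b x) \<le> B"
    and lim: "(\<lambda>n. LINT x|M. (cmod (f n x - g x))\<^sup>2) \<longlonglongrightarrow> 0"
  shows "(\<lambda>n::nat. LINT x|M. f n x * b x) \<longlonglongrightarrow> (LINT x|M. g x * b x)"
proof (rule LIM_zero_cancel, rule Lim_null_comparison)
  have d: "(\<lambda>x. f n x - g x) \<in> L2 M" for n by (rule L2_diff[OF f g])
  have "(\<lambda>n. B * (LINT x|M. cmod (f n x - g x))) \<longlonglongrightarrow> B * 0"
    by (intro tendsto_intros L2_tendsto_imp_L1_tendsto[OF M d lim])
  then show "(\<lambda>n. B * (LINT x|M. cmod (f n x - g x))) \<longlonglongrightarrow> 0" by simp
  have i: "integrable M (\<lambda>x. h x * b x)" if "h \<in> L2 M" for h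
    by (rule integrable_mult_bounded[OF L2_integrable[OF M that] b])
  have "norm ((LINT x|M. f n x * b x) - (LINT x|M. g x * b x)) \<le> B * (LINT x|M. cmod (f n x - g x))" for n
  proof -
    have "(LINT x|M. f n x * b x) - (LINT x|M. g x * b x) = (LINT x|M. (f n x - g x) * b x)"
      using i[OF f] i[OF g] by (simp add: left_diff_distrib)
    also have "norm \<dots> \<le> (LINT x|M. norm ((f n x - g x) * b x))" by (rule integral_norm_bound)
    also have "\<dots> \<le> (LINT x|M. B * cmod (f n x - g x))"
    proof (rule integral_mono)
      show "integrable M (\<lambda>x. norm ((f n x - g x) * b x))" by (rule integrable_norm[OF i[OF d]])
      show "integrable M (\<lambda>x. B * cmod (f n x - g x))" using L2_integrable[OF M d] by simp
      show "norm ((f n x - g x) * b x) \<le> B * cmod (f n x - g x)" if "x \<in> space M" for x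
        using mult_left_mono[OF b(2)[OF that], of "cmod (f n x - g x)"] by (simp add: norm_mult mult.commute)
    qed
    finally show ?thesis by simp
  qed
  then show "\<forall>\<^sub>F n in sequentially. norm ((LINT x|M. f n x * b x) - (LINT x|M. g x * b x)) \<le> B * (LINT x|M. cmod (f n x - g x))"
    by simp
qed

lemma finite_measure_lebesgue_on:
  "open Om \<Longrightarrow> bounded Om \<Longrightarrow> finite_measure (lebesgue_on (Om :: 'a::euclidean_space set))"
  using emeasure_bounded_finite[of Om]
  by (intro finite_measureI) (simp add: emeasure_restrict_space)

lemma borel_measurable_lebesgue_on:
  "f \<in> borel_measurable borel \<Longrightarrow> f \<in> borel_measurable (lebesgue_on S)"
  by (intro measurable_restrict_space1 measurable_completion) simp

lemma bounded_on_bounded: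
  fixes f :: cfun
  assumes "bounded Om" "continuous_on UNIV f"
  obtains B where "\<And>x. x \<in> Om \<Longrightarrow> cmod (f x) \<le> B"
proof -
  have "bounded (f ` closure Om)"
    using assms continuous_on_subset by (intro compact_imp_bounded compact_continuous_image) (auto simp: compact_closure)
  then obtain B where B: "\<forall>x\<in>closure Om. cmod (f x) \<le> B" by (auto simp: bounded_iff)
  show thesis by (rule that[of B]) (use B closure_subset[of Om] in auto)
qed

lemma L2_smooth_integrable:
  assumes "open Om" "bounded Om" "g \<in> L2 (lebesgue_on Om)" "smooth h"
  shows "integrable (lebesgue_on Om) (\<lambda>x. g x * h x)"
proof -
  obtain B where "\<And>x. x \<in> Om \<Longrightarrow> cmod (h x) \<le> B"
    using bounded_on_bounded[OF assms(2) smooth_continuous[OF assms(4)]] by blast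
  then show ?thesis
    by (intro integrable_mult_bounded[of _ _ _ B] L2_integrable[OF finite_measure_lebesgue_on] assms
        borel_measurable_lebesgue_on borel_measurable_continuous_onI smooth_continuous) simp
qed

lemma continuous_L2:
  assumes "open Om" "bounded Om" "continuous_on UNIV f"
  shows "f \<in> L2 (lebesgue_on Om)"
proof -
  interpret finite_measure "lebesgue_on Om" by (rule finite_measure_lebesgue_on[OF assms(1,2)])
  obtain B where B: "\<And>x. x \<in> Om \<Longrightarrow> cmod (f x) \<le> B" using bounded_on_bounded[OF assms(2,3)] by blast
  have m: "f \<in> borel_measurable (lebesgue_on Om)"
    by (intro borel_measurable_lebesgue_on borel_measurable_continuous_onI assms)
  have "integrable (lebesgue_on Om) (\<lambda>x. (cmod (f x))\<^sup>2)"
    by (rule integrable_const_bound[of _ "B\<^sup>2"]) (use m B in \<open>auto intro!: AE_I2 power_mono\<close>)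
  with m show ?thesis by (simp add: L2_def)
qed

text \<open>Steep box cutoffs are test functions bounded by 1 that converge to the indicator of an
  open box, so dominated convergence reduces the claim to boxes, for real and imaginary parts
  separately.\<close>

lemma fundamental_lemma:
  assumes op: "open Om" and bd: "bounded Om" and g: "g \<in> L2 (lebesgue_on Om)"
    and z: "\<And>\<phi>. \<phi> \<in> test_functions Om \<Longrightarrow> (LINT x|lebesgue_on Om. g x * \<phi> x) = 0"
  shows "AE x in lebesgue_on Om. g x = 0"
proof -
  have fm: "finite_measure (lebesgue_on Om)" by (rule finite_measure_lebesgue_on[OF op bd])
  have gi: "integrable (lebesgue_on Om) g" by (rule L2_integrable[OF fm g])
  have gm: "g \<in> borel_measurable (lebesgue_on Om)" using gi by simp
  have bx: "(LINT x|lebesgue_on Om. g x * of_real (indicator (box a b) x)) = 0" if ab: "cbox a b \<subseteq> Om" for a b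
  proof -
    have "(\<lambda>n. LINT x|lebesgue_on Om. g x * of_real (box_cut (real (Suc n)) a b x))
        \<longlonglongrightarrow> (LINT x|lebesgue_on Om. g x * of_real (indicator (box a b) x))"
    proof (rule integral_dominated_convergence[where w = "\<lambda>x. cmod (g x)"])
      show "(\<lambda>x. g x * of_real (box_cut (real (Suc n)) a b x)) \<in> borel_measurable (lebesgue_on Om)" for n
        by (intro borel_measurable_times[OF gm] borel_measurable_lebesgue_on
            borel_measurable_continuous_onI smooth_continuous smooth_box_cut)
      show "(\<lambda>x. g x * of_real (indicator (box a b) x)) \<in> borel_measurable (lebesgue_on Om)"
        by (intro borel_measurable_times[OF gm] borel_measurable_lebesgue_on borel_measurable_of_real) simp
      show "integrable (lebesgue_on Om) (\<lambda>x. cmod (g x))" using gi by simp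
      show "AE x in lebesgue_on Om. (\<lambda>n. g x * of_real (box_cut (real (Suc n)) a b x)) \<longlonglongrightarrow> g x * of_real (indicator (box a b) x)"
        by (intro AE_I2 tendsto_intros box_cut_tendsto)
      show "AE x in lebesgue_on Om. norm (g x * of_real (box_cut (real (Suc n)) a b x)) \<le> cmod (g x)" for n
        using box_cut_bounds by (intro AE_I2) (simp add: norm_mult mult_left_le)
    qed
    moreover have "(LINT x|lebesgue_on Om. g x * of_real (box_cut (real (Suc n)) a b x)) = 0" for n
      by (intro z test_function_box_cut ab) simp
    ultimately show ?thesis by (simp add: LIMSEQ_const_iff)
  qed
  have bi: "integrable (lebesgue_on Om) (\<lambda>x. g x * of_real (indicator (box a b) x))" for a b
    by (rule integrable_mult_bounded[OF gi, of _ 1]) (auto intro!: borel_measurable_of_real borel_measurable_lebesgue_on simp: indicator_def)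
  have "AE x in lebesgue_on Om. Re (g x) = 0"
  proof (rule box_integrals_zero_imp_AE_zero[OF op])
    fix a b :: plane assume ab: "cbox a b \<subseteq> Om"
    have "(LINT x|lebesgue_on Om. indicator (box a b) x *\<^sub>R Re (g x)) = (LINT x|lebesgue_on Om. Re (g x * of_real (indicator (box a b) x)))"
      by (simp add: mult.commute)
    also have "\<dots> = Re (LINT x|lebesgue_on Om. g x * of_real (indicator (box a b) x))" by (rule integral_Re[OF bi])
    finally show "(LINT x|lebesgue_on Om. indicator (box a b) x *\<^sub>R Re (g x)) = 0" using bx[OF ab] by simp
  qed (use gi in simp)
  moreover have "AE x in lebesgue_on Om. Im (g x) = 0"
  proof (rule box_integrals_zero_imp_AE_zero[OF op])
    fix a b :: plane assume ab: "cbox a b \<subseteq> Om"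
    have "(LINT x|lebesgue_on Om. indicator (box a b) x *\<^sub>R Im (g x)) = (LINT x|lebesgue_on Om. Im (g x * of_real (indicator (box a b) x)))"
      by (simp add: mult.commute)
    also have "\<dots> = Im (LINT x|lebesgue_on Om. g x * of_real (indicator (box a b) x))" by (rule integral_Im[OF bi])
    finally show "(LINT x|lebesgue_on Om. indicator (box a b) x *\<^sub>R Im (g x)) = 0" using bx[OF ab] by simp
  qed (use gi in simp)
  ultimately show ?thesis by eventually_elim (simp add: complex_eq_iff)
qed

text \<open>\<open>weak_gradient\<close> is a choice, known only through its defining property;
  uniqueness identifies it with any gradient found explicitly.\<close>

lemma weak_gradient_unique:
  assumes op: "open Om" and bd: "bounded Om"
    and G: "has_weak_gradient Om u G" "has_weak_gradient Om u G'"
  shows "AE x in lebesgue_on Om. G x = G' x"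
proof -
  have "AE x in lebesgue_on Om. G x $ i - G' x $ i = 0" for i
  proof (rule fundamental_lemma[OF op bd])
    have L: "(\<lambda>x. G x $ i) \<in> L2 (lebesgue_on Om)" "(\<lambda>x. G' x $ i) \<in> L2 (lebesgue_on Om)"
      using G by (auto simp: has_weak_gradient_def)
    then show "(\<lambda>x. G x $ i - G' x $ i) \<in> L2 (lebesgue_on Om)" by (rule L2_diff)
    fix \<phi> assume \<phi>: "\<phi> \<in> test_functions Om"
    then have "smooth \<phi>" by (simp add: test_functions_def)
    note int = L2_smooth_integrable[OF op bd L(1) this] L2_smooth_integrable[OF op bd L(2) this]
    have "(LINT x|lebesgue_on Om. u x * partial_deriv i \<phi> x) = - (LINT x|lebesgue_on Om. G x $ i * \<phi> x)"
      using G(1) \<phi> unfolding has_weak_gradient_def by blast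
    moreover have "(LINT x|lebesgue_on Om. u x * partial_deriv i \<phi> x) = - (LINT x|lebesgue_on Om. G' x $ i * \<phi> x)"
      using G(2) \<phi> unfolding has_weak_gradient_def by blast
    ultimately have "(LINT x|lebesgue_on Om. G x $ i * \<phi> x) = (LINT x|lebesgue_on Om. G' x $ i * \<phi> x)"
      by simp
    with int show "(LINT x|lebesgue_on Om. (G x $ i - G' x $ i) * \<phi> x) = 0"
      by (simp add: left_diff_distrib)
  qed
  then have "AE x in lebesgue_on Om. \<forall>i. G x $ i - G' x $ i = 0" by (simp add: AE_all_countable)
  then show ?thesis by eventually_elim (simp add: vec_eq_iff)
qed


section \<open>Cauchy data and the reciprocity identity\<close>

lemma weak_gradient_has_weak_gradient:
  assumes "u \<in> H1 Om"
  shows "has_weak_gradient Om u (weak_gradient Om u)"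
proof -
  obtain G where "has_weak_gradient Om u G" using assms by (auto simp: H1_def)
  then show ?thesis unfolding weak_gradient_def by (rule someI[of "has_weak_gradient Om u"])
qed

definition grad :: "cfun \<Rightarrow> plane \<Rightarrow> complex^2" where
  "grad f x = (\<chi> i. partial_deriv i f x)"

text \<open>The product of \<open>f\<close> and a test function vanishes on the boundary, so
  \<open>boundary_estimate\<close> bounds the integral of its partial derivative by 0; the product
  rule turns this into integration by parts.\<close>

lemma has_weak_gradient_smooth:
  assumes Om: "lipschitz_domain Om" and f: "smooth f"
  shows "has_weak_gradient Om f (grad f)"
  unfolding has_weak_gradient_def
proof (intro conjI allI ballI)
  note op = lipschitz_domainD(1)[OF Om] and bd = lipschitz_domainD(2)[OF Om]
  fix i
  have pL2: "(\<lambda>x. partial_deriv i f x) \<in> L2 (lebesgue_on Om)"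
    by (intro continuous_L2 op bd smooth_continuous smooth_partial_deriv f)
  then show "(\<lambda>x. grad f x $ i) \<in> L2 (lebesgue_on Om)" by (simp add: grad_def)
  fix \<phi> assume \<phi>: "\<phi> \<in> test_functions Om"
  then have s\<phi>: "smooth \<phi>" by (simp add: test_functions_def)
  have int: "integrable (lebesgue_on Om) (\<lambda>x. g x * h x)" if "smooth g" "smooth h" for g h
    by (intro L2_smooth_integrable continuous_L2 op bd smooth_continuous that)
  obtain C where "C \<ge> 0" and C: "\<And>h i. smooth h \<Longrightarrow>
    cmod (LINT x|lebesgue_on Om. partial_deriv i h x) \<le> C * (LINT y|boundary_measure Om. cmod (h y))"
    using boundary_estimate[OF Om] by blast
  have "cmod (f y * \<phi> y) = 0" if "y \<in> frontier Om" for y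
  proof -
    have "y \<notin> Om" using that op by (simp add: frontier_def interior_open)
    then show ?thesis using \<phi> closure_subset[of "{x. \<phi> x \<noteq> 0}"] by (auto simp: test_functions_def)
  qed
  then have "(LINT y|boundary_measure Om. cmod (f y * \<phi> y)) = (LINT y|boundary_measure Om. 0)"
    by (intro Bochner_Integration.integral_cong refl) simp
  then have "(LINT x|lebesgue_on Om. partial_deriv i (\<lambda>x. f x * \<phi> x) x) = 0"
    using C[OF smooth_mult[OF f s\<phi>], of i] by simp
  moreover have "partial_deriv i (\<lambda>x. f x * \<phi> x) x = partial_deriv i f x * \<phi> x + f x * partial_deriv i \<phi> x" for x
    by (intro partial_deriv_mult smooth_differentiable f s\<phi>)
  ultimately have "(LINT x|lebesgue_on Om. partial_deriv i f x * \<phi> x) + (LINT x|lebesgue_on Om. f x * partial_deriv i \<phi> x) = 0"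
    using int[OF smooth_partial_deriv[OF f, of i] s\<phi>] int[OF f smooth_partial_deriv[OF s\<phi>, of i]] by simp
  then show "(LINT x|lebesgue_on Om. f x * partial_deriv i \<phi> x) = - (LINT x|lebesgue_on Om. grad f x $ i * \<phi> x)"
    by (simp add: grad_def eq_neg_iff_add_eq_0 add.commute)
qed

lemma smooth_H1:
  assumes "lipschitz_domain Om" "smooth f"
  shows "f \<in> H1 Om"
proof -
  have "f \<in> L2 (lebesgue_on Om)"
    by (rule continuous_L2[OF lipschitz_domainD(1,2)[OF assms(1)] smooth_continuous[OF assms(2)]])
  then show ?thesis using has_weak_gradient_smooth[OF assms] by (auto simp: H1_def)
qed

lemma weak_gradient_smooth:
  assumes "lipschitz_domain Om" "smooth f"
  shows "AE x in lebesgue_on Om. weak_gradient Om f x = grad f x"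
  by (rule weak_gradient_unique[OF lipschitz_domainD(1,2)[OF assms(1)]
        weak_gradient_has_weak_gradient[OF smooth_H1[OF assms]] has_weak_gradient_smooth[OF assms]])

text \<open>\<open>H1_norm\<close> of a difference contains a gradient chosen for the difference,
  unrelated by definition to those chosen for the two terms.\<close>

lemma has_weak_gradient_diff:
  assumes op: "open Om" and bd: "bounded Om" and u: "u \<in> L2 (lebesgue_on Om)" "v \<in> L2 (lebesgue_on Om)"
    and G: "has_weak_gradient Om u G" "has_weak_gradient Om v H"
  shows "has_weak_gradient Om (\<lambda>x. u x - v x) (\<lambda>x. G x - H x)"
  unfolding has_weak_gradient_def
proof (intro conjI allI ballI)
  fix i
  have L: "(\<lambda>x. G x $ i) \<in> L2 (lebesgue_on Om)" "(\<lambda>x. H x $ i) \<in> L2 (lebesgue_on Om)"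
    using G unfolding has_weak_gradient_def by blast+
  from L2_diff[OF this] show "(\<lambda>x. (G x - H x) $ i) \<in> L2 (lebesgue_on Om)" by simp
  fix \<phi> assume \<phi>: "\<phi> \<in> test_functions Om"
  then have s\<phi>: "smooth \<phi>" by (simp add: test_functions_def)
  have "(LINT x|lebesgue_on Om. u x * partial_deriv i \<phi> x) = - (LINT x|lebesgue_on Om. G x $ i * \<phi> x)"
     "(LINT x|lebesgue_on Om. v x * partial_deriv i \<phi> x) = - (LINT x|lebesgue_on Om. H x $ i * \<phi> x)"
    using G \<phi> unfolding has_weak_gradient_def by blast+
  then show "(LINT x|lebesgue_on Om. (u x - v x) * partial_deriv i \<phi> x) = - (LINT x|lebesgue_on Om. (G x - H x) $ i * \<phi> x)"
    using L2_smooth_integrable[OF op bd u(1) smooth_partial_deriv[OF s\<phi>, of i]]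
      L2_smooth_integrable[OF op bd u(2) smooth_partial_deriv[OF s\<phi>, of i]]
      L2_smooth_integrable[OF op bd L(1) s\<phi>] L2_smooth_integrable[OF op bd L(2) s\<phi>]
    by (simp add: left_diff_distrib)
qed

text \<open>By uniqueness the gradient chosen for \<open>f n x - u x\<close> is almost everywhere
  the classical gradient of \<open>f n\<close> minus the chosen one of \<open>u\<close>; each
  component is then controlled by the H^1 norm.\<close>

lemma H1_convergence:
  assumes Om: "lipschitz_domain Om" and u: "u \<in> H1 Om" and f: "\<And>n. smooth (f n)"
    and lim: "(\<lambda>n::nat. H1_norm Om (\<lambda>x. f n x - u x)) \<longlonglongrightarrow> 0"
  shows "(\<lambda>n. LINT x|lebesgue_on Om. (cmod (f n x - u x))\<^sup>2) \<longlonglongrightarrow> 0"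
    and "(\<lambda>n. LINT x|lebesgue_on Om. (cmod (partial_deriv i (f n) x - weak_gradient Om u x $ i))\<^sup>2) \<longlonglongrightarrow> 0"
proof -
  note op = lipschitz_domainD(1)[OF Om] and bd = lipschitz_domainD(2)[OF Om]
  define a where "a n = (LINT x|lebesgue_on Om. (cmod (f n x - u x))\<^sup>2)" for n
  define b where "b n = (LINT x|lebesgue_on Om. (norm (weak_gradient Om (\<lambda>x. f n x - u x) x))\<^sup>2)" for n
  have ab0: "a n \<ge> 0" "b n \<ge> 0" for n by (auto simp: a_def b_def)
  have "(\<lambda>n. (H1_norm Om (\<lambda>x. f n x - u x))\<^sup>2) \<longlonglongrightarrow> 0\<^sup>2" by (intro tendsto_intros lim)
  moreover have "(H1_norm Om (\<lambda>x. f n x - u x))\<^sup>2 = a n + b n" for n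
    using ab0[of n] by (simp add: H1_norm_def a_def b_def)
  ultimately have s: "(\<lambda>n. a n + b n) \<longlonglongrightarrow> 0" by simp
  have a: "a \<longlonglongrightarrow> 0" and b: "b \<longlonglongrightarrow> 0"
    by (rule tendsto_sandwich[OF _ _ tendsto_const s]; use ab0 in simp)+
  from a show "(\<lambda>n. LINT x|lebesgue_on Om. (cmod (f n x - u x))\<^sup>2) \<longlonglongrightarrow> 0" by (simp only: a_def[abs_def])
  have uL: "u \<in> L2 (lebesgue_on Om)" using u by (simp add: H1_def)
  let ?W = "weak_gradient Om u"
  have wu: "has_weak_gradient Om u ?W" by (rule weak_gradient_has_weak_gradient[OF u])
  have le: "(LINT x|lebesgue_on Om. (cmod (partial_deriv i (f n) x - ?W x $ i))\<^sup>2) \<le> b n" for n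
  proof -
    have fL: "f n \<in> L2 (lebesgue_on Om)" by (intro continuous_L2 op bd smooth_continuous f)
    have d: "has_weak_gradient Om (\<lambda>x. f n x - u x) (\<lambda>x. grad (f n) x - ?W x)"
      by (intro has_weak_gradient_diff op bd fL uL wu has_weak_gradient_smooth Om f)
    have "(\<lambda>x. f n x - u x) \<in> H1 Om" using L2_diff[OF fL uL] d by (auto simp: H1_def)
    then have d': "has_weak_gradient Om (\<lambda>x. f n x - u x) (weak_gradient Om (\<lambda>x. f n x - u x))"
      by (rule weak_gradient_has_weak_gradient)
    have ae: "AE x in lebesgue_on Om. weak_gradient Om (\<lambda>x. f n x - u x) x = grad (f n) x - ?W x"
      by (rule weak_gradient_unique[OF op bd d' d])
    have L: "(\<lambda>x. weak_gradient Om (\<lambda>x. f n x - u x) x $ j) \<in> L2 (lebesgue_on Om)" for j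
      using d' unfolding has_weak_gradient_def by blast
    have nrm: "(norm z)\<^sup>2 = (cmod (z $ 1))\<^sup>2 + (cmod (z $ 2))\<^sup>2" for z :: "complex^2"
      by (simp add: norm_vec_def L2_set_def sum_2)
    show ?thesis unfolding b_def
    proof (rule integral_mono_AE)
      have "(\<lambda>x. (grad (f n) x - ?W x) $ i) \<in> L2 (lebesgue_on Om)"
        using d unfolding has_weak_gradient_def by blast
      then show "integrable (lebesgue_on Om) (\<lambda>x. (cmod (partial_deriv i (f n) x - ?W x $ i))\<^sup>2)"
        by (simp add: L2_def grad_def)
      show "integrable (lebesgue_on Om) (\<lambda>x. (norm (weak_gradient Om (\<lambda>x. f n x - u x) x))\<^sup>2)"
        unfolding nrm using L by (simp add: L2_def)
      show "AE x in lebesgue_on Om. (cmod (partial_deriv i (f n) x - ?W x $ i))\<^sup>2 \<le> (norm (weak_gradient Om (\<lambda>x. f n x - u x) x))\<^sup>2"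
        using ae
      proof eventually_elim
        case (elim x)
        have "cmod ((grad (f n) x - ?W x) $ i) \<le> norm (grad (f n) x - ?W x)" by (rule Finite_Cartesian_Product.norm_nth_le)
        then show ?case unfolding elim by (intro power_mono) (auto simp: grad_def)
      qed
    qed
  qed
  show "(\<lambda>n. LINT x|lebesgue_on Om. (cmod (partial_deriv i (f n) x - ?W x $ i))\<^sup>2) \<longlonglongrightarrow> 0"
    by (rule tendsto_sandwich[OF _ _ tendsto_const b]) (use le in simp_all)
qed

definition helmholtz_solution :: "real \<Rightarrow> cfun \<Rightarrow> bool" where
  "helmholtz_solution k w \<longleftrightarrow> smooth w \<and> (\<forall>x. (\<Sum>i\<in>UNIV. partial_deriv i (partial_deriv i w) x) = - of_real (k\<^sup>2) * w x)"

text \<open>The form is written as a limit because \<open>u\<close> has only weak derivatives, while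
  \<open>boundary_estimate\<close> asks for smooth functions. What converges are integrals of
  partial derivatives, so only boundary values matter.\<close>

lemma helmholtz_form_limit:
  assumes Om: "lipschitz_domain Om" and u: "u \<in> H1 Om" and f: "\<And>n. smooth (f n)"
    and lim: "(\<lambda>n::nat. H1_norm Om (\<lambda>x. f n x - u x)) \<longlonglongrightarrow> 0" and w: "helmholtz_solution k w"
  shows "(\<lambda>n. \<Sum>i\<in>UNIV. LINT x|lebesgue_on Om. partial_deriv i (\<lambda>x. f n x * partial_deriv i w x) x)
    \<longlonglongrightarrow> helmholtz_form Om k u w"
proof -
  note op = lipschitz_domainD(1)[OF Om] and bd = lipschitz_domainD(2)[OF Om]
  have fm: "finite_measure (lebesgue_on Om)" by (rule finite_measure_lebesgue_on[OF op bd])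
  have sw: "smooth w" using w by (simp add: helmholtz_solution_def)
  let ?W = "weak_gradient Om u"
  have uL: "u \<in> L2 (lebesgue_on Om)" using u by (simp add: H1_def)
  have WL: "(\<lambda>x. ?W x $ i) \<in> L2 (lebesgue_on Om)" for i
    using weak_gradient_has_weak_gradient[OF u] unfolding has_weak_gradient_def by blast
  have conv: "(\<lambda>n. LINT x|lebesgue_on Om. F n x * b x) \<longlonglongrightarrow> (LINT x|lebesgue_on Om. F' x * b x)"
    if F: "\<And>n. smooth (F n)" "F' \<in> L2 (lebesgue_on Om)" and sb: "smooth b" and limF:
      "(\<lambda>n. LINT x|lebesgue_on Om. (cmod (F n x - F' x))\<^sup>2) \<longlonglongrightarrow> 0" for F :: "nat \<Rightarrow> cfun" and F' b
  proof -
    obtain B where B: "\<And>x. x \<in> Om \<Longrightarrow> cmod (b x) \<le> B"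
      using bounded_on_bounded[OF bd smooth_continuous[OF sb]] by blast
    show ?thesis
    proof (rule L2_tendsto_imp_integral_tendsto[OF fm _ F(2) _ _ limF, of b B])
      show "F n \<in> L2 (lebesgue_on Om)" for n by (intro continuous_L2 op bd smooth_continuous F)
      show "b \<in> borel_measurable (lebesgue_on Om)"
        by (intro borel_measurable_lebesgue_on borel_measurable_continuous_onI smooth_continuous sb)
    qed (use B in simp)
  qed
  note int = L2_smooth_integrable[OF op bd]
  have sL: "g \<in> L2 (lebesgue_on Om)" if "smooth g" for g
    by (intro continuous_L2 op bd smooth_continuous that)
  have form: "helmholtz_form Om k u w = (\<Sum>i\<in>UNIV. LINT x|lebesgue_on Om. ?W x $ i * partial_deriv i w x)
      - of_real (k\<^sup>2) * (LINT x|lebesgue_on Om. u x * w x)"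
  proof -
    have "(LINT x|lebesgue_on Om. (\<Sum>i\<in>UNIV. ?W x $ i * weak_gradient Om w x $ i))
        = (LINT x|lebesgue_on Om. (\<Sum>i\<in>UNIV. ?W x $ i * partial_deriv i w x))"
    proof (rule integral_cong_AE)
      have wL: "(\<lambda>x. weak_gradient Om w x $ i) \<in> L2 (lebesgue_on Om)" for i
        using weak_gradient_has_weak_gradient[OF smooth_H1[OF Om sw]] unfolding has_weak_gradient_def by blast
      show "(\<lambda>x. \<Sum>i\<in>UNIV. ?W x $ i * weak_gradient Om w x $ i) \<in> borel_measurable (lebesgue_on Om)"
        using WL wL by (intro borel_measurable_sum borel_measurable_times) (auto simp: L2_def)
      show "(\<lambda>x. \<Sum>i\<in>UNIV. ?W x $ i * partial_deriv i w x) \<in> borel_measurable (lebesgue_on Om)"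
        using WL sL[OF smooth_partial_deriv[OF sw]] by (intro borel_measurable_sum borel_measurable_times) (auto simp: L2_def)
      show "AE x in lebesgue_on Om. (\<Sum>i\<in>UNIV. ?W x $ i * weak_gradient Om w x $ i) = (\<Sum>i\<in>UNIV. ?W x $ i * partial_deriv i w x)"
        using weak_gradient_smooth[OF Om sw] by eventually_elim (simp add: grad_def)
    qed
    also have "\<dots> = (\<Sum>i\<in>UNIV. LINT x|lebesgue_on Om. ?W x $ i * partial_deriv i w x)"
      by (intro Bochner_Integration.integral_sum int WL smooth_partial_deriv sw)
    finally show ?thesis by (simp add: helmholtz_form_def)
  qed
  have "(\<lambda>n. (\<Sum>i\<in>UNIV. LINT x|lebesgue_on Om. partial_deriv i (f n) x * partial_deriv i w x)
      - of_real (k\<^sup>2) * (LINT x|lebesgue_on Om. f n x * w x)) \<longlonglongrightarrow> helmholtz_form Om k u w"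
    unfolding form
    by (intro tendsto_diff tendsto_sum tendsto_mult tendsto_const conv WL uL smooth_partial_deriv sw f
        H1_convergence[OF Om u f lim])
  moreover have "(\<Sum>i\<in>UNIV. LINT x|lebesgue_on Om. partial_deriv i (f n) x * partial_deriv i w x)
      - of_real (k\<^sup>2) * (LINT x|lebesgue_on Om. f n x * w x)
      = (\<Sum>i\<in>UNIV. LINT x|lebesgue_on Om. partial_deriv i (\<lambda>x. f n x * partial_deriv i w x) x)" for n
  proof -
    have 1: "partial_deriv i (\<lambda>x. f n x * partial_deriv i w x) x
        = partial_deriv i (f n) x * partial_deriv i w x + f n x * partial_deriv i (partial_deriv i w) x" for i x
      by (intro partial_deriv_mult smooth_differentiable smooth_partial_deriv f sw)
    have i1: "integrable (lebesgue_on Om) (\<lambda>x. partial_deriv i (f n) x * partial_deriv i w x)" for i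
      by (intro int sL smooth_partial_deriv f sw)
    have i2: "integrable (lebesgue_on Om) (\<lambda>x. f n x * partial_deriv i (partial_deriv i w) x)" for i
      by (intro int sL smooth_partial_deriv f sw)
    \<comment> \<open>The equation for \<open>w\<close> turns the second derivatives left over by
      the product rule into the zeroth order term of the form.\<close>
    have "(\<Sum>i\<in>UNIV. LINT x|lebesgue_on Om. f n x * partial_deriv i (partial_deriv i w) x)
       = (LINT x|lebesgue_on Om. (\<Sum>i\<in>UNIV. f n x * partial_deriv i (partial_deriv i w) x))"
      by (rule Bochner_Integration.integral_sum[symmetric]) (rule i2)
    also have "\<dots> = (LINT x|lebesgue_on Om. - of_real (k\<^sup>2) * (f n x * w x))"
    proof (rule Bochner_Integration.integral_cong[OF refl])
      fix x
      have "(\<Sum>i\<in>UNIV. f n x * partial_deriv i (partial_deriv i w) x) = f n x * (- of_real (k\<^sup>2) * w x)"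
        using w unfolding helmholtz_solution_def by (simp only: sum_distrib_left[symmetric])
      then show "(\<Sum>i\<in>UNIV. f n x * partial_deriv i (partial_deriv i w) x) = - of_real (k\<^sup>2) * (f n x * w x)"
        by (simp add: mult_ac)
    qed
    also have "\<dots> = - of_real (k\<^sup>2) * (LINT x|lebesgue_on Om. f n x * w x)"
      by (rule integral_mult_right_zero)
    finally show ?thesis unfolding 1 using i1 i2 by (simp add: sum.distrib)
  qed
  ultimately show ?thesis by simp
qed

lemma smooth_L2_boundary:
  assumes "lipschitz_domain Om" "smooth h"
  shows "h \<in> L2 (boundary_measure Om)"
proof -
  have "continuous_on UNIV (\<lambda>x. (cmod (h x))\<^sup>2)" by (intro continuous_intros smooth_continuous assms)
  from integrable_boundary_measure[OF assms(1) this] show ?thesis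
    using smooth_continuous[OF assms(2)]
    by (auto simp: L2_def intro!: borel_measurable_boundary_measure borel_measurable_continuous_onI)
qed

text \<open>The approximating integrals for \<open>u1\<close> and \<open>u2\<close> differ by at
  most \<open>C\<close> times a bound for the gradient of \<open>w\<close> on the boundary times the
  two L^1 distances from the common trace \<open>g\<close>.\<close>

lemma helmholtz_form_eq_of_trace_eq:
  assumes Om: "lipschitz_domain Om" and t1: "has_trace Om u1 g" and t2: "has_trace Om u2 g"
    and w: "helmholtz_solution k w"
  shows "helmholtz_form Om k u1 w = helmholtz_form Om k u2 w"
proof -
  let ?M = "boundary_measure Om"
  have sw: "smooth w" using w by (simp add: helmholtz_solution_def)
  interpret M: finite_measure ?M by (rule finite_boundary_measure[OF Om])
  note op = lipschitz_domainD(1)[OF Om] and bd = lipschitz_domainD(2)[OF Om]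
  have fm: "finite_measure (lebesgue_on Om)" by (rule finite_measure_lebesgue_on[OF op bd])
  obtain f1 where f1: "\<And>n. smooth (f1 n)" "(\<lambda>n::nat. H1_norm Om (\<lambda>x. f1 n x - u1 x)) \<longlonglongrightarrow> 0"
      "(\<lambda>n. LINT x|?M. (cmod (f1 n x - g x))\<^sup>2) \<longlonglongrightarrow> 0"
    using t1 unfolding has_trace_def by blast
  obtain f2 where f2: "\<And>n. smooth (f2 n)" "(\<lambda>n::nat. H1_norm Om (\<lambda>x. f2 n x - u2 x)) \<longlonglongrightarrow> 0"
      "(\<lambda>n. LINT x|?M. (cmod (f2 n x - g x))\<^sup>2) \<longlonglongrightarrow> 0"
    using t2 unfolding has_trace_def by blast
  have u: "u1 \<in> H1 Om" "u2 \<in> H1 Om" and g: "g \<in> L2 ?M" using t1 t2 by (auto simp: has_trace_def)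
  obtain C where C0: "C \<ge> 0" and C: "\<And>h i. smooth h \<Longrightarrow>
    cmod (LINT x|lebesgue_on Om. partial_deriv i h x) \<le> C * (LINT y|?M. cmod (h y))"
    using boundary_estimate[OF Om] by blast
  have bdf: "bounded (frontier Om)" using compact_frontier_bounded[OF bd] by (rule compact_imp_bounded)
  note cL = smooth_L2_boundary[OF Om]
  define J where "J f i = (LINT x|lebesgue_on Om. partial_deriv i (\<lambda>x. f x * partial_deriv i w x) x)" for f :: cfun and i
  define E where "E f = (LINT x|?M. cmod (f x - g x))" for f
  have L1: "(\<lambda>n. E (f1 n)) \<longlonglongrightarrow> 0"
    unfolding E_def by (intro L2_tendsto_imp_L1_tendsto[OF M.finite_measure_axioms _ f1(3)] L2_diff cL f1(1) g)
  have L2: "(\<lambda>n. E (f2 n)) \<longlonglongrightarrow> 0"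
    unfolding E_def by (intro L2_tendsto_imp_L1_tendsto[OF M.finite_measure_axioms _ f2(3)] L2_diff cL f2(1) g)
  have *: "(\<lambda>n. J (f1 n) i
     - J (f2 n) i) \<longlonglongrightarrow> 0" for i
  proof -
    obtain B where B: "\<And>x. x \<in> frontier Om \<Longrightarrow> cmod (partial_deriv i w x) \<le> B"
      using bounded_on_bounded[OF bdf smooth_continuous[OF smooth_partial_deriv[OF sw]]] by blast
    \<comment> \<open>The maximum with 0 makes the bound nonnegative without the choice of a
      boundary point.\<close>
    define B' where "B' = max B 0"
    have B': "B' \<ge> 0" "\<And>x. x \<in> frontier Om \<Longrightarrow> cmod (partial_deriv i w x) \<le> B'" using B by (auto simp: B'_def le_max_iff_disj)
    have "norm (J (f1 n) i
     - J (f2 n) i)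
       \<le> C * (B' * (E (f1 n) + E (f2 n)))" for n
    proof -
      let ?h1 = "\<lambda>x. f1 n x * partial_deriv i w x" and ?h2 = "\<lambda>x. f2 n x * partial_deriv i w x"
      have s: "smooth ?h1" "smooth ?h2" by (intro smooth_mult smooth_partial_deriv sw f1 f2)+
      have ii: "integrable (lebesgue_on Om) (partial_deriv i h)" if "smooth h" for h
        by (intro L2_integrable[OF fm] continuous_L2 op bd smooth_continuous smooth_partial_deriv that)
      have "J (f1 n) i - J (f2 n) i = (LINT x|lebesgue_on Om. partial_deriv i (\<lambda>x. ?h1 x - ?h2 x) x)"
        unfolding J_def using ii[OF s(1)] ii[OF s(2)] by (simp add: partial_deriv_diff smooth_differentiable s)
      also have "cmod \<dots> \<le> C * (LINT y|?M. cmod (?h1 y - ?h2 y))"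
        by (rule C[OF smooth_diff[OF s]])
      also have "(LINT y|?M. cmod (?h1 y - ?h2 y)) \<le> (LINT y|?M. B' * (cmod (f1 n y - g y) + cmod (f2 n y - g y)))"
      proof (rule integral_mono)
        show "integrable ?M (\<lambda>y. cmod (?h1 y - ?h2 y))"
          using L2_integrable[OF M.finite_measure_axioms cL[OF smooth_diff[OF s]]] by simp
        show "integrable ?M (\<lambda>y. B' * (cmod (f1 n y - g y) + cmod (f2 n y - g y)))"
          using L2_integrable[OF M.finite_measure_axioms L2_diff[OF cL[OF f1(1)[of n]] g]]
            L2_integrable[OF M.finite_measure_axioms L2_diff[OF cL[OF f2(1)[of n]] g]] by simp
        fix y assume "y \<in> space ?M"
        then have y: "y \<in> frontier Om" by simp
        have "cmod (?h1 y - ?h2 y) = cmod (f1 n y - f2 n y) * cmod (partial_deriv i w y)"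
          by (simp add: norm_mult[symmetric] left_diff_distrib)
        also have "\<dots> \<le> cmod (f1 n y - f2 n y) * B'" by (intro mult_left_mono B'(2) y) simp
        also have "cmod (f1 n y - f2 n y) \<le> cmod (f1 n y - g y) + cmod (f2 n y - g y)"
          using norm_triangle_ineq4[of "f1 n y - g y" "f2 n y - g y"] by simp
        finally show "cmod (?h1 y - ?h2 y) \<le> B' * (cmod (f1 n y - g y) + cmod (f2 n y - g y))"
          using B' by (simp add: mult.commute mult_right_mono)
      qed
      also have "\<dots> = B' * (E (f1 n) + E (f2 n))"
        using L2_integrable[OF M.finite_measure_axioms L2_diff[OF cL[OF f1(1)[of n]] g]]
            L2_integrable[OF M.finite_measure_axioms L2_diff[OF cL[OF f2(1)[of n]] g]] by (simp add: E_def)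
      finally show ?thesis using C0 by (simp add: mult_left_mono)
    qed
    then have ev: "\<forall>\<^sub>F n in sequentially. norm (J (f1 n) i
     - J (f2 n) i)
       \<le> C * (B' * (E (f1 n) + E (f2 n)))"
      by (rule always_eventually[OF allI])
    have "(\<lambda>n. C * (B' * (E (f1 n) + E (f2 n)))) \<longlonglongrightarrow> C * (B' * (0 + 0))"
      by (intro tendsto_mult tendsto_const tendsto_add L1 L2)
    then have "(\<lambda>n. C * (B' * (E (f1 n) + E (f2 n)))) \<longlonglongrightarrow> 0"
      by simp
    with ev show ?thesis by (rule Lim_null_comparison)
  qed
  have "(\<lambda>n. (\<Sum>i\<in>UNIV. J (f1 n) i
     - J (f2 n) i)) \<longlonglongrightarrow> (\<Sum>i\<in>(UNIV::2 set). 0)"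
    by (intro tendsto_sum *)
  moreover have "(\<lambda>n. (\<Sum>i\<in>UNIV. J (f1 n) i)
     - (\<Sum>i\<in>UNIV. J (f2 n) i))
     \<longlonglongrightarrow> helmholtz_form Om k u1 w - helmholtz_form Om k u2 w"
    unfolding J_def by (intro tendsto_diff helmholtz_form_limit Om u f1 f2 w)
  ultimately show ?thesis
    unfolding sum_subtractf[symmetric] using LIMSEQ_unique by fastforce
qed

text \<open>The constant sequence serves as approximation. That its error has norm 0 rests on
  uniqueness, since the gradient chosen for the zero function is zero only almost
  everywhere.\<close>

lemma has_trace_smooth:
  assumes Om: "lipschitz_domain Om" and w: "smooth w"
  shows "has_trace Om w w"
  unfolding has_trace_def
proof (intro conjI exI[of _ "\<lambda>n. w"] allI w)
  show "w \<in> H1 Om" by (rule smooth_H1[OF Om w])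
  show "w \<in> L2 (boundary_measure Om)" by (rule smooth_L2_boundary[OF Om w])
  have ae: "AE x in lebesgue_on Om. weak_gradient Om (\<lambda>x. 0) x = grad (\<lambda>x. 0) x"
    by (rule weak_gradient_smooth[OF Om smooth_const])
  have "(LINT x|lebesgue_on Om. (norm (weak_gradient Om (\<lambda>x. 0) x))\<^sup>2) = 0"
  proof (rule integral_eq_zero_AE)
    show "AE x in lebesgue_on Om. (norm (weak_gradient Om (\<lambda>x. 0) x))\<^sup>2 = 0"
      using ae by eventually_elim (simp add: grad_def zero_vec_def[symmetric])
  qed
  then show "(\<lambda>n. H1_norm Om (\<lambda>x. w x - w x)) \<longlonglongrightarrow> 0" by (simp add: H1_norm_def)
  show "(\<lambda>n. LINT x|boundary_measure Om. (cmod (w x - w x))\<^sup>2) \<longlonglongrightarrow> 0" by simp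
qed

text \<open>The defining formula is quantified over cutoffs, so it yields nothing until one is
  exhibited. As \<open>functional_support\<close> lies in the closure of \<open>D\<close>, a test
  function equal to 1 near that closure qualifies, and it leaves the integral over \<open>D\<close>
  unchanged.\<close>

lemma neumann_derivative_smooth:
  assumes Om: "lipschitz_domain Om" and N: "has_neumann_derivative Om k (source D \<rho>) u N" and w: "smooth w"
    and D: "open D" "closure D \<subseteq> Om"
  shows "N w = helmholtz_form Om k u w + source D \<rho> w"
proof -
  note op = lipschitz_domainD(1)[OF Om] and bd = lipschitz_domainD(2)[OF Om]
  have cD: "compact (closure D)"
    using D bd by (meson bounded_subset closed_closure compact_eq_bounded_closed)
  obtain \<psi> V where \<psi>: "\<psi> \<in> test_functions Om" "open V" "closure D \<subseteq> V" "\<And>x. x \<in> V \<Longrightarrow> \<psi> x = 1"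
    using cutoff_exists[OF cD op D(2)] by blast
  have spD: "space (lebesgue_on D) = D" by simp
  have "source D \<rho> f = 0" if f: "f \<in> test_functions (Om - closure D)" for f
  proof -
    have "\<rho> x * f x = 0" if "x \<in> D" for x
      using f that closure_subset[of "{x. f x \<noteq> 0}"] closure_subset[of D] by (auto simp: test_functions_def)
    then have "(LINT x|lebesgue_on D. \<rho> x * f x) = (LINT x|lebesgue_on D. 0)"
      by (intro Bochner_Integration.integral_cong refl) (simp add: spD)
    then show ?thesis by (simp add: source_def)
  qed
  moreover have "open (Om - closure D)" using op by auto
  ultimately have "functional_support Om (source D \<rho>) \<subseteq> closure D"
    unfolding functional_support_def by blast
  then have "cutoff Om (source D \<rho>) \<psi>" using \<psi> unfolding cutoff_def by blast
  moreover have tr: "has_trace Om w w" by (rule has_trace_smooth[OF Om w])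
  moreover from tr have "w \<in> H_half Om" unfolding H_half_def by blast
  ultimately have "N w = helmholtz_form Om k u w + source D \<rho> (\<lambda>x. \<psi> x * w x)"
    using N unfolding has_neumann_derivative_def by blast
  moreover have "source D \<rho> (\<lambda>x. \<psi> x * w x) = source D \<rho> w"
    unfolding source_def
  proof (rule Bochner_Integration.integral_cong[OF refl])
    fix x assume "x \<in> space (lebesgue_on D)"
    then have "x \<in> V" using \<psi>(3) closure_subset[of D] by auto
    then show "\<rho> x * (\<psi> x * w x) = \<rho> x * w x" by (simp add: \<psi>(4))
  qed
  ultimately show ?thesis by simp
qed

text \<open>The same functional \<open>N\<close> is evaluated at \<open>w\<close> for both
  solutions; once the forms agree, the source terms must agree.\<close>

lemma source_eq_of_cauchy_data:
  assumes Om: "lipschitz_domain Om" and w: "helmholtz_solution k w"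
    and c: "has_cauchy_data Om k (source D1 \<rho>1) u1 (g, N)" "has_cauchy_data Om k (source D2 \<rho>2) u2 (g, N)"
    and D: "open D1" "closure D1 \<subseteq> Om" "open D2" "closure D2 \<subseteq> Om"
  shows "source D1 \<rho>1 w = source D2 \<rho>2 w"
proof -
  have sw: "smooth w" using w by (simp add: helmholtz_solution_def)
  have t: "has_trace Om u1 g" "has_trace Om u2 g"
    and n: "has_neumann_derivative Om k (source D1 \<rho>1) u1 N" "has_neumann_derivative Om k (source D2 \<rho>2) u2 N"
    using c by (auto simp: has_cauchy_data_def)
  have "helmholtz_form Om k u1 w = helmholtz_form Om k u2 w" by (rule helmholtz_form_eq_of_trace_eq[OF Om t w])
  moreover have "N w = helmholtz_form Om k u1 w + source D1 \<rho>1 w"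
    by (rule neumann_derivative_smooth[OF Om n(1) sw D(1,2)])
  moreover have "N w = helmholtz_form Om k u2 w + source D2 \<rho>2 w"
    by (rule neumann_derivative_smooth[OF Om n(2) sw D(3,4)])
  ultimately show ?thesis by simp
qed


section \<open>Corners of polygons\<close>

text \<open>A list with fewer than two points gives the empty set, unlike the image of the path;
  hence the length conditions below.\<close>

fun segs :: "plane list \<Rightarrow> plane set" where
  "segs (a # b # xs) = closed_segment a b \<union> segs (b # xs)"
| "segs _ = {}"

lemma polygonal_path_ends [simp]:
  "xs \<noteq> [] \<Longrightarrow> pathstart (polygonal_path xs) = hd xs"
  "xs \<noteq> [] \<Longrightarrow> pathfinish (polygonal_path xs) = last xs"
  by (induction xs rule: polygonal_path.induct) auto

lemma path_image_polygonal_path: "length xs \<ge> 2 \<Longrightarrow> path_image (polygonal_path xs) = segs xs"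
  by (induction xs rule: polygonal_path.induct) (auto simp: path_image_join)

lemma polygonal_path_Cons:
  "length xs \<ge> 2 \<Longrightarrow> polygonal_path (a # xs) = linepath a (hd xs) +++ polygonal_path xs"
  by (cases xs; cases "tl xs") auto

lemma segs_append: "segs (us @ a # vs) = segs (us @ [a]) \<union> segs (a # vs)"
proof (induction us)
  case (Cons u us)
  then show ?case by (cases us) auto
qed simp

lemma closed_segs: "closed (segs xs)"
  by (induction xs rule: segs.induct) auto

lemma set_subset_segs: "length xs \<ge> 2 \<Longrightarrow> set xs \<subseteq> segs xs"
proof (induction xs rule: segs.induct)
  case (1 a b xs)
  then show ?case by (cases xs) auto
qed auto

lemma segs_subset_hull: "segs xs \<subseteq> convex hull (set xs)"
proof (induction xs rule: segs.induct)
  case (1 a b xs)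
  have "closed_segment a b \<subseteq> convex hull (set (a # b # xs))"
    unfolding segment_convex_hull by (rule hull_mono) auto
  moreover have "convex hull (set (b # xs)) \<subseteq> convex hull (set (a # b # xs))"
    by (rule hull_mono) auto
  ultimately show ?case using 1 by auto
qed auto

lemma arc_polygonal_path_Cons:
  assumes "arc (polygonal_path (a # xs))" "length xs \<ge> 2"
  shows "arc (polygonal_path xs)" "a \<noteq> hd xs" "closed_segment a (hd xs) \<inter> segs xs \<subseteq> {hd xs}"
proof -
  have xs: "xs \<noteq> []" using assms(2) by auto
  have "arc (linepath a (hd xs) +++ polygonal_path xs)"
    using assms by (simp add: polygonal_path_Cons)
  then have *: "arc (linepath a (hd xs)) \<and> arc (polygonal_path xs) \<and>
      path_image (linepath a (hd xs)) \<inter> path_image (polygonal_path xs) \<subseteq> {hd xs}"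
    using xs by (subst (asm) arc_join_eq) auto
  then show "arc (polygonal_path xs)" "closed_segment a (hd xs) \<inter> segs xs \<subseteq> {hd xs}"
    using assms(2) by (auto simp: path_image_polygonal_path)
  show "a \<noteq> hd xs" using * arc_distinct_ends by fastforce
qed

lemma arc_start_notin_segs: "arc (polygonal_path (p # b # vs)) \<Longrightarrow> p \<notin> segs (b # vs)"
proof (cases vs)
  case (Cons c cs)
  assume "arc (polygonal_path (p # b # vs))"
  from arc_polygonal_path_Cons[OF this] show ?thesis using Cons by auto
qed auto

lemma arc_finish_notin_segs: "arc (polygonal_path (us @ [a, p])) \<Longrightarrow> p \<notin> segs (us @ [a])"
proof (induction us)
  case (Cons u us)
  let ?r = "us @ [a, p]"
  have r: "arc (polygonal_path ?r)" "closed_segment u (hd ?r) \<inter> segs ?r \<subseteq> {hd ?r}"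
    using arc_polygonal_path_Cons[of u ?r] Cons.prems by auto
  have "p \<notin> segs (us @ [a])" using Cons.IH r by blast
  moreover have "p \<in> segs ?r" using set_subset_segs[of ?r] by auto
  moreover have "hd ?r \<noteq> p" using arc_distinct_ends[OF r(1)] by simp
  moreover have "segs ((u # us) @ [a]) = closed_segment u (hd ?r) \<union> segs (us @ [a])"
    by (cases us) auto
  ultimately show ?case using r(2) by auto
qed simp

text \<open>An arc passes through \<open>p\<close> only once, so the edges before and after its two
  adjacent ones avoid \<open>p\<close>. The induction peels off the first edge, which meets the rest
  only in its end point \<open>hd ?r\<close>, a point other than \<open>p\<close>.\<close>

lemma arc_inner_notin_segs:
  "arc (polygonal_path (us @ a # p # b # vs)) \<Longrightarrow> p \<notin> segs (us @ [a]) \<and> p \<notin> segs (b # vs) \<and> a \<noteq> p"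
proof (induction us)
  case Nil
  then show ?case
    using arc_polygonal_path_Cons[of a "p # b # vs"] arc_start_notin_segs by auto
next
  case (Cons u us)
  let ?r = "us @ a # p # b # vs"
  have r: "arc (polygonal_path ?r)" "closed_segment u (hd ?r) \<inter> segs ?r \<subseteq> {hd ?r}"
    using arc_polygonal_path_Cons[of u ?r] Cons.prems by auto
  have IH: "p \<notin> segs (us @ [a])" "p \<notin> segs (b # vs)" "a \<noteq> p" using Cons.IH[OF r(1)] by auto
  have "p \<in> segs ?r" using set_subset_segs[of ?r] by auto
  moreover have "hd ?r \<noteq> p"
  proof (cases us)
    case (Cons w ws)
    have "w \<in> segs (us @ [a])" using set_subset_segs[of "us @ [a]"] Cons by (cases ws) auto
    then show ?thesis using IH Cons by auto
  qed (use IH in simp)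
  moreover have "segs ((u # us) @ [a]) = closed_segment u (hd ?r) \<union> segs (us @ [a])"
    by (cases us) auto
  ultimately show ?case using r(2) IH by auto
qed

text \<open>Since \<open>R\<close> is closed and avoids \<open>p\<close>, a small disk around
  \<open>p\<close> meets the curve in the two edges only.\<close>

definition corner_of :: "plane set \<Rightarrow> plane \<Rightarrow> plane \<Rightarrow> plane \<Rightarrow> bool" where
  "corner_of Q a p b \<longleftrightarrow> \<not> collinear {a, p, b} \<and>
     (\<exists>R. closed R \<and> p \<notin> R \<and> Q = closed_segment p a \<union> closed_segment p b \<union> R)"

lemma corner_ofI:
  assumes "\<not> collinear {a, p, b}" "closed R" "p \<notin> R" "Q = closed_segment p a \<union> closed_segment p b \<union> R"
  shows "corner_of Q a p b"
  using assms unfolding corner_of_def by blast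

text \<open>A closed simple path is not an arc, but becomes one when its first edge is removed. The
  vertex \<open>p\<close> is then the end, the start or an inner vertex of the arc from
  \<open>v1\<close> back to \<open>v0\<close>.\<close>

lemma polygon_corner:
  assumes P: "open_polygon ps D" and p: "p \<in> set ps"
  obtains a b where "a \<in> set ps" "b \<in> set ps" "corner_of (path_image (polygonal_path (ps @ [hd ps]))) a p b"
proof -
  let ?n = "length ps"
  have n: "?n \<ge> 3" and simple: "simple_path (polygonal_path (ps @ [hd ps]))"
    and nc: "\<And>i. i < ?n \<Longrightarrow> \<not> collinear {ps ! i, ps ! ((i + 1) mod ?n), ps ! ((i + 2) mod ?n)}"
    using P unfolding open_polygon_def by blast+
  obtain v0 v1 w rest where ps: "ps = v0 # v1 # w # rest"
    using n by (metis One_nat_def Suc_le_length_iff numeral_3_eq_3)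
  let ?t = "v1 # w # rest @ [v0]"
  have Q: "path_image (polygonal_path (ps @ [hd ps])) = closed_segment v0 v1 \<union> segs ?t"
    using ps by (subst path_image_polygonal_path) auto
  have "polygonal_path (ps @ [hd ps]) = linepath v0 v1 +++ polygonal_path ?t"
    using ps by simp
  then have "simple_path (linepath v0 v1 +++ polygonal_path ?t)" using simple by simp
  then have "arc (linepath v0 v1) \<and> arc (polygonal_path ?t) \<and>
      path_image (linepath v0 v1) \<inter> path_image (polygonal_path ?t) \<subseteq> {v0, v1}"
    by (subst (asm) simple_path_join_loop_eq) auto
  then have arc: "arc (polygonal_path ?t)" and int: "closed_segment v0 v1 \<inter> segs ?t \<subseteq> {v0, v1}"
    using path_image_polygonal_path[of ?t] by auto
  consider "p = v0" | "p = v1" | "p \<in> set (w # rest)" using p ps by auto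
  then show thesis
  proof cases
    case 1
    obtain us a where ua: "v1 # w # rest = us @ [a]" by (metis rev_exhaust list.distinct(1))
    then have t: "?t = us @ a # [v0]" by simp
    have a: "a = last ps" "a \<in> set ps" using ua ps by (metis last.simps last_snoc list.distinct(1)) (use ua ps in \<open>metis in_set_conv_decomp list.set_intros(2)\<close>)
    have idx: "ps ! (?n - 1) = a" using a ps last_conv_nth[of ps] by simp
    \<comment> \<open>Indices wrap around: the predecessor of the first vertex is the last one,
      number \<open>?n - 1\<close>.\<close>
    have "(?n - 1 + 1) mod ?n = 0" "(?n - 1 + 2) mod ?n = 1" using n by (auto simp: mod_if)
    then have "\<not> collinear {a, v0, v1}" using nc[of "?n - 1"] n idx ps by simp
    moreover have "v0 \<notin> segs (us @ [a])" using arc_finish_notin_segs[of us a v0] arc t by simp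
    moreover have "segs ?t = segs (us @ [a]) \<union> closed_segment a v0" unfolding t by (subst segs_append) simp
    ultimately have "corner_of (path_image (polygonal_path (ps @ [hd ps]))) a v0 v1"
      unfolding Q by (intro corner_ofI[of _ _ _ "segs (us @ [a])"] closed_segs) (auto simp: closed_segment_commute)
    then show thesis using that[of a v1] a 1 ps by auto
  next
    case 2
    have "\<not> collinear {v0, v1, w}" using nc[of 0] n ps by (simp add: mod_if)
    moreover have "v1 \<notin> segs (w # rest @ [v0])" using arc_start_notin_segs[of v1 w "rest @ [v0]"] arc by simp
    ultimately have "corner_of (path_image (polygonal_path (ps @ [hd ps]))) v0 v1 w"
      unfolding Q by (intro corner_ofI[of _ _ _ "segs (w # rest @ [v0])"] closed_segs) (auto simp: closed_segment_commute)
    then show thesis using that[of v0 w] 2 ps by auto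
  next
    case 3
    obtain r1 r2 where r: "w # rest = r1 @ p # r2" using 3 by (meson split_list)
    obtain us a where ua: "v1 # r1 = us @ [a]" by (metis rev_exhaust list.distinct(1))
    obtain b vs where bv: "r2 @ [v0] = b # vs" by (cases "r2 @ [v0]") auto
    have psr: "ps = v0 # (us @ [a]) @ p # r2" using ps r ua by (metis append_Cons)
    have t: "?t = us @ a # p # b # vs"
    proof -
      have "?t = (v1 # r1) @ p # r2 @ [v0]" using r by (metis append.assoc append_Cons)
      then show ?thesis unfolding ua bv by simp
    qed
    have np: "p \<notin> segs (us @ [a])" "p \<notin> segs (b # vs)" "a \<noteq> p"
      using arc_inner_notin_segs[of us a p b vs] arc t by auto
    have nc': "\<not> collinear {a, p, b}"
    proof -
      let ?i = "Suc (length us)"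
      have i: "?i + 1 < ?n" using psr by simp
      have "ps ! ?i = a" "ps ! (?i + 1) = p" using psr by (auto simp: nth_append)
      moreover have "ps ! ((?i + 2) mod ?n) = b"
      proof (cases r2)
        case Nil
        then have "?i + 2 = ?n" "b = v0" using psr bv by auto
        then show ?thesis using ps by simp
      next
        case (Cons c cs)
        then have "b = c" "?i + 2 < ?n" using bv psr by auto
        then show ?thesis using psr Cons by (simp add: nth_append)
      qed
      ultimately show ?thesis using nc[of ?i] i by simp
    qed
    then have pb: "p \<noteq> b" by auto
    \<comment> \<open>Here the removed first edge becomes part of the remainder; it meets the arc
      only in \<open>v0\<close> and \<open>v1\<close>, and both differ from
      \<open>p\<close>.\<close>
    have "p \<notin> closed_segment v0 v1"
    proof
      assume "p \<in> closed_segment v0 v1"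
      moreover have "p \<in> segs ?t" using set_subset_segs[of ?t] unfolding t by auto
      ultimately have "p = v0 \<or> p = v1" using int by auto
      moreover have "p \<noteq> v0"
      proof (cases vs)
        case Nil
        then have "b = v0" using bv by (cases r2) auto
        then show ?thesis using pb by simp
      next
        case (Cons c cs)
        have "v0 = last (b # vs)" using bv by (metis last_snoc)
        then have "v0 \<in> set (b # vs)" by (metis last_in_set list.distinct(1))
        then have "v0 \<in> segs (b # vs)" using set_subset_segs[of "b # vs"] Cons by auto
        then show ?thesis using np by auto
      qed
      moreover have "p \<noteq> v1"
      proof (cases us)
        case Nil
        then show ?thesis using ua np(3) by simp
      next
        case (Cons c cs)
        then have "v1 = c" using ua by simp
        then have "v1 \<in> segs (us @ [a])" using set_subset_segs[of "us @ [a]"] Cons by auto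
        then show ?thesis using np by auto
      qed
      ultimately show False by blast
    qed
    moreover have "segs ?t = segs (us @ [a]) \<union> closed_segment a p \<union> closed_segment p b \<union> segs (b # vs)"
      unfolding t by (subst segs_append) auto
    ultimately have "corner_of (path_image (polygonal_path (ps @ [hd ps]))) a p b"
      unfolding Q using np nc'
      by (intro corner_ofI[of _ _ _ "closed_segment v0 v1 \<union> segs (us @ [a]) \<union> segs (b # vs)"] closed_Un closed_segs)
         (auto simp: closed_segment_commute)
    moreover have "a \<in> set ps" "b \<in> set ps"
    proof -
      show "a \<in> set ps" unfolding psr by simp
      show "b \<in> set ps" using bv unfolding psr by (cases r2) auto
    qed
    ultimately show thesis using that by blast
  qed
qed

text \<open>The Jordan curve theorem concerns curves in the complex plane; a linear isomorphism
  carries it over. The bounded component is recognised as \<open>inside\<close> because the other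
  one is connected and unbounded.\<close>

lemma Jordan_plane:
  fixes c :: "real \<Rightarrow> plane"
  assumes "simple_path c" "pathfinish c = pathstart c"
  shows "open (inside (path_image c))" "bounded (inside (path_image c))"
    "frontier (inside (path_image c)) = path_image c"
proof -
  define f :: "plane \<Rightarrow> complex" where "f x = Complex (x $ 1) (x $ 2)" for x
  define h :: "complex \<Rightarrow> plane" where "h z = vector [Re z, Im z]" for z
  have lin: "linear f" "linear h"
    by (auto intro!: linearI simp: f_def h_def complex_eq_iff vec_eq_iff forall_2)
  have fh: "f (h z) = z" "h (f x) = x" for z x
    by (auto simp: f_def h_def complex_eq_iff vec_eq_iff forall_2)
  have inj: "inj f" "inj h" by (metis injI fh)+
  have "simple_path (f \<circ> c)" "pathfinish (f \<circ> c) = pathstart (f \<circ> c)"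
    using assms simple_path_linear_image_eq[OF lin(1) inj(1), of c]
    by (auto simp: pathfinish_compose pathstart_compose)
  from Jordan_curve[OF this] obtain inner outer where *:
    "inner \<noteq> {}" "open inner" "connected inner"
    "outer \<noteq> {}" "open outer" "connected outer"
    "bounded inner" "\<not> bounded outer" "inner \<inter> outer = {}"
    "inner \<union> outer = - path_image (f \<circ> c)"
    "frontier inner = path_image (f \<circ> c)" "frontier outer = path_image (f \<circ> c)"
    by metis
  have img: "h ` path_image (f \<circ> c) = path_image c"
    by (auto simp: path_image_compose image_image fh)
  have bl: "bounded_linear f" "bounded_linear h" using lin linear_linear by blast+
  have op: "open (h ` inner)" using * lin inj fh by (intro open_surjective_linear_image) (auto simp: surj_def, metis)
  have bd: "bounded (h ` inner)" using * bl by (intro bounded_linear_image)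
  have fr: "frontier (h ` inner) = path_image c"
  proof -
    have "frontier (h ` inner) = h ` closure inner - h ` inner"
      unfolding frontier_def interior_open[OF op] closure_injective_linear_image[OF lin(2) inj(2)] ..
    also have "\<dots> = h ` (closure inner - inner)" by (rule image_set_diff[OF inj(2), symmetric])
    also have "closure inner - inner = path_image (f \<circ> c)"
      using *(11) by (simp add: frontier_def interior_open[OF *(2)])
    finally show ?thesis using img by simp
  qed
  have "\<not> bounded (h ` outer)"
  proof
    assume "bounded (h ` outer)"
    then have "bounded (f ` (h ` outer))" by (rule bounded_linear_image[OF _ bl(1)])
    then show False using * by (simp add: image_image fh)
  qed
  moreover have "connected (h ` outer)"
    using * bl by (intro connected_continuous_image linear_continuous_on)
  moreover have "h ` inner \<union> h ` outer = - path_image c"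
  proof -
    have "h ` (inner \<union> outer) = - h ` path_image (f \<circ> c)"
      unfolding *(10) using inj fh by (metis bij_image_Compl_eq bijI surjI)
    then show ?thesis by (simp add: image_Un img)
  qed
  ultimately have "inside (path_image c) \<subseteq> h ` inner" by (intro inside_subset)
  moreover have "h ` inner \<subseteq> inside (path_image c)"
    using interior_inside_frontier[OF bd] by (simp add: fr interior_open[OF op])
  ultimately have "inside (path_image c) = h ` inner" by blast
  then show "open (inside (path_image c))" "bounded (inside (path_image c))"
    "frontier (inside (path_image c)) = path_image c"
    using op bd fr by simp_all
qed

lemma polygon_facts:
  assumes P: "open_polygon ps D"
  shows "open D" "bounded D" "frontier D = path_image (polygonal_path (ps @ [hd ps]))"
    "D \<subseteq> convex hull (set ps)" "set ps \<subseteq> frontier D"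
proof -
  let ?c = "polygonal_path (ps @ [hd ps])"
  have n: "length ps \<ge> 3" and sp: "simple_path ?c" and D: "D = inside (path_image ?c)"
    using P unfolding open_polygon_def by blast+
  have "hd (ps @ [hd ps]) = hd ps" using n by (cases ps) auto
  then have "pathfinish ?c = pathstart ?c" by simp
  from Jordan_plane[OF sp this] show "open D" "bounded D" and fr: "frontier D = path_image ?c"
    by (simp_all add: D)
  have im: "path_image ?c = segs (ps @ [hd ps])" using n by (intro path_image_polygonal_path) auto
  have "set (ps @ [hd ps]) = set ps" using n by (cases ps) auto
  then have sub: "path_image ?c \<subseteq> convex hull (set ps)" using segs_subset_hull[of "ps @ [hd ps]"] by (simp add: im)
  \<comment> \<open>Off a convex set that contains the curve one can escape to infinity.\<close>
  have "- (convex hull (set ps)) \<subseteq> outside (path_image ?c)"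
    by (rule outside_subset_convex[OF convex_convex_hull sub])
  then show "D \<subseteq> convex hull (set ps)" unfolding D using inside_Int_outside by blast
  show "set ps \<subseteq> frontier D"
    using set_subset_segs[of "ps @ [hd ps]"] n unfolding fr im by auto
qed

text \<open>The vertices are limits of points of \<open>D\<close>, so the hull of \<open>D\<close>
  is dense in the hull of the vertices; as an open convex set it is the interior of its
  closure.\<close>

lemma convex_hull_polygon:
  assumes P: "open_polygon ps D"
  shows "convex hull D = interior (convex hull (set ps))"
proof -
  note f = polygon_facts[OF P]
  have "convex hull D \<subseteq> convex hull (set ps)" using f(4) by (simp add: hull_minimal)
  moreover have "convex hull (set ps) \<subseteq> closure (convex hull D)"
  proof (rule hull_minimal)
    show "set ps \<subseteq> closure (convex hull D)"
      using f(5) closure_mono[OF hull_subset[of D convex]] by (auto simp: frontier_def)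
    show "convex (closure (convex hull D))" by (intro convex_closure convex_convex_hull)
  qed
  ultimately have "interior (convex hull D) \<subseteq> interior (convex hull (set ps)) \<and>
    interior (convex hull (set ps)) \<subseteq> interior (closure (convex hull D))"
    by (simp add: interior_mono)
  moreover have "interior (closure (convex hull D)) = interior (convex hull D)"
    by (rule convex_interior_closure[OF convex_convex_hull])
  moreover have "interior (convex hull D) = convex hull D"
    by (intro interior_open open_convex_hull f)
  ultimately show ?thesis by blast
qed

text \<open>By Cramer's rule, with \<open>d\<close> the determinant of \<open>a\<close> and
  \<open>b\<close>, the rows of the inverse matrix are \<open>u\<close> and \<open>v\<close>. They
  read off the coordinates along the two edges of a corner.\<close>

lemma dual_basis:
  fixes a b :: plane
  assumes "\<not> collinear {0, a, b}"
  obtains u v where "u \<bullet> a = 1" "u \<bullet> b = 0" "v \<bullet> a = 0" "v \<bullet> b = 1"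
    "\<forall>x. x = (u \<bullet> x) *\<^sub>R a + (v \<bullet> x) *\<^sub>R b"
proof -
  define d where "d = a $ 1 * b $ 2 - a $ 2 * b $ 1"
  have d: "d \<noteq> 0"
  proof
    assume d0: "d = 0"
    have "a = 0 \<or> b = 0 \<or> (\<exists>c. b = c *\<^sub>R a)"
    proof (cases "a = 0")
      case False
      then consider "a $ 1 \<noteq> 0" | "a $ 2 \<noteq> 0" by (auto simp: vec_eq_iff forall_2)
      then show ?thesis
      proof cases
        case 1
        then have "b = (b $ 1 / a $ 1) *\<^sub>R a" using d0 by (auto simp: d_def vec_eq_iff forall_2 field_simps)
        then show ?thesis by blast
      next
        case 2
        then have "b = (b $ 2 / a $ 2) *\<^sub>R a" using d0 by (auto simp: d_def vec_eq_iff forall_2 field_simps)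
        then show ?thesis by blast
      qed
    qed simp
    then show False using assms by (simp add: collinear_lemma)
  qed
  define u :: plane where "u = vector [b $ 2 / d, - b $ 1 / d]"
  define v :: plane where "v = vector [- a $ 2 / d, a $ 1 / d]"
  have in2: "x \<bullet> y = x $ 1 * y $ 1 + x $ 2 * y $ 2" for x y :: plane
    by (simp add: inner_vec_def sum_2)
  have ui: "u \<bullet> x = (b $ 2 * x $ 1 - b $ 1 * x $ 2) / d" for x
    by (simp add: u_def in2 diff_divide_distrib)
  have vi: "v \<bullet> x = (a $ 1 * x $ 2 - a $ 2 * x $ 1) / d" for x
    by (simp add: v_def in2 diff_divide_distrib)
  have "b $ 2 * a $ 1 - b $ 1 * a $ 2 = d" by (simp add: d_def)
  then have "u \<bullet> a = 1" unfolding ui using d by simp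
  moreover have "a $ 1 * b $ 2 - a $ 2 * b $ 1 = d" by (simp add: d_def)
  then have "v \<bullet> b = 1" unfolding vi using d by simp
  moreover have "u \<bullet> b = 0" "v \<bullet> a = 0" by (auto simp: ui vi)
  moreover have "x = (u \<bullet> x) *\<^sub>R a + (v \<bullet> x) *\<^sub>R b" for x
  proof -
    have "d * x $ 1 = (b $ 2 * x $ 1 - b $ 1 * x $ 2) * a $ 1 + (a $ 1 * x $ 2 - a $ 2 * x $ 1) * b $ 1"
      "d * x $ 2 = (b $ 2 * x $ 1 - b $ 1 * x $ 2) * a $ 2 + (a $ 1 * x $ 2 - a $ 2 * x $ 1) * b $ 2"
      by (auto simp: d_def algebra_simps)
    then have "x $ 1 = ((b $ 2 * x $ 1 - b $ 1 * x $ 2) * a $ 1 + (a $ 1 * x $ 2 - a $ 2 * x $ 1) * b $ 1) / d"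
      "x $ 2 = ((b $ 2 * x $ 1 - b $ 1 * x $ 2) * a $ 2 + (a $ 1 * x $ 2 - a $ 2 * x $ 1) * b $ 2) / d"
      using d by (metis nonzero_mult_div_cancel_left)+
    then show ?thesis by (simp add: ui vi vec_eq_iff forall_2 add_divide_distrib)
  qed
  ultimately show thesis by (intro that[of u v] allI)
qed

lemma convex_subset_or_disjoint:
  fixes C D :: "'a::euclidean_space set"
  assumes "convex C" "C \<inter> frontier D = {}"
  shows "C \<subseteq> D \<or> C \<inter> D = {}"
  using connected_Int_frontier[of C D] assms convex_connected[OF assms(1)] by blast

text \<open>Near \<open>p\<close> the frontier consists of pieces of the two edges, so a convex
  region avoiding them lies in \<open>D\<close> or misses it. Exposure of \<open>p\<close> excludes
  the reflex side, and points of \<open>D\<close> close to \<open>p\<close> select the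
  sector.\<close>

lemma exposed_vertex_sector:
  assumes P: "open_polygon ps D" and p: "p \<in> set ps"
    and ex: "\<And>x. x \<in> convex hull (set ps) \<Longrightarrow> x \<noteq> p \<Longrightarrow> \<omega> \<bullet> (x - p) < 0"
  obtains a b u v r where "r > 0" "u \<bullet> a = 1" "u \<bullet> b = 0" "v \<bullet> a = 0" "v \<bullet> b = 1"
    "\<forall>x. x = (u \<bullet> x) *\<^sub>R a + (v \<bullet> x) *\<^sub>R b" "\<omega> \<bullet> a < 0" "\<omega> \<bullet> b < 0"
    "D \<inter> ball p r = {x \<in> ball p r. u \<bullet> (x - p) > 0 \<and> v \<bullet> (x - p) > 0}"
proof -
  note f = polygon_facts[OF P]
  obtain a0 b0 where ab: "a0 \<in> set ps" "b0 \<in> set ps" and "corner_of (frontier D) a0 p b0"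
    using polygon_corner[OF P p] f(3) by metis
  then obtain R where nc: "\<not> collinear {a0, p, b0}" and R: "closed R" "p \<notin> R"
    and Q: "frontier D = closed_segment p a0 \<union> closed_segment p b0 \<union> R"
    unfolding corner_of_def by blast
  define a where "a = a0 - p"
  define b where "b = b0 - p"
  have nc': "\<not> collinear {0, a, b}" using nc collinear_3[of a0 p b0] by (simp add: a_def b_def insert_commute)
  then have ne: "a \<noteq> 0" "b \<noteq> 0" by (auto simp: collinear_lemma)
  obtain u v where uv: "u \<bullet> a = 1" "u \<bullet> b = 0" "v \<bullet> a = 0" "v \<bullet> b = 1"
    and rep: "\<forall>x. x = (u \<bullet> x) *\<^sub>R a + (v \<bullet> x) *\<^sub>R b"
    using dual_basis[OF nc'] by blast
  have "a0 \<in> convex hull (set ps)" "b0 \<in> convex hull (set ps)" using ab by (auto intro: hull_inc)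
  then have w: "\<omega> \<bullet> a < 0" "\<omega> \<bullet> b < 0" using ex[of a0] ex[of b0] ne by (auto simp: a_def b_def)
  obtain r0 where r0: "r0 > 0" "ball p r0 \<inter> R = {}"
    by (meson ComplI R disjoint_eq_subset_Compl open_Compl openE)
  \<comment> \<open>The disk avoids \<open>R\<close> and is no larger than either edge, so inside it
    each edge fills its whole ray.\<close>
  define r where "r = Min {r0, norm a, norm b}"
  have r: "r > 0" "r \<le> r0" "r \<le> norm a" "r \<le> norm b" using r0 ne by (auto simp: r_def)
  have seg: "\<exists>s\<ge>0. x - p = s *\<^sub>R a \<or> x - p = s *\<^sub>R b" if "x \<in> ball p r" "x \<in> frontier D" for x
  proof -
    have "x \<in> ball p r0" using that r by auto
    then have "x \<notin> R" using r0(2) by blast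
    then have "x \<in> closed_segment p a0 \<union> closed_segment p b0" using that(2) Q by blast
    then show ?thesis by (auto simp: in_segment a_def b_def algebra_simps)
  qed
  have on: "p + s *\<^sub>R a \<in> frontier D" "p + s *\<^sub>R b \<in> frontier D" if "0 \<le> s" "s \<le> 1" for s
  proof -
    have "p + s *\<^sub>R a = (1 - s) *\<^sub>R p + s *\<^sub>R a0" "p + s *\<^sub>R b = (1 - s) *\<^sub>R p + s *\<^sub>R b0"
      by (auto simp: a_def b_def algebra_simps)
    then show "p + s *\<^sub>R a \<in> frontier D" "p + s *\<^sub>R b \<in> frontier D"
      unfolding Q using that by (auto simp: in_segment)
  qed
  \<comment> \<open>Used with \<open>u\<close> and \<open>a\<close>, then with \<open>v\<close> and
    \<open>b\<close>: an open half-disk with both edges on the other side of its diameter.\<close>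
  have half: "ball p r \<inter> {x. n \<bullet> (x - p) < 0} \<inter> D = {}"
    if n: "n \<bullet> c = 1" "\<omega> \<bullet> c < 0" "n \<bullet> a \<ge> 0" "n \<bullet> b \<ge> 0" for n c
  proof -
    let ?H = "ball p r \<inter> {x. n \<bullet> (x - p) < 0}"
    have "{x. n \<bullet> (x - p) < 0} = {x. n \<bullet> x < n \<bullet> p}" by (auto simp: inner_diff_right)
    then have "convex ?H" by (simp add: convex_Int convex_halfspace_lt)
    moreover have "?H \<inter> frontier D = {}"
    proof -
      have False if x: "x \<in> ball p r" "n \<bullet> (x - p) < 0" "x \<in> frontier D" for x
      proof -
        obtain s where s: "s \<ge> 0" "x - p = s *\<^sub>R a \<or> x - p = s *\<^sub>R b" using seg[OF x(1,3)] by blast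
        then show False using x(2) n(3,4) by (auto simp: mult_less_0_iff)
      qed
      then show ?thesis by blast
    qed
    ultimately have "?H \<subseteq> D \<or> ?H \<inter> D = {}" by (rule convex_subset_or_disjoint)
    moreover have "\<not> ?H \<subseteq> D"
    proof
      assume sub: "?H \<subseteq> D"
      have c: "c \<noteq> 0" using n by auto
      \<comment> \<open>This point lies opposite to the edge direction \<open>c\<close>, so
        \<open>\<omega>\<close> is larger there than at \<open>p\<close>, which no point of the hull
        allows.\<close>
      define x where "x = p - (r / (2 * norm c)) *\<^sub>R c"
      have k: "r / (2 * norm c) > 0" using r c by simp
      have "dist p x = r / 2" using r c by (simp add: x_def dist_norm)
      moreover have "n \<bullet> (x - p) < 0" using k n(1) by (simp add: x_def)
      ultimately have "x \<in> ball p r \<inter> {x. n \<bullet> (x - p) < 0}" using r by simp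
      then have "x \<in> convex hull (set ps)" using sub f(4) by blast
      moreover have "x \<noteq> p" using k c r(1) by (simp add: x_def)
      ultimately have "\<omega> \<bullet> (x - p) < 0" by (rule ex)
      then have "(r / (2 * norm c)) * (\<omega> \<bullet> c) > 0" by (simp add: x_def)
      then show False using mult_pos_neg[OF k n(2)] by linarith
    qed
    ultimately show ?thesis by blast
  qed
  have ha: "ball p r \<inter> {x. u \<bullet> (x - p) < 0} \<inter> D = {}" using half[of u a] uv w by simp
  have hb: "ball p r \<inter> {x. v \<bullet> (x - p) < 0} \<inter> D = {}" using half[of v b] uv w by simp
  let ?S = "{x \<in> ball p r. u \<bullet> (x - p) > 0 \<and> v \<bullet> (x - p) > 0}"
  have DQ: "D \<inter> frontier D = {}" using f(1) by (simp add: frontier_def interior_open)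
  have sub: "D \<inter> ball p r \<subseteq> ?S"
  proof
    fix x assume x: "x \<in> D \<inter> ball p r"
    then have ge: "u \<bullet> (x - p) \<ge> 0" "v \<bullet> (x - p) \<ge> 0" using ha hb by force+
    have xr: "norm (x - p) < r" using x by (simp add: dist_norm norm_minus_commute)
    \<comment> \<open>A point with one coordinate 0 and the other nonnegative lies on an edge, hence
      in the frontier, which the open set \<open>D\<close> avoids.\<close>
    have "u \<bullet> (x - p) \<noteq> 0"
    proof
      assume 0: "u \<bullet> (x - p) = 0"
      define s where "s = v \<bullet> (x - p)"
      have e: "x - p = s *\<^sub>R b" using rep[rule_format, of "x - p"] 0 by (simp add: s_def)
      have "s \<ge> 0" using ge by (simp add: s_def)
      then have "norm (x - p) = s * norm b" unfolding e by simp
      then have "s * norm b < norm b" using xr r by linarith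
      then have "s \<le> 1" using ne by simp
      then have "p + s *\<^sub>R b \<in> frontier D" using on(2) ge by (simp add: s_def)
      then show False using DQ x e by (metis IntI Int_iff add.commute diff_add_cancel empty_iff)
    qed
    moreover have "v \<bullet> (x - p) \<noteq> 0"
    proof
      assume 0: "v \<bullet> (x - p) = 0"
      define s where "s = u \<bullet> (x - p)"
      have e: "x - p = s *\<^sub>R a" using rep[rule_format, of "x - p"] 0 by (simp add: s_def)
      have "s \<ge> 0" using ge by (simp add: s_def)
      then have "norm (x - p) = s * norm a" unfolding e by simp
      then have "s * norm a < norm a" using xr r by linarith
      then have "s \<le> 1" using ne by simp
      then have "p + s *\<^sub>R a \<in> frontier D" using on(1) ge by (simp add: s_def)
      then show False using DQ x e by (metis IntI Int_iff add.commute diff_add_cancel empty_iff)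
    qed
    ultimately show "x \<in> ?S" using ge x by auto
  qed
  have "?S \<subseteq> D"
  proof -
    have "?S = ball p r \<inter> {x. u \<bullet> x > u \<bullet> p} \<inter> {x. v \<bullet> x > v \<bullet> p}" by (auto simp: inner_diff_right)
    then have "convex ?S" by (simp add: convex_Int convex_halfspace_gt)
    moreover have "?S \<inter> frontier D = {}"
    proof -
      have False if x: "x \<in> ball p r" "u \<bullet> (x - p) > 0" "v \<bullet> (x - p) > 0" "x \<in> frontier D" for x
        using seg[OF x(1,4)] x(2,3) uv by auto
      then show ?thesis by blast
    qed
    ultimately have "?S \<subseteq> D \<or> ?S \<inter> D = {}" by (rule convex_subset_or_disjoint)
    moreover have "p \<in> closure D" using f(5) p by (auto simp: frontier_def)
    then obtain y where "y \<in> D" "dist y p < r" using r(1) by (auto simp: closure_approachable)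
    then have "y \<in> ?S \<inter> D" using sub by (auto simp: dist_commute)
    ultimately show ?thesis by blast
  qed
  then have "D \<inter> ball p r = ?S" using sub by auto
  then show thesis using that[OF r(1) uv rep w] by blast
qed

text \<open>If all extreme points of the joint hull lay in both hulls, Krein-Milman would make the
  three hulls equal. An extreme point is one of the generating points, and in a polytope it is
  exposed, which supplies the strict functional.\<close>

lemma exposed_vertex_exists:
  fixes A B :: "'a::euclidean_space set"
  assumes fin: "finite A" "finite B" and ne: "convex hull A \<noteq> convex hull B"
  obtains p \<omega> where "p \<in> A - convex hull B \<or> p \<in> B - convex hull A"
    "\<forall>x\<in>convex hull (A \<union> B). x \<noteq> p \<longrightarrow> \<omega> \<bullet> x < \<omega> \<bullet> p"
proof -
  let ?K = "convex hull (A \<union> B)"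
  have poly: "polytope ?K" using fin by (simp add: polytope_convex_hull)
  have KA: "convex hull A \<subseteq> ?K" "convex hull B \<subseteq> ?K" by (simp_all add: hull_mono)
  have "\<exists>p. p extreme_point_of ?K \<and> (p \<notin> convex hull A \<or> p \<notin> convex hull B)"
  proof (rule ccontr)
    assume "\<not> ?thesis"
    then have "{x. x extreme_point_of ?K} \<subseteq> convex hull A" "{x. x extreme_point_of ?K} \<subseteq> convex hull B" by auto
    then have "convex hull {x. x extreme_point_of ?K} \<subseteq> convex hull A" "convex hull {x. x extreme_point_of ?K} \<subseteq> convex hull B"
      by (auto simp: hull_minimal)
    moreover have "?K = convex hull {x. x extreme_point_of ?K}"
      using poly by (intro Krein_Milman_polytope) (simp_all add: fin)
    ultimately show False using KA ne by auto
  qed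
  then obtain p where p: "p extreme_point_of ?K" "p \<notin> convex hull A \<or> p \<notin> convex hull B" by blast
  have "p \<in> A \<union> B" using extreme_point_of_convex_hull[OF p(1)] .
  then have pAB: "p \<in> A - convex hull B \<or> p \<in> B - convex hull A"
    using p(2) hull_inc[of p A] hull_inc[of p B] by auto
  have "{p} face_of ?K" using p(1) by (simp add: face_of_singleton)
  then have "{p} exposed_face_of ?K"
    using exposed_face_of_polyhedron[OF polytope_imp_polyhedron[OF poly]] by blast
  then obtain w c where wc: "?K \<subseteq> {x. w \<bullet> x \<le> c}" "{p} = ?K \<inter> {x. w \<bullet> x = c}"
    unfolding exposed_face_of_def by blast
  show thesis
  proof (rule that[OF pAB])
    have "w \<bullet> p = c" using wc(2) by auto
    moreover have "w \<bullet> x \<le> c" "w \<bullet> x \<noteq> c" if "x \<in> ?K" "x \<noteq> p" for x using wc that by auto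
    ultimately show "\<forall>x\<in>?K. x \<noteq> p \<longrightarrow> w \<bullet> x < w \<bullet> p" by (auto simp: less_le)
  qed
qed


section \<open>Complex geometrical optics solutions\<close>

lemma exp_integral_halfline:
  fixes c :: complex
  assumes c: "Re c < 0"
  shows "integrable lborel (\<lambda>t. indicator {0<..} t *\<^sub>R exp (c * of_real t))"
    and "(LINT t|lborel. indicator {0<..} t *\<^sub>R exp (c * of_real t)) = - 1 / c"
proof -
  have ev: "einterval 0 \<infinity> = {0<..}" using einterval_eq_Ici[of 0] by (simp add: zero_ereal_def)
  have lim_exp: "((\<lambda>t. exp (Re c * t)) \<longlongrightarrow> 0) at_top"
  proof -
    have "filterlim (\<lambda>t. Re c * t) at_bot at_top"
      using c by (intro filterlim_tendsto_neg_mult_at_bot[OF tendsto_const _ filterlim_ident])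
    then show ?thesis by (rule filterlim_compose[OF exp_at_bot])
  qed
  \<comment> \<open>Integrability is proved for the modulus, where the integrand is nonnegative, and
    then passed on by domination.\<close>
  have "set_integrable lborel (einterval 0 \<infinity>) (\<lambda>t. exp (Re c * t))"
  proof (rule interval_integral_FTC_nonneg[where F = "\<lambda>t. exp (Re c * t) / Re c"])
    show "DERIV (\<lambda>t. exp (Re c * t) / Re c) x :> exp (Re c * x)" for x
      using c by (auto intro!: derivative_eq_intros)
    have "((\<lambda>t. exp (Re c * t) / Re c) \<longlongrightarrow> exp (Re c * 0) / Re c) (at_right 0)"
      using c by (intro tendsto_intros) auto
    then show "(((\<lambda>t. exp (Re c * t) / Re c) \<circ> real_of_ereal) \<longlongrightarrow> 1 / Re c) (at_right 0)"
      by (simp add: zero_ereal_def ereal_tendsto_simps)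
    have "((\<lambda>t. exp (Re c * t) / Re c) \<longlongrightarrow> 0 / Re c) at_top"
      using c by (intro tendsto_divide lim_exp tendsto_const) auto
    then show "(((\<lambda>t. exp (Re c * t) / Re c) \<circ> real_of_ereal) \<longlongrightarrow> 0) (at_left \<infinity>)"
      by (simp add: ereal_tendsto_simps)
  qed auto
  then have "integrable lborel (\<lambda>t. indicator {0<..} t *\<^sub>R exp (Re c * t))"
    by (simp add: set_integrable_def ev)
  then show int: "integrable lborel (\<lambda>t. indicator {0<..} t *\<^sub>R exp (c * of_real t))"
    by (rule Bochner_Integration.integrable_bound) (auto simp: indicator_def)
  have "(LBINT t=0..\<infinity>. exp (c * of_real t)) = 0 - 1 / c"
  proof (rule interval_integral_FTC_integrable[where F = "\<lambda>t. exp (c * of_real t) / c"])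
    show "((\<lambda>t. exp (c * of_real t) / c) has_vector_derivative exp (c * of_real x)) (at x)" for x
    proof -
      have "c \<noteq> 0" using c by auto
      then have "((\<lambda>z. exp (c * z) / c) has_field_derivative exp (c * of_real x)) (at (of_real x))"
        by (auto intro!: derivative_eq_intros)
      then show ?thesis by (rule has_vector_derivative_real_field)
    qed
    show "set_integrable lborel (einterval 0 \<infinity>) (\<lambda>t. exp (c * of_real t))"
      using int by (simp add: set_integrable_def ev)
    have "((\<lambda>t. exp (c * of_real t) / c) \<longlongrightarrow> exp (c * of_real 0) / c) (at_right (0::real))"
      using c by (intro tendsto_intros) auto
    then show "(((\<lambda>t. exp (c * of_real t) / c) \<circ> real_of_ereal) \<longlongrightarrow> 1 / c) (at_right 0)"
      by (simp add: zero_ereal_def ereal_tendsto_simps)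
    have "((\<lambda>t. exp (c * of_real t)) \<longlongrightarrow> 0) at_top"
    proof (rule tendsto_norm_zero_cancel)
      show "((\<lambda>t. norm (exp (c * complex_of_real t))) \<longlongrightarrow> 0) at_top" using lim_exp by simp
    qed
    then have "((\<lambda>t. exp (c * of_real t) / c) \<longlongrightarrow> 0 / c) at_top"
      using c by (intro tendsto_divide tendsto_const) auto
    then show "(((\<lambda>t. exp (c * of_real t) / c) \<circ> real_of_ereal) \<longlongrightarrow> 0) (at_left \<infinity>)"
      by (simp add: ereal_tendsto_simps)
  qed auto
  then show "(LINT t|lborel. indicator {0<..} t *\<^sub>R exp (c * of_real t)) = - 1 / c"
    by (simp add: interval_lebesgue_integral_def set_lebesgue_integral_def ev)
qed

lemma lborel_integral_prod:
  fixes f :: "'a::euclidean_space \<Rightarrow> real \<Rightarrow> complex"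
  assumes f: "\<And>b. b \<in> Basis \<Longrightarrow> integrable lborel (f b)"
  shows "integrable lborel (\<lambda>x::'a. \<Prod>b\<in>Basis. f b (x \<bullet> b))"
    and "(LINT x|lborel. (\<Prod>b\<in>Basis. f b (x \<bullet> b))) = (\<Prod>b\<in>Basis. LINT t|lborel. f b t)"
proof -
  interpret product_sigma_finite "\<lambda>b::'a. lborel :: real measure" ..
  let ?T = "\<lambda>g::'a \<Rightarrow> real. \<Sum>b\<in>Basis. g b *\<^sub>R b"
  have L: "(lborel :: 'a measure) = distr (\<Pi>\<^sub>M b\<in>Basis. lborel) borel ?T" by (rule lborel_eq)
  have fm: "f b \<in> borel_measurable borel" if "b \<in> Basis" for b using f[OF that] by simp
  have T: "?T \<in> measurable (\<Pi>\<^sub>M b\<in>Basis. lborel) borel" by measurable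
  have m: "(\<lambda>x::'a. \<Prod>b\<in>Basis. f b (x \<bullet> b)) \<in> borel_measurable borel"
    by (intro borel_measurable_prod measurable_compose[OF _ fm]) auto
  have eq: "(\<Prod>b\<in>Basis. f b (?T g \<bullet> b)) = (\<Prod>b\<in>Basis. f b (g b))" for g
    by (intro prod.cong refl) (simp add: inner_sum_left_Basis)
  show "integrable lborel (\<lambda>x::'a. \<Prod>b\<in>Basis. f b (x \<bullet> b))"
    unfolding L
    by (subst integrable_distr_eq[OF T m]) (simp add: eq product_integrable_prod f)
  show "(LINT x|lborel. (\<Prod>b\<in>Basis. f b (x \<bullet> b))) = (\<Prod>b\<in>Basis. LINT t|lborel. f b t)"
    unfolding L by (subst integral_distr[OF T m]) (simp add: eq product_integral_prod f)
qed

text \<open>The exponential of a sum and the indicator of the orthant are both products over the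
  coordinates. The explicit value matters because it is visibly nonzero.\<close>

lemma orthant_exp_integral:
  fixes c :: "'a::euclidean_space \<Rightarrow> complex"
  assumes c: "\<And>b. b \<in> Basis \<Longrightarrow> Re (c b) < 0"
  defines "F \<equiv> \<lambda>x::'a. indicator {x. \<forall>b\<in>Basis. 0 < x \<bullet> b} x *\<^sub>R exp (\<Sum>b\<in>Basis. c b * of_real (x \<bullet> b))"
  shows "integrable lborel F" "(LINT x|lborel. F x) = (\<Prod>b\<in>Basis. - 1 / c b)"
proof -
  have F: "F x = (\<Prod>b\<in>Basis. indicator {0<..} (x \<bullet> b) *\<^sub>R exp (c b * of_real (x \<bullet> b)))" for x
  proof (cases "\<forall>b\<in>Basis. 0 < x \<bullet> b")
    case True
    then show ?thesis by (simp add: F_def exp_sum)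
  next
    case False
    then obtain b where b: "b \<in> Basis" "\<not> 0 < x \<bullet> b" by blast
    then have "(\<Prod>b\<in>Basis. indicator {0<..} (x \<bullet> b) *\<^sub>R exp (c b * of_real (x \<bullet> b))) = 0"
      by (intro prod_zero) (auto intro!: bexI[of _ b])
    moreover have "F x = 0" using False by (simp add: F_def)
    ultimately show ?thesis by simp
  qed
  show "integrable lborel F" "(LINT x|lborel. F x) = (\<Prod>b\<in>Basis. - 1 / c b)"
    unfolding F using lborel_integral_prod[of "\<lambda>b t. indicator {0<..} t *\<^sub>R exp (c b * of_real t)"]
      exp_integral_halfline[OF c] by (auto cong: prod.cong)
qed

text \<open>The preimage of a box under \<open>\<Phi>\<close> is its image under \<open>g\<close>,
  whose volume is scaled by the absolute determinant of \<open>g\<close>; \<open>\<kappa>\<close> is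
  the reciprocal. Positivity is exported because the limit only has to be nonzero.\<close>

lemma lborel_linear:
  fixes \<Phi> g :: "real^'n::{finite,wellorder} \<Rightarrow> real^'n::_"
  assumes lin: "linear \<Phi>" "linear g" and inv: "\<And>x. \<Phi> (g x) = x" "\<And>x. g (\<Phi> x) = x"
  obtains \<kappa> where "\<kappa> > 0" "lborel = density (distr lborel borel \<Phi>) (\<lambda>_. ennreal \<kappa>)"
proof -
  have "inj g" by (metis inv(1) injI)
  then have "det (matrix g) \<noteq> 0" using det_nz_iff_inj[OF lin(2)] by simp
  define d where "d = \<bar>det (matrix g)\<bar>"
  have d: "d > 0" using \<open>det (matrix g) \<noteq> 0\<close> by (simp add: d_def)
  have m: "\<Phi> \<in> borel_measurable borel"
    using lin(1) by (intro borel_measurable_continuous_onI linear_continuous_on) (simp add: linear_linear)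
  have "lborel = density (distr lborel borel \<Phi>) (\<lambda>_. ennreal (1 / d))"
  proof (rule lborel_eqI)
    fix l u :: "real^'n::_" assume le: "\<And>b. b \<in> Basis \<Longrightarrow> l \<bullet> b \<le> u \<bullet> b"
    have vim: "\<Phi> -` box l u = g ` box l u" using inv by (auto simp: image_iff) metis
    have B: "g ` box l u \<in> sets borel" unfolding vim[symmetric] using measurable_sets[OF m, of "box l u"] by simp
    have "emeasure (density (distr lborel borel \<Phi>) (\<lambda>_. ennreal (1 / d))) (box l u)
      = ennreal (1 / d) * emeasure lborel (g ` box l u)"
      using m by (simp add: emeasure_density nn_integral_cmult_indicator emeasure_distr vim)
    also have "emeasure lborel (g ` box l u) = emeasure lebesgue (g ` box l u)"
      using B by simp
    also have "\<dots> = ennreal (measure lebesgue (g ` box l u))"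
      by (intro emeasure_eq_measure2 measurable_linear_image lin) (simp add: lmeasurable_box)
    also have "measure lebesgue (g ` box l u) = d * measure lebesgue (box l u)"
      unfolding d_def by (intro measure_linear_image lin) (simp add: lmeasurable_box)
    also have "ennreal (1 / d) * ennreal (d * measure lebesgue (box l u)) = ennreal (measure lebesgue (box l u))"
      using d by (simp add: ennreal_mult[symmetric])
    also have "\<dots> = emeasure lebesgue (box l u)"
      by (rule emeasure_eq_measure2[symmetric]) (rule lmeasurable_box)
    also have "\<dots> = (\<Prod>b\<in>Basis. (u - l) \<bullet> b)"
      using le by (simp add: emeasure_lborel_box)
    finally show "emeasure (density (distr lborel borel \<Phi>) (\<lambda>_. ennreal (1 / d))) (box l u) = (\<Prod>b\<in>Basis. (u - l) \<bullet> b)" .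
  qed simp
  then show thesis using that[of "1 / d"] d by simp
qed

lemma lborel_integral_affine:
  fixes f :: "'a::euclidean_space \<Rightarrow> complex"
  assumes "c \<noteq> 0" and f: "f \<in> borel_measurable borel"
  shows "(LINT x|lborel. f x) = \<bar>c\<bar> ^ DIM('a) *\<^sub>R (LINT x|lborel. f (t + c *\<^sub>R x))"
proof -
  have m: "(\<lambda>x. t + c *\<^sub>R x) \<in> borel_measurable lborel" by measurable
  have "(LINT x|lborel. f x) = integral\<^sup>L (density (distr lborel borel (\<lambda>x. t + c *\<^sub>R x)) (\<lambda>_. \<bar>c\<bar> ^ DIM('a))) f"
    using lborel_affine[OF assms(1), of t] by (rule arg_cong)
  also have "\<dots> = (LINT x|distr lborel borel (\<lambda>x. t + c *\<^sub>R x). \<bar>c\<bar> ^ DIM('a) *\<^sub>R f x)"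
    using f by (intro integral_density) auto
  also have "\<dots> = \<bar>c\<bar> ^ DIM('a) *\<^sub>R (LINT x|distr lborel borel (\<lambda>x. t + c *\<^sub>R x). f x)" by simp
  also have "(LINT x|distr lborel borel (\<lambda>x. t + c *\<^sub>R x). f x) = (LINT x|lborel. f (t + c *\<^sub>R x))"
    by (rule integral_distr[OF m f])
  finally show ?thesis .
qed

lemma integral_density_distr_const:
  fixes f :: "'a::euclidean_space \<Rightarrow> complex"
  assumes "\<kappa> > 0" and \<Phi>: "\<Phi> \<in> borel_measurable borel" and f: "f \<in> borel_measurable borel"
    and eq: "lborel = density (distr lborel borel \<Phi>) (\<lambda>_. ennreal \<kappa>)"
  shows "(LINT x|lborel. f x) = \<kappa> *\<^sub>R (LINT x|lborel. f (\<Phi> x))"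
proof -
  have "(LINT x|lborel. f x) = integral\<^sup>L (density (distr lborel borel \<Phi>) (\<lambda>_. ennreal \<kappa>)) f"
    using eq by (rule arg_cong)
  also have "\<dots> = (LINT x|distr lborel borel \<Phi>. \<kappa> *\<^sub>R f x)"
    using f assms(1) by (intro integral_density) auto
  also have "\<dots> = \<kappa> *\<^sub>R (LINT x|distr lborel borel \<Phi>. f x)" by simp
  also have "(LINT x|distr lborel borel \<Phi>. f x) = (LINT x|lborel. f (\<Phi> x))"
    using \<Phi> f by (intro integral_distr) auto
  finally show ?thesis .
qed

section \<open>Exponential solutions of the Helmholtz equation\<close>

definition cgo :: "real \<Rightarrow> plane \<Rightarrow> plane \<Rightarrow> plane \<Rightarrow> real \<Rightarrow> cfun" where
  "cgo k \<omega> \<omega>' p \<tau> x = exp (of_real (\<tau> * (\<omega> \<bullet> (x - p))) + \<i> * of_real (sqrt (\<tau>\<^sup>2 + k\<^sup>2) * (\<omega>' \<bullet> (x - p))))"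

lemma norm_cgo: "cmod (cgo k \<omega> \<omega>' p \<tau> x) = exp (\<tau> * (\<omega> \<bullet> (x - p)))"
  by (simp add: cgo_def)

text \<open>With a complex frequency vector, partial derivatives only change the constant in front;
  smoothness is then an induction in which this constant varies.\<close>

definition plane_exp :: "complex^2 \<Rightarrow> cfun" where
  "plane_exp z x = exp (\<Sum>i\<in>UNIV. z $ i * of_real (x $ i))"

lemma plane_exp_deriv:
  shows "((\<lambda>x::plane. c * plane_exp z x) has_derivative
     (\<lambda>h. (\<Sum>i\<in>UNIV. z $ i * of_real (h $ i)) * (c * plane_exp z x))) (at x)"
proof -
  have "((\<lambda>x::plane. \<Sum>i\<in>UNIV. z $ i * of_real (x $ i)) has_derivative (\<lambda>h. \<Sum>i\<in>UNIV. z $ i * of_real (h $ i))) (at x)"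
    by (intro has_derivative_sum has_derivative_mult_right has_derivative_of_real
        bounded_linear.has_derivative[OF bounded_linear_vec_nth] has_derivative_ident)
  moreover have "((\<lambda>w. c * exp w) has_derivative (*) (c * plane_exp z x)) (at (\<Sum>i\<in>UNIV. z $ i * of_real (x $ i)))"
    unfolding has_field_derivative_def[symmetric] plane_exp_def by (auto intro!: derivative_eq_intros)
  ultimately show ?thesis
    unfolding plane_exp_def using has_derivative_compose by (fastforce simp: mult.commute)
qed

lemma plane_exp_smooth:
  shows "smooth (\<lambda>x. c * plane_exp z x)"
    and "partial_deriv j (\<lambda>x. c * plane_exp z x) = (\<lambda>x. (z $ j * c) * plane_exp z x)"
proof -
  have pd: "partial_deriv j (\<lambda>x. c * plane_exp z x) = (\<lambda>x. (z $ j * c) * plane_exp z x)" for c j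
  proof (rule ext)
    fix x
    have "(\<Sum>i\<in>UNIV. z $ i * of_real (axis j 1 $ i)) = z $ j"
      by (simp add: axis_def if_distrib sum.delta cong: if_cong)
    then show "partial_deriv j (\<lambda>x. c * plane_exp z x) x = (z $ j * c) * plane_exp z x"
      using partial_deriv_eqI[OF plane_exp_deriv[of c z x], of j] by simp
  qed
  then show "partial_deriv j (\<lambda>x. c * plane_exp z x) = (\<lambda>x. (z $ j * c) * plane_exp z x)" .
  have "C_k n (\<lambda>x. c * plane_exp z x)" for n
  proof (induction n arbitrary: c)
    case 0
    show ?case
      unfolding C_k.simps(1) continuous_on_eq_continuous_at[OF open_UNIV]
      using has_derivative_continuous[OF plane_exp_deriv] by blast
  next
    case (Suc n)
    show ?case unfolding C_k.simps(2) pd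
      using Suc plane_exp_deriv unfolding differentiable_def by blast
  qed
  then show "smooth (\<lambda>x. c * plane_exp z x)" by (simp add: smooth_def)
qed

text \<open>\<open>\<omega>'\<close> is \<open>\<omega>\<close> turned by a right angle, so the
  mixed terms in the bilinear square of the frequency vector cancel and
  \<open>\<tau>^2 - (\<tau>^2 + k^2) = - k^2\<close> remains.\<close>

lemma helmholtz_solution_cgo:
  assumes "norm \<omega> = 1" "\<omega>' = vector [- \<omega> $ 2, \<omega> $ 1]"
  shows "helmholtz_solution k (cgo k \<omega> \<omega>' p \<tau>)"
proof -
  define s where "s = sqrt (\<tau>\<^sup>2 + k\<^sup>2)"
  have s2: "s * s = \<tau> * \<tau> + k * k" by (simp add: s_def flip: power2_eq_square)
  define z :: "complex^2" where "z = (\<chi> i. of_real (\<tau> * \<omega> $ i) + \<i> * of_real (s * \<omega>' $ i))"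
  define c where "c = exp (- (\<Sum>i\<in>UNIV. z $ i * of_real (p $ i)))"
  have w1: "\<omega> $ 1 * \<omega> $ 1 + \<omega> $ 2 * \<omega> $ 2 = 1"
    using assms(1) by (simp add: norm_eq_1 inner_vec_def sum_2)
  have eq: "cgo k \<omega> \<omega>' p \<tau> = (\<lambda>x. c * plane_exp z x)"
  proof (rule ext)
    fix x
    have "of_real (\<tau> * (\<omega> \<bullet> (x - p))) + \<i> * of_real (s * (\<omega>' \<bullet> (x - p)))
      = - (\<Sum>i\<in>UNIV. z $ i * of_real (p $ i)) + (\<Sum>i\<in>UNIV. z $ i * of_real (x $ i))"
      by (simp add: z_def inner_vec_def sum_2 algebra_simps)
    then show "cgo k \<omega> \<omega>' p \<tau> x = c * plane_exp z x"
      by (simp add: cgo_def c_def s_def plane_exp_def exp_add[symmetric])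
  qed
  have zz: "z $ 1 * z $ 1 + z $ 2 * z $ 2 = - of_real (k\<^sup>2)"
  proof -
    have "\<tau> * \<tau> * (\<omega> $ 1 * \<omega> $ 1 + \<omega> $ 2 * \<omega> $ 2) - s * s * (\<omega> $ 1 * \<omega> $ 1 + \<omega> $ 2 * \<omega> $ 2) = - (k * k)"
      unfolding w1 s2 by simp
    then show ?thesis
      by (simp add: z_def assms(2) complex_eq_iff power2_eq_square algebra_simps)
  qed
  show ?thesis
    unfolding helmholtz_solution_def eq
  proof (intro conjI allI plane_exp_smooth(1))
    fix x
    let ?e = "plane_exp z x"
    have "(\<Sum>i\<in>UNIV. partial_deriv i (partial_deriv i (\<lambda>x. c * plane_exp z x)) x)
      = (z $ 1 * z $ 1 + z $ 2 * z $ 2) * (c * ?e)"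
      unfolding plane_exp_smooth(2) by (simp add: sum_2 algebra_simps)
    then show "(\<Sum>i\<in>UNIV. partial_deriv i (partial_deriv i (\<lambda>x. c * plane_exp z x)) x)
      = - of_real (k\<^sup>2) * (c * ?e)" unfolding zz .
  qed
qed


section \<open>The corner asymptotics\<close>

lemma cgo_measurable: "cgo k \<omega> \<omega>' p \<tau> \<in> borel_measurable borel"
  unfolding cgo_def[abs_def] by (intro borel_measurable_continuous_onI continuous_intros)

lemma cgo_measurable_lebesgue: "cgo k \<omega> \<omega>' p \<tau> \<in> borel_measurable lebesgue"
  by (intro measurable_completion) (simp add: cgo_measurable)

lemma sector_borel:
  fixes u v p :: plane
  shows "{x. u \<bullet> (x - p) > 0 \<and> v \<bullet> (x - p) > 0} \<in> sets borel"
proof -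
  have "{x. u \<bullet> (x - p) > 0 \<and> v \<bullet> (x - p) > 0} = {x. 0 < u \<bullet> (x - p)} \<inter> {x. 0 < v \<bullet> (x - p)}" by auto
  moreover have "open {x::plane. 0 < \<zeta> \<bullet> (x - p)}" for \<zeta>
    by (intro open_Collect_less continuous_intros)
  ultimately show ?thesis by simp
qed

text \<open>Rescaling by \<open>1 / \<tau>\<close> about the apex \<open>p\<close> maps the sector to itself and freezes the density at \<open>p\<close>.\<close>

lemma sector_limit:
  fixes a b u v \<omega> \<omega>' p :: plane and h :: cfun
  assumes uv: "u \<bullet> a = 1" "u \<bullet> b = 0" "v \<bullet> a = 0" "v \<bullet> b = 1"
    and rep: "\<forall>x. x = (u \<bullet> x) *\<^sub>R a + (v \<bullet> x) *\<^sub>R b" and w: "\<omega> \<bullet> a < 0" "\<omega> \<bullet> b < 0"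
    and hm: "h \<in> borel_measurable borel" and hM: "\<And>x. cmod (h x) \<le> M" and hc: "isCont h p"
  obtains L where "L \<noteq> 0"
    "(\<lambda>n. (real (Suc n))\<^sup>2 *\<^sub>R (LINT x|lborel. indicator {x. u \<bullet> (x - p) > 0 \<and> v \<bullet> (x - p) > 0} x *\<^sub>R (h x * cgo k \<omega> \<omega>' p (real (Suc n)) x)))
      \<longlonglongrightarrow> h p * L"
proof -
  \<comment> \<open>\<open>\<Phi>\<close> maps the open first quadrant onto the sector with apex 0,
    and the dual basis gives its inverse \<open>g\<close>.\<close>
  define \<Phi> :: "plane \<Rightarrow> plane" where "\<Phi> y = y $ 1 *\<^sub>R a + y $ 2 *\<^sub>R b" for y
  define g :: "plane \<Rightarrow> plane" where "g x = vector [u \<bullet> x, v \<bullet> x]" for x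
  have lin: "linear \<Phi>" "linear g"
    by (auto intro!: linearI simp: \<Phi>_def g_def vec_eq_iff forall_2 algebra_simps inner_add_right)
  have u\<Phi>: "u \<bullet> \<Phi> y = y $ 1" "v \<bullet> \<Phi> y = y $ 2" for y
    using uv by (auto simp: \<Phi>_def inner_add_right)
  have inv: "\<Phi> (g x) = x" "g (\<Phi> x) = x" for x
  proof -
    show "\<Phi> (g x) = x" using rep[rule_format, of x] by (simp add: \<Phi>_def g_def)
    show "g (\<Phi> x) = x" by (simp add: g_def u\<Phi> vec_eq_iff forall_2)
  qed
  obtain \<kappa> where \<kappa>: "\<kappa> > 0" "lborel = density (distr lborel borel \<Phi>) (\<lambda>_. ennreal \<kappa>)"
    using lborel_linear[OF lin inv] by blast
  have \<Phi>c: "continuous_on UNIV \<Phi>"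
    using lin(1) by (intro linear_continuous_on) (simp add: linear_linear)
  then have \<Phi>m [measurable]: "\<Phi> \<in> borel_measurable borel" by (rule borel_measurable_continuous_onI)
  define Q where "Q = {y::plane. \<forall>e\<in>Basis. 0 < y \<bullet> e}"
  have Q: "y \<in> Q \<longleftrightarrow> y $ 1 > 0 \<and> y $ 2 > 0" for y
    by (simp add: Q_def Basis_vec_def inner_axis forall_2)
  have Qm [measurable]: "Q \<in> sets borel"
  proof -
    have "Q = {y. 0 < y $ 1} \<inter> {y. 0 < y $ 2}" using Q by auto
    moreover have "open {y::plane. 0 < y $ i}" for i
      by (intro open_Collect_less continuous_intros)
    ultimately show ?thesis by simp
  qed
  \<comment> \<open>The exponents of the limit integrand along the two edges; their real parts are
    negative since \<open>\<omega>\<close> is, so the integral over the quadrant converges.\<close>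
  define c where "c e = complex_of_real (\<omega> \<bullet> \<Phi> e) + \<i> * of_real (\<omega>' \<bullet> \<Phi> e)" for e
  have Rec: "Re (c e) < 0" if "e \<in> Basis" for e
  proof -
    have "e = axis 1 1 \<or> e = axis 2 1" using that by (auto simp: Basis_vec_def exhaust_2) (metis exhaust_2)
    then show ?thesis using w by (auto simp: c_def \<Phi>_def axis_def)
  qed
  have expand: "\<zeta> \<bullet> \<Phi> y = (\<Sum>e\<in>Basis. (y \<bullet> e) * (\<zeta> \<bullet> \<Phi> e))" for \<zeta> y
  proof -
    have "\<Phi> y = (\<Sum>e\<in>Basis. (y \<bullet> e) *\<^sub>R \<Phi> e)"
      by (subst euclidean_representation[symmetric, of y]) (simp only: linear_sum[OF lin(1)] linear_scale[OF lin(1)])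
    then show ?thesis by (simp add: inner_sum_right)
  qed
  have csum: "(\<Sum>e\<in>Basis. c e * of_real (y \<bullet> e)) = of_real (\<omega> \<bullet> \<Phi> y) + \<i> * of_real (\<omega>' \<bullet> \<Phi> y)" for y
    unfolding expand[of \<omega> y] expand[of \<omega>' y] c_def by (simp add: sum.distrib sum_distrib_left algebra_simps)
  define F where "F y = indicator Q y *\<^sub>R exp (complex_of_real (\<omega> \<bullet> \<Phi> y) + \<i> * of_real (\<omega>' \<bullet> \<Phi> y))" for y
  have F: "integrable lborel F" "(LINT y|lborel. F y) = (\<Prod>e\<in>Basis. - 1 / c e)"
    using orthant_exp_integral[of c, OF Rec] unfolding F_def[abs_def] Q_def csum by blast+
  have "c e \<noteq> 0" if "e \<in> Basis" for e using Rec[OF that] by auto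
  then have F0: "(LINT y|lborel. F y) \<noteq> 0" unfolding F(2) by simp
  let ?S = "{x. u \<bullet> (x - p) > 0 \<and> v \<bullet> (x - p) > 0}"
  note Sm = sector_borel[of u p v]
  define q where "q n y = p + (1 / real (Suc n)) *\<^sub>R \<Phi> y" for n y
  \<comment> \<open>\<open>\<sigma> n\<close> is \<open>sqrt (\<tau>^2 + k^2) / \<tau>\<close> for
    \<open>\<tau> = real (Suc n)\<close> and tends to 1, so \<open>k\<close> disappears in the
    limit.\<close>
  define \<sigma> where "\<sigma> n = sqrt (1 + k\<^sup>2 * (1 / real (Suc n))\<^sup>2)" for n
  define f where "f n y = indicator Q y *\<^sub>R (h (q n y) * exp (complex_of_real (\<omega> \<bullet> \<Phi> y) + \<i> * of_real (\<sigma> n * (\<omega>' \<bullet> \<Phi> y))))" for n y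
  have scaled: "(real (Suc n))\<^sup>2 *\<^sub>R (LINT x|lborel. indicator ?S x *\<^sub>R (h x * cgo k \<omega> \<omega>' p (real (Suc n)) x))
      = \<kappa> *\<^sub>R (LINT y|lborel. f n y)" for n
  proof -
    define N where "N = real (Suc n)"
    have N: "N > 0" by (simp add: N_def)
    let ?G = "\<lambda>x. indicator ?S x *\<^sub>R (h x * cgo k \<omega> \<omega>' p N x)"
    have Gm: "?G \<in> borel_measurable borel"
      using hm cgo_measurable Sm by (intro borel_measurable_scaleR borel_measurable_indicator borel_measurable_times)
    have Gm': "(\<lambda>x. ?G (p + (1 / N) *\<^sub>R x)) \<in> borel_measurable borel"
      by (rule measurable_compose[OF _ Gm]) measurable
    have sqN: "sqrt (N\<^sup>2 + k\<^sup>2) = N * \<sigma> n"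
    proof -
      have "N\<^sup>2 + k\<^sup>2 = N\<^sup>2 * (1 + k\<^sup>2 * (1 / N)\<^sup>2)" using N by (simp add: field_simps)
      then show ?thesis using N by (simp add: real_sqrt_mult \<sigma>_def N_def)
    qed
    have "?G (p + (1 / N) *\<^sub>R \<Phi> y) = f n y" for y
    proof -
      have "p + (1 / N) *\<^sub>R \<Phi> y \<in> ?S \<longleftrightarrow> y \<in> Q"
        unfolding Q using N by (simp add: u\<Phi> zero_less_divide_iff)
      moreover have "cgo k \<omega> \<omega>' p N (p + (1 / N) *\<^sub>R \<Phi> y) = exp (complex_of_real (\<omega> \<bullet> \<Phi> y) + \<i> * of_real (\<sigma> n * (\<omega>' \<bullet> \<Phi> y)))"
        unfolding cgo_def sqN using N by simp
      moreover have "q n y = p + (1 / N) *\<^sub>R \<Phi> y" by (simp add: q_def N_def)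
      ultimately show ?thesis by (simp only: f_def indicator_def)
    qed
    \<comment> \<open>In dimension two the dilation contributes the square of \<open>1 / N\<close>,
      which cancels the factor in front; \<open>\<Phi>\<close> contributes
      \<open>\<kappa>\<close>.\<close>
    moreover have "(LINT x|lborel. ?G x) = (1 / N)\<^sup>2 *\<^sub>R (\<kappa> *\<^sub>R (LINT y|lborel. ?G (p + (1 / N) *\<^sub>R \<Phi> y)))"
    proof -
      have "(LINT x|lborel. ?G x) = \<bar>1 / N\<bar> ^ DIM(plane) *\<^sub>R (LINT x|lborel. ?G (p + (1 / N) *\<^sub>R x))"
        by (rule lborel_integral_affine[OF _ Gm]) (use N in simp)
      also have "(LINT x|lborel. ?G (p + (1 / N) *\<^sub>R x)) = \<kappa> *\<^sub>R (LINT y|lborel. ?G (p + (1 / N) *\<^sub>R \<Phi> y))"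
        by (rule integral_density_distr_const[OF \<kappa>(1) \<Phi>m Gm' \<kappa>(2)])
      finally show ?thesis using N by simp
    qed
    ultimately show ?thesis using N unfolding N_def[symmetric] by (simp add: power_one_over)
  qed
  \<comment> \<open>The moduli of the exponentials do not depend on \<open>\<sigma> n\<close>, so
    one dominating function serves all \<open>n\<close>.\<close>
  have lim: "(\<lambda>n. LINT y|lborel. f n y) \<longlonglongrightarrow> (LINT y|lborel. h p * F y)"
  proof (rule integral_dominated_convergence[where w = "\<lambda>y. M * norm (F y)"])
    show "integrable lborel (\<lambda>y. M * norm (F y))" using F(1) by simp
    show "(\<lambda>y. h p * F y) \<in> borel_measurable lborel" using F(1) by simp
    show "f n \<in> borel_measurable lborel" for n
    proof -
      have hq: "(\<lambda>y. h (q n y)) \<in> borel_measurable borel"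
        unfolding q_def by (rule measurable_compose[OF _ hm]) measurable
      have em: "(\<lambda>y. exp (complex_of_real (\<omega> \<bullet> \<Phi> y) + \<i> * of_real (\<sigma> n * (\<omega>' \<bullet> \<Phi> y)))) \<in> borel_measurable borel"
        by (intro borel_measurable_continuous_onI continuous_intros \<Phi>c)
      have "(\<lambda>y. indicator Q y *\<^sub>R (h (q n y) * exp (complex_of_real (\<omega> \<bullet> \<Phi> y) + \<i> * of_real (\<sigma> n * (\<omega>' \<bullet> \<Phi> y))))) \<in> borel_measurable borel"
        by (intro borel_measurable_scaleR borel_measurable_indicator Qm borel_measurable_times[OF hq em])
      then show ?thesis by (simp add: f_def[abs_def])
    qed
    show "AE y in lborel. norm (f n y) \<le> M * norm (F y)" for n
    proof (rule AE_I2)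
      fix y
      have "cmod (h (q n y)) * exp (\<omega> \<bullet> \<Phi> y) \<le> M * exp (\<omega> \<bullet> \<Phi> y)"
        by (intro mult_right_mono hM) simp
      then show "norm (f n y) \<le> M * norm (F y)"
        by (simp add: f_def F_def norm_mult indicator_def)
    qed
    show "AE y in lborel. (\<lambda>n. f n y) \<longlonglongrightarrow> h p * F y"
    proof (rule AE_I2)
      fix y
      have inv0: "(\<lambda>n. 1 / real (Suc n)) \<longlonglongrightarrow> 0" using LIMSEQ_inverse_real_of_nat by (simp add: inverse_eq_divide)
      have "(\<lambda>n. q n y) \<longlonglongrightarrow> p + 0 *\<^sub>R \<Phi> y" unfolding q_def by (intro tendsto_intros inv0)
      then have "(\<lambda>n. q n y) \<longlonglongrightarrow> p" by simp
      then have "(\<lambda>n. h (q n y)) \<longlonglongrightarrow> h p" by (rule isCont_tendsto_compose[OF hc])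
      moreover have "\<sigma> \<longlonglongrightarrow> sqrt (1 + k\<^sup>2 * 0\<^sup>2)" unfolding \<sigma>_def by (intro tendsto_intros inv0)
      then have "\<sigma> \<longlonglongrightarrow> 1" by simp
      ultimately have "(\<lambda>n. f n y) \<longlonglongrightarrow> indicator Q y *\<^sub>R (h p * exp (complex_of_real (\<omega> \<bullet> \<Phi> y) + \<i> * of_real (1 * (\<omega>' \<bullet> \<Phi> y))))"
        unfolding f_def by (intro tendsto_intros)
      then show "(\<lambda>n. f n y) \<longlonglongrightarrow> h p * F y" by (simp add: F_def)
    qed
  qed
  show thesis
  proof (rule that[of "of_real \<kappa> * (LINT y|lborel. F y)"])
    show "of_real \<kappa> * (LINT y|lborel. F y) \<noteq> 0" using \<kappa> F0 by simp
    have "(\<lambda>n. \<kappa> *\<^sub>R (LINT y|lborel. f n y)) \<longlonglongrightarrow> \<kappa> *\<^sub>R (LINT y|lborel. h p * F y)"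
      by (intro tendsto_intros lim)
    moreover have "\<kappa> *\<^sub>R (LINT y|lborel. h p * F y) = h p * (of_real \<kappa> * (LINT y|lborel. F y))"
      by (simp add: scaleR_conv_of_real mult_ac)
    ultimately show "(\<lambda>n. (real (Suc n))\<^sup>2 *\<^sub>R (LINT x|lborel. indicator ?S x *\<^sub>R (h x * cgo k \<omega> \<omega>' p (real (Suc n)) x)))
      \<longlonglongrightarrow> h p * (of_real \<kappa> * (LINT y|lborel. F y))" unfolding scaled by simp
  qed
qed

text \<open>Where \<open>f\<close> does not vanish, the modulus of the solution is at most
  \<open>exp (- d * N)\<close>, which beats the factor \<open>N^2\<close>.\<close>

lemma cgo_tail:
  assumes f: "integrable lebesgue f" and d: "d > 0" and E: "\<And>x. f x \<noteq> 0 \<Longrightarrow> \<omega> \<bullet> (x - p) \<le> - d"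
  shows "(\<lambda>n. (real (Suc n))\<^sup>2 *\<^sub>R (LINT x|lebesgue. f x * cgo k \<omega> \<omega>' p (real (Suc n)) x)) \<longlonglongrightarrow> 0"
proof (rule Lim_null_comparison)
  let ?I = "LINT x|lebesgue. cmod (f x)"
  have bound: "cmod (f x * cgo k \<omega> \<omega>' p N x) \<le> exp (- d * N) * cmod (f x)" if "N > 0" for N x
  proof (cases "f x = 0")
    case False
    then have "N * (\<omega> \<bullet> (x - p)) \<le> N * (- d)" using E that by (intro mult_left_mono) auto
    then have "exp (N * (\<omega> \<bullet> (x - p))) \<le> exp (- d * N)" by (simp add: mult.commute)
    then have "exp (N * (\<omega> \<bullet> (x - p))) * cmod (f x) \<le> exp (- d * N) * cmod (f x)"
      by (rule mult_right_mono) simp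
    then show ?thesis unfolding norm_mult norm_cgo by (subst mult.commute)
  qed simp
  have int: "integrable lebesgue (\<lambda>x. f x * cgo k \<omega> \<omega>' p N x)" if "N > 0" for N
  proof (rule Bochner_Integration.integrable_bound)
    show "integrable lebesgue (\<lambda>x. exp (- d * N) * cmod (f x))" using f by simp
    show "(\<lambda>x. f x * cgo k \<omega> \<omega>' p N x) \<in> borel_measurable lebesgue"
      by (rule borel_measurable_times[OF borel_measurable_integrable[OF f] cgo_measurable_lebesgue])
    show "AE x in lebesgue. norm (f x * cgo k \<omega> \<omega>' p N x) \<le> norm (exp (- d * N) * cmod (f x))"
      using bound[OF that] by (intro AE_I2) simp
  qed
  have "norm ((real (Suc n))\<^sup>2 *\<^sub>R (LINT x|lebesgue. f x * cgo k \<omega> \<omega>' p (real (Suc n)) x))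
      \<le> ((real (Suc n))\<^sup>2 * exp (- d * real (Suc n))) * ?I" for n
  proof -
    have "cmod (LINT x|lebesgue. f x * cgo k \<omega> \<omega>' p (real (Suc n)) x) \<le> (LINT x|lebesgue. cmod (f x * cgo k \<omega> \<omega>' p (real (Suc n)) x))"
      by (rule integral_norm_bound)
    also have "\<dots> \<le> (LINT x|lebesgue. exp (- d * real (Suc n)) * cmod (f x))"
      using f int[of "real (Suc n)"] bound[of "real (Suc n)"] by (intro integral_mono integrable_norm) auto
    also have "\<dots> = exp (- d * real (Suc n)) * ?I" by simp
    finally show ?thesis by (simp add: mult.assoc mult_left_mono)
  qed
  then show "\<forall>\<^sub>F n in sequentially. norm ((real (Suc n))\<^sup>2 *\<^sub>R (LINT x|lebesgue. f x * cgo k \<omega> \<omega>' p (real (Suc n)) x))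
      \<le> ((real (Suc n))\<^sup>2 * exp (- d * real (Suc n))) * ?I" by simp
  have "filterlim (\<lambda>n. d * real (Suc n)) at_top sequentially"
    using d by (intro filterlim_tendsto_pos_mult_at_top[OF tendsto_const]
        filterlim_compose[OF filterlim_real_sequentially filterlim_Suc])
  from filterlim_compose[OF tendsto_power_div_exp_0[of 2] this]
  have "(\<lambda>n. (1 / d\<^sup>2 * ?I) * ((d * real (Suc n))\<^sup>2 / exp (d * real (Suc n)))) \<longlonglongrightarrow> (1 / d\<^sup>2 * ?I) * 0"
    by (intro tendsto_mult tendsto_const)
  moreover have "(1 / d\<^sup>2 * ?I) * ((d * N)\<^sup>2 / exp (d * N)) = (N\<^sup>2 * exp (- d * N)) * ?I" for N
    using d by (simp add: exp_minus field_simps power_mult_distrib)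
  ultimately show "(\<lambda>n. ((real (Suc n))\<^sup>2 * exp (- d * real (Suc n))) * ?I) \<longlonglongrightarrow> 0" by simp
qed

lemma compact_negative_bound:
  fixes K :: "'a::euclidean_space set"
  assumes "compact K" "\<And>x. x \<in> K \<Longrightarrow> \<omega> \<bullet> (x - p) < 0"
  shows "\<exists>d>0. \<forall>x\<in>K. \<omega> \<bullet> (x - p) \<le> - d"
proof (cases "K = {}")
  case False
  have "continuous_on K (\<lambda>x. \<omega> \<bullet> (x - p))" by (intro continuous_intros)
  then obtain y where y: "y \<in> K" "\<forall>x\<in>K. \<omega> \<bullet> (x - p) \<le> \<omega> \<bullet> (y - p)"
    using continuous_attains_sup[OF assms(1) False] by blast
  then show ?thesis using assms(2)[of y] by (intro exI[of _ "- (\<omega> \<bullet> (y - p))"]) simp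
qed (use zero_less_one in blast)

text \<open>Extension by zero gives the globally Borel and bounded density that
  \<open>sector_limit\<close> requires and changes nothing near \<open>p\<close>, where the Hoelder
  bound gives continuity.\<close>

lemma holder_on_ball_extension:
  assumes h: "holder_on \<alpha> (cball p \<eta>) f" and \<alpha>: "0 < \<alpha>" and r: "0 < r" "r \<le> \<eta>"
  defines "g \<equiv> \<lambda>x. indicator (ball p r) x *\<^sub>R f x"
  shows "g \<in> borel_measurable borel" "\<exists>M. \<forall>x. cmod (g x) \<le> M" "isCont g p"
proof -
  obtain C where C: "\<And>x y. x \<in> cball p \<eta> \<Longrightarrow> y \<in> cball p \<eta> \<Longrightarrow> cmod (f x - f y) \<le> C * dist x y powr \<alpha>"
    using h unfolding holder_on_def by blast
  have sub: "ball p r \<subseteq> cball p \<eta>" using r by auto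
  have cont: "isCont f x" if x: "x \<in> ball p r" for x
    unfolding isCont_def
  proof (rule LIM_zero_cancel, rule Lim_null_comparison)
    have "((\<lambda>y. C * dist y x powr \<alpha>) \<longlongrightarrow> C * dist x x powr \<alpha>) (at x)"
      using \<alpha> by (intro tendsto_intros tendsto_powr') auto
    then show "((\<lambda>y. C * dist y x powr \<alpha>) \<longlongrightarrow> 0) (at x)" by simp
    have "\<forall>\<^sub>F y in at x. y \<in> ball p r" using x by (intro eventually_at_in_open') auto
    then show "\<forall>\<^sub>F y in at x. norm (f y - f x) \<le> C * dist y x powr \<alpha>"
      by eventually_elim (use C x sub in blast)
  qed
  then have "continuous_on (ball p r) f" by (simp add: continuous_at_imp_continuous_on)
  then show "g \<in> borel_measurable borel"
    unfolding g_def by (intro borel_measurable_continuous_on_indicator) auto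
  show "\<exists>M. \<forall>x. cmod (g x) \<le> M"
  proof (intro exI allI)
    fix x
    show "cmod (g x) \<le> cmod (f p) + \<bar>C\<bar> * \<eta> powr \<alpha>"
    proof (cases "x \<in> ball p r")
      case True
      have "cmod (f x) \<le> cmod (f p) + cmod (f x - f p)" by (rule norm_triangle_sub)
      also have "cmod (f x - f p) \<le> C * dist x p powr \<alpha>" using True sub r by (intro C) auto
      also have "\<dots> \<le> \<bar>C\<bar> * \<eta> powr \<alpha>"
        using True r \<alpha> by (intro mult_mono powr_mono2) (auto simp: dist_commute)
      finally show ?thesis using True by (simp add: g_def)
    qed (simp add: g_def)
  qed
  have "\<forall>\<^sub>F x in nhds p. f x = g x"
    using eventually_nhds_in_open[of "ball p r" p] r by (auto simp: g_def elim!: eventually_mono)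
  then show "isCont g p" using cont[of p] r isCont_cong by fastforce
qed

lemma source_eq_lebesgue:
  "D \<in> sets lebesgue \<Longrightarrow> source D \<rho> w = (LINT x|lebesgue. (indicator D x *\<^sub>R \<rho> x) * w x)"
  unfolding source_def by (subst integral_restrict_space) auto

definition nonzero_corner :: "plane set \<Rightarrow> cfun \<Rightarrow> plane \<Rightarrow> bool" where
  "nonzero_corner D \<rho> p \<longleftrightarrow> (\<exists>\<eta>>0. \<exists>\<alpha> \<rho>'. 0 < \<alpha> \<and> \<alpha> \<le> 1 \<and> holder_on \<alpha> (cball p \<eta>) \<rho>' \<and>
     (AE x in lebesgue. x \<in> ball p \<eta> \<inter> closure D \<longrightarrow> \<rho> x = \<rho>' x) \<and> \<rho>' p \<noteq> 0)"

lemma admissible_iff: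
  "admissible Om D \<rho> \<longleftrightarrow> (\<exists>ps. open_polygon ps D \<and> closure D \<subseteq> Om \<and> \<rho> \<in> L2 (lebesgue_on D) \<and>
     (\<forall>p\<in>set ps. nonzero_corner D \<rho> p))"
  unfolding admissible_def nonzero_corner_def ..

text \<open>The exponent is negative on the compact hull of the second polygon, since
  \<open>p\<close> lies off it, and on the first hull minus a disk around \<open>p\<close>;
  compactness bounds it away from 0 on both, so only the corner of \<open>D1\<close> survives at the
  scale \<open>N^2\<close>.\<close>

lemma no_separated_exposed_vertex:
  assumes P1: "open_polygon ps1 D1" and P2: "open_polygon ps2 D2"
    and p: "p \<in> set ps1" "p \<notin> convex hull (set ps2)"
    and ex: "\<forall>x\<in>convex hull (set ps1 \<union> set ps2). x \<noteq> p \<longrightarrow> \<omega>0 \<bullet> x < \<omega>0 \<bullet> p"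
    and \<rho>: "\<rho>1 \<in> L2 (lebesgue_on D1)" "\<rho>2 \<in> L2 (lebesgue_on D2)"
    and corner: "nonzero_corner D1 \<rho>1 p"
    and eq: "\<And>w. helmholtz_solution k w \<Longrightarrow> source D1 \<rho>1 w = source D2 \<rho>2 w"
  shows False
proof -
  obtain \<eta> \<alpha> \<rho>' where \<eta>: "\<eta> > 0" "0 < \<alpha>" "holder_on \<alpha> (cball p \<eta>) \<rho>'" "\<rho>' p \<noteq> 0"
    and ae: "AE x in lebesgue. x \<in> ball p \<eta> \<inter> closure D1 \<longrightarrow> \<rho>1 x = \<rho>' x"
    using corner unfolding nonzero_corner_def by blast
  note f1 = polygon_facts[OF P1] and f2 = polygon_facts[OF P2]
  \<comment> \<open>The strict inequality has to be tested at a point other than \<open>p\<close>;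
    the second polygon provides one, as its hull avoids \<open>p\<close>.\<close>
  have "\<omega>0 \<noteq> 0"
  proof
    assume "\<omega>0 = 0"
    have "hd ps2 \<in> set ps2" using P2 by (intro hd_in_set) (auto simp: open_polygon_def)
    then have y: "hd ps2 \<in> convex hull (set ps2)" "hd ps2 \<in> convex hull (set ps1 \<union> set ps2)"
      by (simp_all add: hull_inc)
    then have "hd ps2 \<noteq> p" using p(2) by blast
    then show False using bspec[OF ex y(2)] \<open>\<omega>0 = 0\<close> by simp
  qed
  define \<omega> where "\<omega> = \<omega>0 /\<^sub>R norm \<omega>0"
  have \<omega>1: "norm \<omega> = 1" using \<open>\<omega>0 \<noteq> 0\<close> by (simp add: \<omega>_def)
  have neg: "\<omega> \<bullet> (x - p) < 0" if "x \<in> convex hull (set ps1 \<union> set ps2)" "x \<noteq> p" for x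
    using bspec[OF ex that(1)] that(2) \<open>\<omega>0 \<noteq> 0\<close> by (simp add: \<omega>_def inner_diff_right mult_less_0_iff)
  have hull: "convex hull (set ps1) \<subseteq> convex hull (set ps1 \<union> set ps2)"
    "convex hull (set ps2) \<subseteq> convex hull (set ps1 \<union> set ps2)" by (simp_all add: hull_mono)
  define \<omega>' :: plane where "\<omega>' = vector [- \<omega> $ 2, \<omega> $ 1]"
  let ?W = "\<lambda>n. cgo k \<omega> \<omega>' p (real (Suc n))"
  have W: "helmholtz_solution k (?W n)" for n by (rule helmholtz_solution_cgo[OF \<omega>1 \<omega>'_def])
  have neg1: "\<And>x. x \<in> convex hull (set ps1) \<Longrightarrow> x \<noteq> p \<Longrightarrow> \<omega> \<bullet> (x - p) < 0" using neg hull by blast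
  obtain a b u v r0 where r0: "r0 > 0" and uv: "u \<bullet> a = 1" "u \<bullet> b = 0" "v \<bullet> a = 0" "v \<bullet> b = 1"
    and rep: "\<forall>x. x = (u \<bullet> x) *\<^sub>R a + (v \<bullet> x) *\<^sub>R b" and w: "\<omega> \<bullet> a < 0" "\<omega> \<bullet> b < 0"
    and sector: "D1 \<inter> ball p r0 = {x \<in> ball p r0. u \<bullet> (x - p) > 0 \<and> v \<bullet> (x - p) > 0}"
    by (rule exposed_vertex_sector[OF P1 p(1) neg1])
  define r where "r = min r0 \<eta>"
  have r: "0 < r" "r \<le> \<eta>" "r \<le> r0" using r0 \<eta> by (auto simp: r_def)
  define h where "h x = indicator (ball p r) x *\<^sub>R \<rho>' x" for x
  have hm: "h \<in> borel_measurable borel" and hb: "\<exists>M. \<forall>x. cmod (h x) \<le> M" and hc: "isCont h p"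
    using holder_on_ball_extension[OF \<eta>(3,2) r(1,2)] unfolding h_def[abs_def] by blast+
  obtain M where M: "\<And>x. cmod (h x) \<le> M" using hb by blast
  have hp: "h p \<noteq> 0" using r \<eta> by (simp add: h_def)
  let ?S = "{x. u \<bullet> (x - p) > 0 \<and> v \<bullet> (x - p) > 0}"
  obtain L where L: "L \<noteq> 0" and limL:
    "(\<lambda>n. (real (Suc n))\<^sup>2 *\<^sub>R (LINT x|lborel. indicator ?S x *\<^sub>R (h x * ?W n x))) \<longlonglongrightarrow> h p * L"
    by (rule sector_limit[OF uv rep w hm M hc])
  have D: "D1 \<in> sets lebesgue" "D2 \<in> sets lebesgue" using f1(1) f2(1) by auto
  have intD: "integrable lebesgue (\<lambda>x. indicator D x *\<^sub>R \<rho> x)"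
    if "open D" "bounded D" "\<rho> \<in> L2 (lebesgue_on D)" for D and \<rho> :: cfun
    using L2_integrable[OF finite_measure_lebesgue_on[OF that(1,2)] that(3)] that(1)
    by (subst (asm) integrable_restrict_space) auto
  \<comment> \<open>\<open>g\<close> is the first source away from the vertex and \<open>g2\<close>
    the whole second source: the two parts that decay.\<close>
  define g where "g x = indicator (D1 - ball p r) x *\<^sub>R \<rho>1 x" for x
  define g2 where "g2 x = indicator D2 x *\<^sub>R \<rho>2 x" for x
  have gi: "integrable lebesgue g"
  proof -
    have "g = (\<lambda>x. indicator (- ball p r) x *\<^sub>R (indicator D1 x *\<^sub>R \<rho>1 x))" by (auto simp: g_def indicator_def)
    moreover have "- ball p r \<in> sets lebesgue" by auto
    ultimately show ?thesis using integrable_mult_indicator[OF _ intD[OF f1(1,2) \<rho>(1)]] by simp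
  qed
  have g2i: "integrable lebesgue g2" unfolding g2_def by (rule intD[OF f2(1,2) \<rho>(2)])
  have t1: "(\<lambda>n. (real (Suc n))\<^sup>2 *\<^sub>R (LINT x|lebesgue. g x * ?W n x)) \<longlonglongrightarrow> 0"
  proof -
    let ?K = "convex hull (set ps1) - ball p r"
    have "compact ?K" by (intro compact_diff finite_imp_compact_convex_hull) auto
    moreover have "\<omega> \<bullet> (x - p) < 0" if "x \<in> ?K" for x
    proof -
      have "x \<noteq> p" using that r(1) by auto
      then show ?thesis using that neg1[of x] by blast
    qed
    ultimately have "\<exists>d>0. \<forall>x\<in>?K. \<omega> \<bullet> (x - p) \<le> - d" by (rule compact_negative_bound)
    then obtain d where d: "d > 0" "\<forall>x\<in>?K. \<omega> \<bullet> (x - p) \<le> - d" by blast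
    show ?thesis
    proof (rule cgo_tail[OF gi d(1)])
      fix x assume "g x \<noteq> 0"
      then have "x \<in> ?K" using f1(4) by (auto simp: g_def indicator_def split: if_splits)
      then show "\<omega> \<bullet> (x - p) \<le> - d" using d(2) by blast
    qed
  qed
  have t2: "(\<lambda>n. (real (Suc n))\<^sup>2 *\<^sub>R (LINT x|lebesgue. g2 x * ?W n x)) \<longlonglongrightarrow> 0"
  proof -
    let ?K = "convex hull (set ps2)"
    have "compact ?K" by (intro finite_imp_compact_convex_hull) auto
    moreover have "\<omega> \<bullet> (x - p) < 0" if "x \<in> ?K" for x using that neg[of x] hull p(2) by blast
    ultimately have "\<exists>d>0. \<forall>x\<in>?K. \<omega> \<bullet> (x - p) \<le> - d" by (rule compact_negative_bound)
    then obtain d where d: "d > 0" "\<forall>x\<in>?K. \<omega> \<bullet> (x - p) \<le> - d" by blast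
    show ?thesis
    proof (rule cgo_tail[OF g2i d(1)])
      fix x assume "g2 x \<noteq> 0"
      then have "x \<in> ?K" using f2(4) by (auto simp: g2_def indicator_def split: if_splits)
      then show "\<omega> \<bullet> (x - p) \<le> - d" using d(2) by blast
    qed
  qed
  \<comment> \<open>On the hull of the first polygon the exponent is nonpositive, so the solutions
    have modulus at most 1 there.\<close>
  have Wint: "integrable lebesgue (\<lambda>x. f x * ?W n x)" if f: "integrable lebesgue f" "\<And>x. f x \<noteq> 0 \<Longrightarrow> x \<in> convex hull (set ps1)" for f n
  proof (rule Bochner_Integration.integrable_bound)
    show "integrable lebesgue (\<lambda>x. cmod (f x))" using f by simp
    show "(\<lambda>x. f x * ?W n x) \<in> borel_measurable lebesgue"
      by (rule borel_measurable_times[OF borel_measurable_integrable[OF f(1)] cgo_measurable_lebesgue])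
    show "AE x in lebesgue. norm (f x * ?W n x) \<le> norm (cmod (f x))"
    proof (rule AE_I2)
      fix x
      have "real (Suc n) * (\<omega> \<bullet> (x - p)) \<le> 0" if "f x \<noteq> 0"
        using neg1[OF f(2)[OF that]] by (cases "x = p") (auto intro!: mult_nonneg_nonpos)
      then show "norm (f x * ?W n x) \<le> norm (cmod (f x))"
        by (cases "f x = 0") (auto simp: norm_mult norm_cgo mult_left_le)
    qed
  qed
  \<comment> \<open>Reciprocity solved for the corner term: in the small disk \<open>D1\<close> is
    the sector and \<open>\<rho>1\<close> is \<open>h\<close> almost everywhere on it; outside the
    disk \<open>h\<close> vanishes and \<open>?f\<close> equals \<open>g\<close>.\<close>
  have main: "(LINT x|lborel. indicator ?S x *\<^sub>R (h x * ?W n x)) = (LINT x|lebesgue. g2 x * ?W n x) - (LINT x|lebesgue. g x * ?W n x)" for n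
  proof -
    let ?f = "\<lambda>x. indicator D1 x *\<^sub>R \<rho>1 x"
    have fi: "integrable lebesgue ?f" by (rule intD[OF f1(1,2) \<rho>(1)])
    have hull1: "x \<in> convex hull (set ps1)" if "indicator D1 x *\<^sub>R \<rho>1 x \<noteq> 0" for x
      using that f1(4) by (auto simp: indicator_def split: if_splits)
    have hull2: "x \<in> convex hull (set ps1)" if "g x \<noteq> 0" for x
      using that f1(4) by (auto simp: g_def indicator_def split: if_splits)
    have fW: "integrable lebesgue (\<lambda>x. ?f x * ?W n x)" by (rule Wint[OF fi hull1])
    have gW: "integrable lebesgue (\<lambda>x. g x * ?W n x)" by (rule Wint[OF gi hull2])
    note Sm = sector_borel[of u p v]
    have Gm: "(\<lambda>x. indicator ?S x *\<^sub>R (h x * ?W n x)) \<in> borel_measurable borel"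
      using hm cgo_measurable Sm by (intro borel_measurable_scaleR borel_measurable_indicator borel_measurable_times)
    have "(LINT x|lborel. indicator ?S x *\<^sub>R (h x * ?W n x)) = (LINT x|lebesgue. indicator ?S x *\<^sub>R (h x * ?W n x))"
      using Gm by (intro integral_completion[symmetric]) simp
    also have "\<dots> = (LINT x|lebesgue. ?f x * ?W n x - g x * ?W n x)"
    proof (rule integral_cong_AE)
      show "(\<lambda>x. indicator ?S x *\<^sub>R (h x * ?W n x)) \<in> borel_measurable lebesgue"
        using Gm by (intro measurable_completion) simp
      show "(\<lambda>x. ?f x * ?W n x - g x * ?W n x) \<in> borel_measurable lebesgue"
        using fW gW by simp
      show "AE x in lebesgue. indicator ?S x *\<^sub>R (h x * ?W n x) = ?f x * ?W n x - g x * ?W n x"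
        using ae
      proof eventually_elim
        case (elim x)
        show ?case
        proof (cases "x \<in> ball p r")
          case True
          have "x \<in> ball p r0" using True r by auto
          then have S: "x \<in> D1 \<longleftrightarrow> x \<in> ?S" using sector by blast
          have "x \<in> ball p \<eta>" using True r by auto
          then have "x \<in> D1 \<Longrightarrow> \<rho>1 x = \<rho>' x" using elim closure_subset[of D1] by blast
          then show ?thesis using True S by (cases "x \<in> D1") (simp_all add: h_def g_def)
        next
          case False
          then show ?thesis by (simp add: h_def g_def indicator_def)
        qed
      qed
    qed
    also have "\<dots> = (LINT x|lebesgue. ?f x * ?W n x) - (LINT x|lebesgue. g x * ?W n x)"
      by (rule Bochner_Integration.integral_diff[OF fW gW])
    also have "(LINT x|lebesgue. ?f x * ?W n x) = source D1 \<rho>1 (?W n)" by (simp add: source_eq_lebesgue D)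
    also have "\<dots> = source D2 \<rho>2 (?W n)" by (rule eq[OF W])
    also have "\<dots> = (LINT x|lebesgue. g2 x * ?W n x)" by (simp add: source_eq_lebesgue D g2_def)
    finally show ?thesis .
  qed
  have "(\<lambda>n. (real (Suc n))\<^sup>2 *\<^sub>R (LINT x|lborel. indicator ?S x *\<^sub>R (h x * ?W n x))) \<longlonglongrightarrow> 0 - 0"
    unfolding main scaleR_diff_right by (intro tendsto_diff t1 t2)
  then have "h p * L = 0" using LIMSEQ_unique[OF limL] by simp
  then show False using L hp by simp
qed

theorem corollary1:
  fixes Om D1 D2 :: "plane set" and k :: real
    and \<rho>1 \<rho>2 u1 u2 g :: cfun and N :: "cfun \<Rightarrow> complex"
  assumes "lipschitz_domain Om" and "k \<ge> 0"
    and "admissible Om D1 \<rho>1" and "admissible Om D2 \<rho>2"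
    and "weak_solution Om k (source D1 \<rho>1) u1"
    and "weak_solution Om k (source D2 \<rho>2) u2"
    and "has_cauchy_data Om k (source D1 \<rho>1) u1 (g, N)"
    and "has_cauchy_data Om k (source D2 \<rho>2) u2 (g, N)"
  shows "convex hull D1 = convex hull D2"
proof -
  obtain ps1 where P1: "open_polygon ps1 D1" "closure D1 \<subseteq> Om" "\<rho>1 \<in> L2 (lebesgue_on D1)"
    and V1: "\<forall>p\<in>set ps1. nonzero_corner D1 \<rho>1 p"
    using assms(3) unfolding admissible_iff by blast
  obtain ps2 where P2: "open_polygon ps2 D2" "closure D2 \<subseteq> Om" "\<rho>2 \<in> L2 (lebesgue_on D2)"
    and V2: "\<forall>p\<in>set ps2. nonzero_corner D2 \<rho>2 p"
    using assms(4) unfolding admissible_iff by blast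
  have eq: "source D1 \<rho>1 w = source D2 \<rho>2 w" if "helmholtz_solution k w" for w
    by (rule source_eq_of_cauchy_data[OF assms(1) that assms(7,8) polygon_facts(1)[OF P1(1)] P1(2)
          polygon_facts(1)[OF P2(1)] P2(2)])
  have "convex hull (set ps1) = convex hull (set ps2)"
  proof (rule ccontr)
    assume ne: "convex hull (set ps1) \<noteq> convex hull (set ps2)"
    obtain p \<omega> where p: "p \<in> set ps1 - convex hull (set ps2) \<or> p \<in> set ps2 - convex hull (set ps1)"
      and ex: "\<forall>x\<in>convex hull (set ps1 \<union> set ps2). x \<noteq> p \<longrightarrow> \<omega> \<bullet> x < \<omega> \<bullet> p"
      by (rule exposed_vertex_exists[OF finite_set finite_set ne])
    from p show False
    proof
      assume p: "p \<in> set ps1 - convex hull (set ps2)"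
      show False
        by (rule no_separated_exposed_vertex[OF P1(1) P2(1) _ _ ex P1(3) P2(3) _ eq]) (use p V1 in auto)
    next
      assume p: "p \<in> set ps2 - convex hull (set ps1)"
      \<comment> \<open>The joint hull is symmetric in the two vertex lists, so the argument applies
        with the two pairs exchanged.\<close>
      show False
        by (rule no_separated_exposed_vertex[OF P2(1) P1(1) _ _ ex[unfolded Un_commute[of "set ps1"]] P2(3) P1(3) _ eq[symmetric]])
           (use p V2 in auto)
    qed
  qed
  \<comment> \<open>Equal vertex hulls have equal interiors, and these are the hulls of the open
    polygons.\<close>
  then show ?thesis by (simp add: convex_hull_polygon[OF P1(1)] convex_hull_polygon[OF P2(1)])
qed

end
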